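(* Let $(X,d)$ be a metric space such that $\beta(X)<\infty$, where $$\beta(X)=\int_{X^3}\frac{\partial(z_1,z_2,z_3)}{d(\{z_1,z_2,z_3\})^3}\,d(\mathcal{H}^1)^3(z_1,z_2,z_3).$$ Then $X$ is rectifiable, that is, there are a set $E\subset\mathbb{R}$ and a Lipschitz function $f:E\to X$ such that $\mathcal{H}^1(X\setminus f(E))=0$.
   Context: $\mathcal{H}^1$ denotes the 1-dimensional Hausdorff measure on $X$, and $d(\{z_1,z_2,z_3\})$ denotes the diameter of the set $\{z_1,z_2,z_3\}$. For $z_1,z_2,z_3\in X$, $$\partial(z_1,z_2,z_3)=\min_{\sigma\in S_3}\left(d(z_{\sigma(1)},z_{\sigma(2)})+d(z_{\sigma(2)},z_{\sigma(3)})-d(z_{\sigma(1)},z_{\sigma(3)})\right),$$ where $S_3$ is the set of permutations of $\{1,2,3\}$. The integrand is taken to be $0$ when $z_1=z_2=z_3$. The integral with respect to $(\mathcal{H}^1)^3$ is understood as the iterated integral in $z_1,z_2,z_3$; no $\sigma$-finiteness of $\mathcal{H}^1$ is assumed. *)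

theory Defs
  imports "HOL-Analysis.Analysis" "HOL-Combinatorics.Permutations"
begin

section \<open>One-dimensional Hausdorff measure on a metric space\<close>

(* diameter is real-valued and carries no information on unbounded sets, so the members of a
   cover are required to be bounded.  The infimum is top if A has no admissible countable cover. *)
definition hausdorff1_delta :: "real \<Rightarrow> 'a::metric_space set \<Rightarrow> ennreal" where
  "hausdorff1_delta \<delta> A =
     (INF U \<in> {U :: nat \<Rightarrow> 'a set. A \<subseteq> (\<Union>i. U i) \<and> (\<forall>i. bounded (U i) \<and> diameter (U i) \<le> \<delta>)}.
        \<Sum>i. ennreal (diameter (U i)))"

(* The outer measure, defined on all subsets. *)
definition hausdorff1 :: "'a::metric_space set \<Rightarrow> ennreal" where
  "hausdorff1 A = (SUP \<delta> \<in> {0<..}. hausdorff1_delta \<delta> A)"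

(* The restriction to the Borel sets; emeasure_hausdorff1_measure below shows that it is a measure,
   so that measure_of does not fall back to its default value. *)
definition hausdorff1_measure :: "'a::metric_space measure" where
  "hausdorff1_measure = measure_of UNIV (sets borel) hausdorff1"


section \<open>The curvature functional\<close>

definition triangle_excess :: "'a::metric_space \<Rightarrow> 'a \<Rightarrow> 'a \<Rightarrow> real" where
  "triangle_excess z1 z2 z3 =
     (let z = (\<lambda>i::nat. if i = 1 then z1 else if i = 2 then z2 else z3) in
      Min ((\<lambda>\<sigma>. dist (z (\<sigma> 1)) (z (\<sigma> 2)) + dist (z (\<sigma> 2)) (z (\<sigma> 3)) - dist (z (\<sigma> 1)) (z (\<sigma> 3)))
           ` {\<sigma>. \<sigma> permutes {1, 2, 3}}))"

(* For z1 = z2 = z3 the integrand is 0, because x / 0 = 0.  The integrand is nonnegative, so ennreal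
   truncates nothing, and it is lower semicontinuous; by Fatou's lemma so are the inner integrals,
   hence all three integrands are Borel although hausdorff1_measure need not be sigma-finite. *)
definition menger_beta :: "'a::metric_space itself \<Rightarrow> ennreal" where
  "menger_beta _ =
     (\<integral>\<^sup>+ z1. \<integral>\<^sup>+ z2. \<integral>\<^sup>+ z3.
        ennreal (triangle_excess z1 z2 z3 / diameter {z1, z2, z3} ^ 3)
        \<partial>hausdorff1_measure \<partial>hausdorff1_measure \<partial>(hausdorff1_measure :: 'a measure))"


section \<open>Hausdorff measure is a measure on the Borel sets\<close>

lemma hausdorff1_delta_le:
  assumes "A \<subseteq> (\<Union>i. U i)" "\<And>i. bounded (U i)" "\<And>i. diameter (U i) \<le> \<delta>"
  shows "hausdorff1_delta \<delta> A \<le> (\<Sum>i. ennreal (diameter (U i)))"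
  unfolding hausdorff1_delta_def using assms by (intro INF_lower) auto

lemma hausdorff1_delta_mono: "A \<subseteq> B \<Longrightarrow> hausdorff1_delta \<delta> A \<le> hausdorff1_delta \<delta> B"
  unfolding hausdorff1_delta_def by (intro INF_superset_mono) auto

lemma hausdorff1_delta_antimono: "\<delta> \<le> \<epsilon> \<Longrightarrow> hausdorff1_delta \<epsilon> A \<le> hausdorff1_delta \<delta> A"
  unfolding hausdorff1_delta_def by (intro INF_superset_mono) (auto intro: order_trans)

lemma hausdorff1_delta_empty: "0 < \<delta> \<Longrightarrow> hausdorff1_delta \<delta> {} = 0"
  using hausdorff1_delta_le[of "{}" "\<lambda>_. {}" \<delta>] by simp

lemma hausdorff1_delta_countably_subadditive:
  fixes A :: "nat \<Rightarrow> 'a::metric_space set"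
  shows "hausdorff1_delta \<delta> (\<Union>n. A n) \<le> (\<Sum>n. hausdorff1_delta \<delta> (A n))"
proof (rule ennreal_le_epsilon)
  fix e :: real assume e: "0 < e" and fin: "(\<Sum>n. hausdorff1_delta \<delta> (A n)) < top"
  have "hausdorff1_delta \<delta> (A n) < hausdorff1_delta \<delta> (A n) + e * (1/2)^Suc n" for n
    using e fin by (auto simp add: less_top dest!: ennreal_suminf_lessD)
  then have "\<forall>n. \<exists>U. A n \<subseteq> (\<Union>i. U i) \<and> (\<forall>i. bounded (U i) \<and> diameter (U i) \<le> \<delta>) \<and>
      (\<Sum>i. ennreal (diameter (U i))) < hausdorff1_delta \<delta> (A n) + e * (1/2)^Suc n"
    unfolding hausdorff1_delta_def INF_less_iff by (simp add: conj_assoc)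
  then obtain B where B: "\<And>n. A n \<subseteq> (\<Union>i. B n i)" "\<And>n i. bounded (B n i)"
      "\<And>n i. diameter (B n i) \<le> \<delta>"
    and le: "\<And>n. (\<Sum>i. ennreal (diameter (B n i))) < hausdorff1_delta \<delta> (A n) + e * (1/2)^Suc n"
    by metis
  define C where "C = case_prod B o prod_decode"
  have C: "(\<Union>n. A n) \<subseteq> (\<Union>i. C i)"
    using B(1) by (auto simp add: C_def subset_eq) (metis prod.case prod_encode_inverse)
  have "hausdorff1_delta \<delta> (\<Union>n. A n) \<le> (\<Sum>i. ennreal (diameter (C i)))"
    using B by (intro hausdorff1_delta_le[OF C]) (auto simp: C_def split: prod.split)
  also have "\<dots> = (\<Sum>n. \<Sum>i. ennreal (diameter (B n i)))"
    using suminf_ennreal_2dimen[of "\<lambda>n. \<Sum>i. ennreal (diameter (B n i))"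
        "\<lambda>p. ennreal (diameter (case_prod B p))"]
    by (simp add: C_def)
  also have "\<dots> \<le> (\<Sum>n. hausdorff1_delta \<delta> (A n) + e * (1/2) ^ Suc n)"
    using le by (intro suminf_le) (auto intro: less_imp_le)
  also have "\<dots> = (\<Sum>n. hausdorff1_delta \<delta> (A n)) + (\<Sum>n. ennreal e * ennreal ((1/2) ^ Suc n))"
    using e by (subst suminf_add[symmetric])
      (auto simp del: ennreal_suminf_cmult simp add: ennreal_mult[symmetric])
  also have "\<dots> = (\<Sum>n. hausdorff1_delta \<delta> (A n)) + e"
    unfolding ennreal_suminf_cmult
    by (subst suminf_ennreal_eq[OF zero_le_power power_half_series]) auto
  finally show "hausdorff1_delta \<delta> (\<Union>n. A n) \<le> (\<Sum>n. hausdorff1_delta \<delta> (A n)) + e" .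
qed

lemma hausdorff1_delta_separated:
  assumes \<delta>: "0 < \<delta>" "\<delta> < r" and sep: "\<And>x y. x \<in> A \<Longrightarrow> y \<in> B \<Longrightarrow> r \<le> dist x y"
  shows "hausdorff1_delta \<delta> A + hausdorff1_delta \<delta> B \<le> hausdorff1_delta \<delta> (A \<union> B)"
  unfolding hausdorff1_delta_def[of \<delta> "A \<union> B"]
proof (rule INF_greatest, clarify)
  fix U :: "nat \<Rightarrow> 'a set"
  assume U: "A \<union> B \<subseteq> (\<Union>i. U i)" "\<forall>i. bounded (U i) \<and> diameter (U i) \<le> \<delta>"
  define V where "V C i = (if U i \<inter> C = {} then {} else U i)" for C i
  have V: "hausdorff1_delta \<delta> C \<le> (\<Sum>i. ennreal (diameter (V C i)))" if CAB: "C \<subseteq> A \<union> B" for C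
  proof (rule hausdorff1_delta_le)
    show "C \<subseteq> (\<Union>i. V C i)"
    proof
      fix x assume "x \<in> C"
      then obtain i where "x \<in> U i" using U(1) CAB by blast
      then have "x \<in> V C i" using \<open>x \<in> C\<close> by (auto simp: V_def)
      then show "x \<in> (\<Union>i. V C i)" by blast
    qed
  qed (use U \<delta> in \<open>auto simp: V_def\<close>)
  have disj: "U i \<inter> A = {} \<or> U i \<inter> B = {}" for i
  proof (rule ccontr)
    assume "\<not> ?thesis"
    then obtain x y where "x \<in> U i" "x \<in> A" "y \<in> U i" "y \<in> B" by blast
    then have "r \<le> dist x y" "dist x y \<le> \<delta>"
      using sep U(2) diameter_bounded_bound[of "U i" x y] by (auto intro: order_trans)
    then show False using \<delta> by simp
  qed
  have "hausdorff1_delta \<delta> A + hausdorff1_delta \<delta> B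
      \<le> (\<Sum>i. ennreal (diameter (V A i))) + (\<Sum>i. ennreal (diameter (V B i)))"
    by (intro add_mono V) auto
  also have "\<dots> = (\<Sum>i. ennreal (diameter (V A i)) + ennreal (diameter (V B i)))"
    by (rule suminf_add) auto
  also have "\<dots> \<le> (\<Sum>i. ennreal (diameter (U i)))"
    using disj by (intro suminf_le) (auto simp: V_def)
  finally show "hausdorff1_delta \<delta> A + hausdorff1_delta \<delta> B \<le> (\<Sum>i. ennreal (diameter (U i)))" .
qed

lemma hausdorff1_delta_le_hausdorff1: "0 < \<delta> \<Longrightarrow> hausdorff1_delta \<delta> A \<le> hausdorff1 A"
  unfolding hausdorff1_def by (rule SUP_upper) auto

lemma hausdorff1_empty [simp]: "hausdorff1 {} = 0"
proof -
  have "hausdorff1 {} \<le> 0"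
    unfolding hausdorff1_def by (rule SUP_least) (simp add: hausdorff1_delta_empty)
  then show ?thesis by simp
qed

lemma hausdorff1_mono: "A \<subseteq> B \<Longrightarrow> hausdorff1 A \<le> hausdorff1 B"
  unfolding hausdorff1_def by (intro SUP_mono) (auto intro: hausdorff1_delta_mono)

lemma hausdorff1_countably_subadditive: "hausdorff1 (\<Union>n. A n) \<le> (\<Sum>n. hausdorff1 (A n))"
  for A :: "nat \<Rightarrow> 'a::metric_space set"
proof -
  have "hausdorff1_delta \<delta> (\<Union>n. A n) \<le> (\<Sum>n. hausdorff1 (A n))" if "0 < \<delta>" for \<delta>
    using hausdorff1_delta_countably_subadditive[of \<delta> A] hausdorff1_delta_le_hausdorff1[OF that]
    by (auto intro!: suminf_le elim!: order_trans)
  then show ?thesis by (subst hausdorff1_def) (auto intro!: SUP_least)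
qed

lemma outer_measure_space_hausdorff1:
  "outer_measure_space UNIV (hausdorff1 :: 'a::metric_space set \<Rightarrow> ennreal)"
  by (auto simp: outer_measure_space_def positive_def increasing_def countably_subadditive_def
      intro: hausdorff1_mono hausdorff1_countably_subadditive)

lemma hausdorff1_Un_le: "hausdorff1 (A \<union> B) \<le> hausdorff1 A + hausdorff1 B"
  using hausdorff1_countably_subadditive[of "binaryset A B"]
    suminf_binaryset_eq[of hausdorff1 A B] by (simp add: UN_binaryset_eq)

lemma hausdorff1_separated:
  assumes "0 < r" and sep: "\<And>x y. x \<in> A \<Longrightarrow> y \<in> B \<Longrightarrow> r \<le> dist x y"
  shows "hausdorff1 A + hausdorff1 B \<le> hausdorff1 (A \<union> B)"
proof -
  have "hausdorff1 A + hausdorff1 B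
      = (SUP \<delta>\<in>{0<..}. hausdorff1_delta \<delta> A + hausdorff1_delta \<delta> B)"
    unfolding hausdorff1_def
  proof (rule SUP_add_directed_ennreal[symmetric])
    fix i j :: real assume ij: "i \<in> {0<..}" "j \<in> {0<..}"
    show "\<exists>k\<in>{0<..}. hausdorff1_delta i A + hausdorff1_delta j B
        \<le> hausdorff1_delta k A + hausdorff1_delta k B"
      using ij by (intro bexI[of _ "min i j"] add_mono hausdorff1_delta_antimono) auto
  qed
  also have "\<dots> \<le> hausdorff1 (A \<union> B)"
  proof (rule SUP_least)
    fix \<delta> :: real assume \<delta>: "\<delta> \<in> {0<..}"
    define k where "k = min \<delta> (r / 2)"
    have k: "0 < k" "k < r" "k \<le> \<delta>" using \<delta> assms(1) by (auto simp: k_def)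
    have "hausdorff1_delta \<delta> A + hausdorff1_delta \<delta> B \<le> hausdorff1_delta k A + hausdorff1_delta k B"
      using k by (intro add_mono hausdorff1_delta_antimono)
    also have "\<dots> \<le> hausdorff1_delta k (A \<union> B)"
      using k sep by (intro hausdorff1_delta_separated) auto
    also have "\<dots> \<le> hausdorff1 (A \<union> B)"
      using k by (intro hausdorff1_delta_le_hausdorff1)
    finally show "hausdorff1_delta \<delta> A + hausdorff1_delta \<delta> B \<le> hausdorff1 (A \<union> B)" .
  qed
  finally show ?thesis .
qed

lemma hausdorff1_closed_splits:
  fixes C A :: "'a::metric_space set"
  assumes C: "closed C"
  shows "hausdorff1 (A \<inter> C) + hausdorff1 (A - C) \<le> hausdorff1 A"
proof (cases "C = {} \<or> hausdorff1 A = top")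
  case True
  then show ?thesis by auto
next
  case False
  then have ne: "C \<noteq> {}" and fin: "hausdorff1 A \<noteq> top" by auto
  define a where "a n = 1 / real (Suc n)" for n
  have a_pos: "0 < a n" for n by (simp add: a_def)
  have a_anti: "a n \<le> a m" if "m \<le> n" for m n using that by (simp add: a_def frac_le)
  have a_strict: "a n < a m" if "m < n" for m n using that by (simp add: a_def frac_less2)
  define D where "D n = {x \<in> A. a n \<le> infdist x C}" for n
  define R where "R n = {x \<in> A. a (Suc n) \<le> infdist x C \<and> infdist x C < a n}" for n
  have sepR: "hausdorff1 (\<Union>k<n. R (2 * k + p)) = (\<Sum>k<n. hausdorff1 (R (2 * k + p)))"
    if "p \<le> 1" for n p
  proof (induction n)
    case (Suc n)
    define S where "S = (\<Union>k<n. R (2 * k + p))"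
    have eq: "(\<Union>k<Suc n. R (2 * k + p)) = S \<union> R (2 * n + p)"
      by (auto simp: S_def less_Suc_eq)
    have "hausdorff1 S + hausdorff1 (R (2 * n + p)) \<le> hausdorff1 (S \<union> R (2 * n + p))"
    proof (cases "n = 0")
      case True
      then show ?thesis by (simp add: S_def)
    next
      case False
      show ?thesis
      proof (rule hausdorff1_separated)
        show "0 < a (2 * n + p - 1) - a (2 * n + p)" using False a_strict by simp
        fix x y assume "x \<in> S" "y \<in> R (2 * n + p)"
        then obtain k where k: "k < n" "x \<in> R (2 * k + p)" by (auto simp: S_def)
        have "a (2 * n + p - 1) \<le> a (Suc (2 * k + p))" using k by (intro a_anti) auto
        also have "\<dots> \<le> infdist x C" using k by (simp add: R_def)
        also have "\<dots> \<le> infdist y C + dist x y" by (rule infdist_triangle)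
        also have "\<dots> \<le> a (2 * n + p) + dist x y" using \<open>y \<in> R (2 * n + p)\<close> by (simp add: R_def)
        finally show "a (2 * n + p - 1) - a (2 * n + p) \<le> dist x y" by simp
      qed
    qed
    then have "hausdorff1 (S \<union> R (2 * n + p)) = hausdorff1 S + hausdorff1 (R (2 * n + p))"
      by (intro antisym hausdorff1_Un_le)
    then show ?case using Suc by (simp add: eq S_def)
  qed simp
  have sumR: "(\<Sum>k. hausdorff1 (R (2 * k + p))) \<le> hausdorff1 A" if "p \<le> 1" for p
  proof (rule suminf_le_const)
    fix n
    have "(\<Sum>k<n. hausdorff1 (R (2 * k + p))) = hausdorff1 (\<Union>k<n. R (2 * k + p))"
      using sepR[OF that] by simp
    also have "\<dots> \<le> hausdorff1 A" by (rule hausdorff1_mono) (auto simp: R_def)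
    finally show "(\<Sum>k<n. hausdorff1 (R (2 * k + p))) \<le> hausdorff1 A" .
  qed auto
  have "(\<Sum>k. hausdorff1 (R k)) \<le> hausdorff1 A + hausdorff1 A"
  proof (rule suminf_le_const)
    fix n
    have "(\<Sum>k<n. hausdorff1 (R k)) \<le> (\<Sum>k<2*n. hausdorff1 (R k))"
      by (rule sum_mono2) auto
    also have "\<dots> = (\<Sum>k<n. hausdorff1 (R (2 * k + 0))) + (\<Sum>k<n. hausdorff1 (R (2 * k + 1)))"
      by (induction n) (simp_all add: ac_simps)
    also have "\<dots> \<le> (\<Sum>k. hausdorff1 (R (2 * k + 0))) + (\<Sum>k. hausdorff1 (R (2 * k + 1)))"
      by (intro add_mono sum_le_suminf) auto
    also have "\<dots> \<le> hausdorff1 A + hausdorff1 A"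
      by (intro add_mono sumR) auto
    finally show "(\<Sum>k<n. hausdorff1 (R k)) \<le> hausdorff1 A + hausdorff1 A" .
  qed auto
  then have finR: "(\<Sum>k. hausdorff1 (R k)) \<noteq> top" using fin by (auto simp: top_unique)
  have tail: "(\<lambda>n. \<Sum>k. hausdorff1 (R (k + n))) \<longlonglongrightarrow> 0"
  proof -
    have "(\<Sum>k. hausdorff1 (R (k + n))) = (\<Sum>k. hausdorff1 (R k)) - (\<Sum>k<n. hausdorff1 (R k))" for n
    proof -
      have "(\<Sum>k. hausdorff1 (R k)) = (\<Sum>k. hausdorff1 (R (k + n))) + (\<Sum>k<n. hausdorff1 (R k))"
        by (rule suminf_offset) auto
      moreover from this have "(\<Sum>k<n. hausdorff1 (R k)) \<noteq> top" using finR by auto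
      ultimately show ?thesis by simp
    qed
    moreover have "(\<lambda>n. (\<Sum>k. hausdorff1 (R k)) - (\<Sum>k<n. hausdorff1 (R k)))
        \<longlonglongrightarrow> (\<Sum>k. hausdorff1 (R k)) - (\<Sum>k. hausdorff1 (R k))"
      using finR by (intro tendsto_diff_ennreal tendsto_const summable_LIMSEQ) auto
    ultimately show ?thesis using finR by (simp add: top.not_eq_extremum)
  qed
  have step: "hausdorff1 (A \<inter> C) + hausdorff1 (A - C)
      \<le> hausdorff1 A + (\<Sum>k. hausdorff1 (R (k + n)))" for n
  proof -
    have "A - C \<subseteq> D n \<union> (\<Union>k. R (k + n))"
    proof
      fix x assume x: "x \<in> A - C"
      then have pos: "0 < infdist x C" using infdist_pos_not_in_closed[OF C ne] by auto
      then obtain m where m: "a m \<le> infdist x C"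
        unfolding a_def using nat_approx_posE by (metis less_imp_le)
      define l where "l = (LEAST m. a m \<le> infdist x C)"
      have l: "a l \<le> infdist x C" unfolding l_def using m by (rule LeastI)
      have lm: "infdist x C < a k" if "k < l" for k
        using not_less_Least[of k "\<lambda>m. a m \<le> infdist x C"] that by (auto simp: l_def)
      show "x \<in> D n \<union> (\<Union>k. R (k + n))"
      proof (cases "l \<le> n")
        case True
        then show ?thesis using x l a_anti[OF True] by (auto simp: D_def)
      next
        case False
        then obtain k where k: "l = Suc (k + n)"
          by (metis less_imp_Suc_add not_le add.commute)
        then have "x \<in> R (k + n)" using x l lm[of "k + n"] by (simp add: R_def)
        then show ?thesis by blast
      qed
    qed
    then have "hausdorff1 (A - C) \<le> hausdorff1 (D n \<union> (\<Union>k. R (k + n)))"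
      by (rule hausdorff1_mono)
    also have "\<dots> \<le> hausdorff1 (D n) + hausdorff1 (\<Union>k. R (k + n))"
      by (rule hausdorff1_Un_le)
    also have "\<dots> \<le> hausdorff1 (D n) + (\<Sum>k. hausdorff1 (R (k + n)))"
      by (intro add_left_mono hausdorff1_countably_subadditive)
    finally have "hausdorff1 (A \<inter> C) + hausdorff1 (A - C)
        \<le> (hausdorff1 (A \<inter> C) + hausdorff1 (D n)) + (\<Sum>k. hausdorff1 (R (k + n)))"
      by (simp add: add.assoc add_left_mono)
    also have "hausdorff1 (A \<inter> C) + hausdorff1 (D n) \<le> hausdorff1 (A \<inter> C \<union> D n)"
    proof (rule hausdorff1_separated[OF a_pos])
      fix x y assume "x \<in> A \<inter> C" "y \<in> D n"
      then show "a n \<le> dist x y"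
        using infdist_le[of x C y] by (auto simp: D_def dist_commute)
    qed
    also have "\<dots> \<le> hausdorff1 A" by (rule hausdorff1_mono) (auto simp: D_def)
    finally show ?thesis by (simp add: add_right_mono)
  qed
  have "(\<lambda>n. hausdorff1 A + (\<Sum>k. hausdorff1 (R (k + n)))) \<longlonglongrightarrow> hausdorff1 A + 0"
    by (intro tendsto_add tendsto_const tail)
  then show ?thesis
    using step by (intro LIMSEQ_le_const[where a = "hausdorff1 (A \<inter> C) + hausdorff1 (A - C)"]) auto
qed

lemma space_hausdorff1_measure [simp]: "space hausdorff1_measure = UNIV"
  by (simp add: hausdorff1_measure_def space_measure_of_conv)

lemma sets_hausdorff1_measure [simp, measurable_cong]: "sets hausdorff1_measure = sets borel"
  unfolding hausdorff1_measure_def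
  using sets.sigma_sets_eq[of "borel :: 'a measure"] by (simp add: sets_measure_of_conv)

lemma emeasure_hausdorff1_measure:
  fixes B :: "'a::metric_space set"
  assumes B: "B \<in> sets borel"
  shows "emeasure hausdorff1_measure B = hausdorff1 B"
proof -
  define L where "L = lambda_system UNIV UNIV (hausdorff1 :: 'a set \<Rightarrow> ennreal)"
  interpret P: sigma_algebra UNIV "UNIV :: 'a set set"
    using sigma_algebra_Pow[of "UNIV :: 'a set"] by (simp add: Pow_UNIV)
  have ms: "measure_space UNIV L hausdorff1"
    unfolding L_def by (rule P.caratheodory_lemma[OF outer_measure_space_hausdorff1])
  then interpret L: sigma_algebra UNIV L by (simp add: measure_space_def)
  have closed_L: "C \<in> L" if "closed C" for C
  proof -
    have "hausdorff1 (A \<inter> C) + hausdorff1 (A - C) = hausdorff1 A" for A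
      using hausdorff1_closed_splits[OF that, of A] hausdorff1_Un_le[of "A \<inter> C" "A - C"]
      by (simp add: Int_Diff_Un antisym)
    then show ?thesis by (simp add: L_def P.lambda_system_eq)
  qed
  have "sigma_sets UNIV {C :: 'a set. closed C} \<subseteq> L"
    using closed_L by (intro L.sigma_sets_subset) auto
  then have sub: "sets (borel :: 'a measure) \<subseteq> L"
    by (simp add: borel_eq_closed)
  have "countably_additive (sets (borel :: 'a measure)) hausdorff1"
    using ms sub unfolding measure_space_def countably_additive_def by blast
  moreover have "positive (sets (borel :: 'a measure)) hausdorff1"
    by (simp add: positive_def)
  ultimately have "measure_space UNIV (sets (borel :: 'a measure)) hausdorff1"
    using sets.sigma_algebra_axioms[of "borel :: 'a measure"] by (simp add: measure_space_def)
  then show ?thesis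
    unfolding hausdorff1_measure_def
    using B by (intro emeasure_measure_of_sigma) (auto simp: measure_space_def)
qed

end

theory Submission
  imports Defs
begin

text \<open>
  Call a set expanding if it carries a real function \<open>t\<close> with \<open>dist z z' \<le> \<bar>t z - t z'\<bar>\<close>; the inverse of \<open>t\<close> is
  then a Lipschitz parametrization.  Expanding sets are closed under countable unions.  Finiteness of \<open>\<beta>\<close>
  makes Hausdorff measure sigma-finite, so by exhaustion it suffices to find an expanding subset of positive measure
  in every Borel set of finite positive measure.

  Inside such a set there is a piece of mass between \<open>r0 / 2\<close> and \<open>r0\<close> in a ball of radius \<open>r0\<close> such that the
  curvature integral based at every point of the piece is tiny.  At the scales \<open>r k = r0 * (2/3) ^ k\<close> one builds
  finite lists of points, cut into segments, that approximate the points not yet recognized as sparse.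
  A new point is selected by Markov's inequality in a small ball, flat with its future neighbours, and is inserted
  next to an old point.  Its cost is an excess paid for by the curvature or, at the end of a segment, a multiple of
  \<open>r k\<close> paid for by cutting long edges.  So the total length stays bounded, and so does the number of segments
  weighted by scale.  A point around which the measure is sparse at some scale must lie near the end of a
  segment, hence sparse points carry at most half of the mass.  On the rest, a limit of the arc-length positions along
  the lists is expanding.
\<close>

section \<open>Excess of a triple\<close>

text \<open>The obstacle is that curvature is known only as an integral while the lower density of
  Hausdorff measure may vanish: a point in flat position with finitely many others can be selected
  only inside a ball of mass at least \<open>\<delta> * alpha * r k\<close>. Sparse points must
  therefore be estimated separately. There the curvature bound at every point of the piece, not
  merely on average, puts the sparse point itself in flat position with two dense regions. Constants
  are fixed in the order \<open>\<delta>\<close>, \<open>C2\<close>, \<open>C3\<close>,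
  \<open>\<eta>\<close>: the mass lost at sparse points is proportional to \<open>\<delta>\<close>,
  with a large factor from the 53 levels between a hole and the list that locates it, whereas every
  selection loses a factor \<open>1 / \<delta>\<close>, which only a smaller \<open>\<eta>\<close>
  repairs. Flatness is available only for triples with diameter comparable to \<open>r k\<close>,
  hence the cutting of edges longer than \<open>45 * r k\<close>. The ratio 2/3 keeps a new point
  within \<open>152/100 * r k\<close> of an old one, less than twice the separation, so that no
  point of the list lies between the two.\<close>

definition detour :: "'a::metric_space \<Rightarrow> 'a \<Rightarrow> 'a \<Rightarrow> real" where
  "detour x y z = dist x y + dist y z - dist x z"

text \<open>Each detour is twice a Gromov product and is invariant under reversal, so the six orders
  of a triple leave three values.\<close>

definition excess :: "'a::metric_space \<Rightarrow> 'a \<Rightarrow> 'a \<Rightarrow> real" where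
  "excess x y z = min (detour x y z) (min (detour x z y) (detour y x z))"

definition diam3 :: "'a::metric_space \<Rightarrow> 'a \<Rightarrow> 'a \<Rightarrow> real" where
  "diam3 x y z = max (dist x y) (max (dist y z) (dist x z))"

lemma excess_le_iff:
  "excess x y z \<le> t \<longleftrightarrow> detour x y z \<le> t \<or> detour x z y \<le> t \<or> detour y x z \<le> t"
  by (auto simp: excess_def min_le_iff_disj)

lemma excess_commute: "excess x y z = excess y x z" "excess x y z = excess x z y"
  unfolding excess_def detour_def by (simp_all add: dist_commute min_def)

lemma diam3_commute: "diam3 x y z = diam3 y x z" "diam3 x y z = diam3 x z y"
  unfolding diam3_def by (simp_all add: dist_commute max_def)

lemma detour_nonneg: "0 \<le> detour x y z"
  unfolding detour_def using dist_triangle[of x z y] by simp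

lemma excess_nonneg: "0 \<le> excess x y z"
  by (simp add: excess_def detour_nonneg)

lemma diam3_nonneg: "0 \<le> diam3 x y z"
  by (simp add: diam3_def le_max_iff_disj)

lemma excess_le_detour: "excess x y z \<le> detour x y z" "excess x y z \<le> detour x z y"
    "excess x y z \<le> detour y x z"
  by (simp_all add: excess_def)

lemma triangle_excess_eq: "triangle_excess x y z = excess x y z"
proof -
  let ?z = "\<lambda>i::nat. if i = 1 then x else if i = 2 then y else z"
  let ?f = "\<lambda>\<sigma>. detour (?z (\<sigma> 1)) (?z (\<sigma> 2)) (?z (\<sigma> 3))"
  let ?P = "{\<sigma>. \<sigma> permutes {1, 2, 3::nat}}"
  have fin: "finite (?f ` ?P)" by (intro finite_imageI finite_permutations) auto
  have te: "triangle_excess x y z = Min (?f ` ?P)"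
    unfolding triangle_excess_def Let_def detour_def ..
  have in1: "id \<in> ?P" by (simp add: permutes_id)
  have in2: "Transposition.transpose 2 3 \<in> ?P" "Transposition.transpose 1 2 \<in> ?P"
    by (auto intro!: permutes_swap_id)
  have "detour x y z \<in> ?f ` ?P"
    by (rule image_eqI[OF _ in1]) simp
  moreover have "detour x z y \<in> ?f ` ?P"
    by (rule image_eqI[OF _ in2(1)]) (simp add: Transposition.transpose_def)
  moreover have "detour y x z \<in> ?f ` ?P"
    by (rule image_eqI[OF _ in2(2)]) (simp add: Transposition.transpose_def)
  ultimately have le: "Min (?f ` ?P) \<le> excess x y z"
    using fin by (auto simp: excess_def)
  have ge: "excess x y z \<le> Min (?f ` ?P)"
  proof (rule Min.boundedI[OF fin])
    show "?f ` ?P \<noteq> {}" using in1 by blast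
    fix a assume "a \<in> ?f ` ?P"
    then obtain \<sigma> where s: "\<sigma> permutes {1, 2, 3::nat}" and a: "a = ?f \<sigma>" by auto
    have inj: "\<sigma> 1 \<noteq> \<sigma> 2" "\<sigma> 1 \<noteq> \<sigma> 3" "\<sigma> 2 \<noteq> \<sigma> 3"
      using permutes_inj[OF s] by (simp_all add: inj_eq)
    have "\<sigma> 1 \<in> {1,2,3}" "\<sigma> 2 \<in> {1,2,3}" "\<sigma> 3 \<in> {1,2,3}"
      using permutes_in_image[OF s] by auto
    then show "excess x y z \<le> a"
      unfolding a using inj
      by (elim insertE emptyE; simp add: excess_def detour_def dist_commute min_le_iff_disj)
  qed
  show ?thesis using te le ge by simp
qed

lemma diameter_triple: "diameter {x, y, z} = diam3 x y z"
proof (rule antisym)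
  show "diameter {x, y, z} \<le> diam3 x y z"
    unfolding diameter_def
    by (simp only: insert_not_empty if_False, rule cSUP_least)
       (auto simp: diam3_def dist_commute le_max_iff_disj)
  have b: "bounded {x, y, z}" by simp
  show "diam3 x y z \<le> diameter {x, y, z}"
    unfolding diam3_def
    using diameter_bounded_bound[OF b, of x y] diameter_bounded_bound[OF b, of y z]
      diameter_bounded_bound[OF b, of x z] by simp
qed

lemma dist_le_diam3: "dist x y \<le> diam3 x y z" "dist y z \<le> diam3 x y z" "dist x z \<le> diam3 x y z"
  by (simp_all add: diam3_def)

lemma diam3_pos: "x \<noteq> y \<or> y \<noteq> z \<or> x \<noteq> z \<Longrightarrow> 0 < diam3 x y z"
  by (auto simp: diam3_def less_max_iff_disj)

lemma excess_lipschitz: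
  "excess x y z \<le> excess x y' z' + 2 * dist y y' + 2 * dist z z'"
proof -
  have "detour x y z \<le> detour x y' z' + 2 * dist y y' + 2 * dist z z'"
    "detour x z y \<le> detour x z' y' + 2 * dist y y' + 2 * dist z z'"
    "detour y x z \<le> detour y' x z' + 2 * dist y y' + 2 * dist z z'"
    unfolding detour_def
    using dist_triangle[of x y y'] dist_triangle[of y z y'] dist_triangle[of y' z z']
      dist_triangle[of x z' z] dist_triangle[of x z z'] dist_triangle[of x y' y]
      dist_triangle[of z' y' z] dist_triangle[of z y' y]
      dist_triangle[of y' z' z] dist_triangle[of y' z y]
    by (auto simp: dist_commute)
  then show ?thesis by (auto simp: excess_def min_def split: if_splits)
qed

text \<open>Separation \<open>s\<close> against distances to \<open>p\<close> that differ by at most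
  \<open>s/2\<close> leaves one possible order in each flat triple with \<open>p\<close>: the point
  \<open>p\<close> is in the middle. Three points pairwise on opposite sides of \<open>p\<close>
  cannot be flat among themselves.\<close>

lemma three_in_one_bin:
  fixes p u v w :: "'a::metric_space"
  assumes flat: "excess p u v \<le> t" "excess p u w \<le> t" "excess p v w \<le> t" "excess u v w \<le> t"
    and sep: "s \<le> dist u v" "s \<le> dist u w" "s \<le> dist v w" "s \<le> dist p u" "s \<le> dist p v" "s \<le> dist p w"
    and bin: "\<bar>dist p u - dist p v\<bar> \<le> s/2" "\<bar>dist p u - dist p w\<bar> \<le> s/2" "\<bar>dist p v - dist p w\<bar> \<le> s/2"
    and t: "8 * t < s"
  shows False
proof -
  have far: "dist p a + dist p b - t \<le> dist a b"
    if "excess p a b \<le> t" "s \<le> dist a b" "\<bar>dist p a - dist p b\<bar> \<le> s/2" "0 \<le> t" for a b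
    using that t unfolding excess_le_iff detour_def by (auto simp: dist_commute)
  have t0: "0 \<le> t" using excess_nonneg[of p u v] flat by simp
  have "dist p u + dist p v - t \<le> dist u v" "dist p u + dist p w - t \<le> dist u w"
    "dist p v + dist p w - t \<le> dist v w"
    using far flat sep bin t0 by auto
  moreover have "dist u v \<le> dist p u + dist p v" "dist u w \<le> dist p u + dist p w" "dist v w \<le> dist p v + dist p w"
    by metric+
  ultimately show False
    using flat(4) sep t t0 unfolding excess_le_iff detour_def by (auto simp: dist_commute)
qed

section \<open>Lower semicontinuous functions\<close>

text \<open>The sequential form is the one that Fatou's lemma carries through an integral
  (\<open>lsc_nn_integral\<close>). It makes iterated integrals measurable before sigma-finiteness
  is known, when Tonelli's theorem cannot be applied.\<close>

definition lsc :: "('a::metric_space \<Rightarrow> ennreal) \<Rightarrow> bool" where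
  "lsc f \<longleftrightarrow> (\<forall>x s. s \<longlonglongrightarrow> x \<longrightarrow> f x \<le> liminf (\<lambda>n. f (s n)))"

lemma lscI: "(\<And>x s. s \<longlonglongrightarrow> x \<Longrightarrow> f x \<le> liminf (\<lambda>n. f (s n))) \<Longrightarrow> lsc f"
  by (auto simp: lsc_def)

lemma lscD: "lsc f \<Longrightarrow> s \<longlonglongrightarrow> x \<Longrightarrow> f x \<le> liminf (\<lambda>n. f (s n))"
  by (auto simp: lsc_def)

lemma lsc_closed_sublevel: assumes "lsc f" shows "closed {x. f x \<le> t}"
  unfolding closed_sequential_limits
proof (intro allI impI, elim conjE)
  fix s l assume s: "\<forall>n. s n \<in> {x. f x \<le> t}" "s \<longlonglongrightarrow> l"
  have "f l \<le> liminf (\<lambda>n. f (s n))" using lscD[OF assms s(2)] .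
  also have "\<dots> \<le> liminf (\<lambda>n. t)" using s by (intro Liminf_mono) auto
  also have "\<dots> = t" by (intro Liminf_const) auto
  finally show "l \<in> {x. f x \<le> t}" by simp
qed

lemma lsc_measurable [measurable_dest]: assumes "lsc f" shows "f \<in> borel_measurable borel"
  by (rule borel_measurableI_le) (use lsc_closed_sublevel[OF assms] in auto)

lemma lsc_open_superlevel: assumes "lsc f" shows "open {x. t < f x}"
proof -
  have "{x. t < f x} = - {x. f x \<le> t}" by auto
  then show ?thesis using lsc_closed_sublevel[OF assms] by (simp add: open_Compl)
qed

lemma lsc_compose:
  fixes f :: "'b::metric_space \<Rightarrow> ennreal" and g :: "'a::metric_space \<Rightarrow> 'b"
  assumes "lsc f" "continuous_on UNIV g" shows "lsc (\<lambda>x. f (g x))"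
proof (rule lscI)
  fix x :: 'a and s :: "nat \<Rightarrow> 'a" assume "s \<longlonglongrightarrow> x"
  then have "(\<lambda>n. g (s n)) \<longlonglongrightarrow> g x"
    using assms(2) by (auto intro: continuous_on_tendsto_compose)
  then show "f (g x) \<le> liminf (\<lambda>n. f (g (s n)))" using assms(1) by (rule lscD[rotated])
qed

lemma lsc_indicator_continuous:
  fixes U :: "'a::metric_space set"
  assumes U: "open U" and f: "continuous_on U f"
  shows "lsc (\<lambda>x. if x \<in> U then ennreal (f x) else 0)"
proof (rule lscI)
  fix x and s :: "nat \<Rightarrow> 'a" assume s: "s \<longlonglongrightarrow> x"
  show "(if x \<in> U then ennreal (f x) else 0) \<le> liminf (\<lambda>n. if s n \<in> U then ennreal (f (s n)) else 0)"
  proof (cases "x \<in> U")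
    case True
    have ev: "eventually (\<lambda>n. s n \<in> U) sequentially"
      using s U True by (simp add: tendsto_def)
    have "(\<lambda>n. f (s n)) \<longlonglongrightarrow> f x"
      using continuous_on_tendsto_compose[OF f s True ev] .
    then have "(\<lambda>n. ennreal (f (s n))) \<longlonglongrightarrow> ennreal (f x)" by (rule tendsto_ennrealI)
    then have "(\<lambda>n. if s n \<in> U then ennreal (f (s n)) else 0) \<longlonglongrightarrow> ennreal (f x)"
      by (rule Lim_transform_eventually) (use ev in \<open>auto elim: eventually_mono\<close>)
    then show ?thesis using True by (simp add: lim_imp_Liminf)
  qed simp
qed

lemma lsc_indicator:
  fixes U :: "'a::metric_space set"
  assumes U: "open U" and f: "lsc f"
  shows "lsc (\<lambda>x. if x \<in> U then f x else 0)"
proof (rule lscI)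
  fix x and s :: "nat \<Rightarrow> 'a" assume s: "s \<longlonglongrightarrow> x"
  show "(if x \<in> U then f x else 0) \<le> liminf (\<lambda>n. if s n \<in> U then f (s n) else 0)"
  proof (cases "x \<in> U")
    case True
    have ev: "eventually (\<lambda>n. s n \<in> U) sequentially"
      using s U True by (simp add: tendsto_def)
    have "f x \<le> liminf (\<lambda>n. f (s n))" using f s by (rule lscD)
    also have "\<dots> \<le> liminf (\<lambda>n. if s n \<in> U then f (s n) else 0)"
      by (rule Liminf_mono) (use ev in \<open>auto elim: eventually_mono\<close>)
    finally show ?thesis using True by simp
  qed simp
qed

lemma lsc_nn_integral:
  fixes g :: "'a::metric_space \<Rightarrow> 'b \<Rightarrow> ennreal"
  assumes "\<And>z. lsc (\<lambda>x. g x z)" "\<And>x. g x \<in> borel_measurable M"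
  shows "lsc (\<lambda>x. \<integral>\<^sup>+ z. g x z \<partial>M)"
proof (rule lscI)
  fix x and s :: "nat \<Rightarrow> 'a" assume s: "s \<longlonglongrightarrow> x"
  have "(\<integral>\<^sup>+ z. g x z \<partial>M) \<le> (\<integral>\<^sup>+ z. liminf (\<lambda>n. g (s n) z) \<partial>M)"
    by (intro nn_integral_mono lscD[OF assms(1) s])
  also have "\<dots> \<le> liminf (\<lambda>n. \<integral>\<^sup>+ z. g (s n) z \<partial>M)"
    by (intro nn_integral_liminf assms(2))
  finally show "(\<integral>\<^sup>+ z. g x z \<partial>M) \<le> liminf (\<lambda>n. \<integral>\<^sup>+ z. g (s n) z \<partial>M)" .
qed

section \<open>The kernel and its truncations\<close>

definition kernel :: "real set \<Rightarrow> 'a::metric_space \<Rightarrow> 'a \<Rightarrow> 'a \<Rightarrow> ennreal" where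
  "kernel I x y z = (if diam3 x y z \<in> I then ennreal (excess x y z / diam3 x y z ^ 3) else 0)"

lemma kernel_commute: "kernel I x y z = kernel I y x z" "kernel I x y z = kernel I x z y"
proof -
  show "kernel I x y z = kernel I y x z"
    unfolding kernel_def excess_commute(1)[of x y z] diam3_commute(1)[of x y z] ..
  show "kernel I x y z = kernel I x z y"
    unfolding kernel_def excess_commute(2)[of x y z] diam3_commute(2)[of x y z] ..
qed

lemma kernel_lsc3:
  assumes "open I" "0 \<notin> I"
  shows "lsc (\<lambda>(x, y, z). kernel I x y z)"
proof -
  let ?d = "\<lambda>(x, y, z). diam3 x y z" and ?e = "\<lambda>(x, y, z). excess x y z"
  have c1: "continuous_on A ?d" for A
    unfolding diam3_def case_prod_beta by (intro continuous_intros)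
  have c2: "continuous_on A ?e" for A
    unfolding excess_def detour_def case_prod_beta by (intro continuous_intros)
  have op: "open (?d -` I)"
    using c1 assms(1) by (intro open_vimage) auto
  have eq: "(\<lambda>(x, y, z). kernel I x y z) = (\<lambda>p. if p \<in> ?d -` I then ennreal (?e p / ?d p ^ 3) else 0)"
    by (auto simp: kernel_def fun_eq_iff)
  show ?thesis
    unfolding eq
    by (rule lsc_indicator_continuous[OF op])
       (use assms(2) in \<open>intro continuous_on_divide c1 c2 continuous_on_power, auto simp: vimage_def\<close>)
qed

lemma kernel_lsc:
  assumes "open I" "0 \<notin> I"
  shows "lsc (\<lambda>p. kernel I (fst p) (snd p) z)" "lsc (\<lambda>x. kernel I x y z)" "lsc (\<lambda>z. kernel I x y z)"
  using lsc_compose[OF kernel_lsc3[OF assms], of "\<lambda>p. (fst p, snd p, z)"]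
    lsc_compose[OF kernel_lsc3[OF assms], of "\<lambda>x. (x, y, z)"]
    lsc_compose[OF kernel_lsc3[OF assms], of "\<lambda>z. (x, y, z)"]
  by (simp_all add: continuous_on_Pair continuous_on_fst continuous_on_snd)

definition kernel2 :: "'a measure \<Rightarrow> real set \<Rightarrow> 'a::metric_space \<Rightarrow> 'a \<Rightarrow> ennreal" where
  "kernel2 M I x y = (\<integral>\<^sup>+ z. kernel I x y z \<partial>M)"

definition kernel1 :: "'a measure \<Rightarrow> real set \<Rightarrow> 'a::metric_space \<Rightarrow> ennreal" where
  "kernel1 M I x = (\<integral>\<^sup>+ y. kernel2 M I x y \<partial>M)"

lemma kernel2_commute: "kernel2 M I x y = kernel2 M I y x"
  unfolding kernel2_def by (intro nn_integral_cong kernel_commute)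

context
  fixes M :: "'a::metric_space measure" and I :: "real set"
  assumes M: "sets M = sets borel" and I: "open I" "0 \<notin> I"
begin

lemma lsc_measurable_M: "lsc f \<Longrightarrow> f \<in> borel_measurable M"
  using lsc_measurable[of f] measurable_cong_sets[OF M refl, of "borel :: ennreal measure"] by auto

lemma kernel_measurable: "(\<lambda>z. kernel I x y z) \<in> borel_measurable M"
    "(\<lambda>x. kernel I x y z) \<in> borel_measurable M"
  by (intro lsc_measurable_M kernel_lsc I)+

lemma kernel2_lsc2: "lsc (\<lambda>p. kernel2 M I (fst p) (snd p))"
  unfolding kernel2_def by (intro lsc_nn_integral kernel_lsc I kernel_measurable)

lemma kernel2_lsc: "lsc (\<lambda>y. kernel2 M I x y)"  "lsc (\<lambda>x. kernel2 M I x y)"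
  using lsc_compose[OF kernel2_lsc2, of "\<lambda>y. (x, y)"] lsc_compose[OF kernel2_lsc2, of "\<lambda>x. (x, y)"]
  by (simp_all add: continuous_on_Pair)

lemma kernel2_measurable: "(\<lambda>y. kernel2 M I x y) \<in> borel_measurable M"
  by (intro lsc_measurable_M kernel2_lsc)

lemma kernel1_lsc: "lsc (kernel1 M I)"
  unfolding kernel1_def by (intro lsc_nn_integral kernel2_lsc kernel2_measurable)

lemma kernel1_measurable: "kernel1 M I \<in> borel_measurable M"
  by (intro lsc_measurable_M kernel1_lsc)

end

lemma menger_beta_eq:
  "menger_beta TYPE('a::metric_space)
   = (\<integral>\<^sup>+ x. kernel1 hausdorff1_measure {0<..} x \<partial>(hausdorff1_measure :: 'a measure))"
proof -
  have "ennreal (triangle_excess x y z / diameter {x, y, z} ^ 3) = kernel {0<..} x y z" for x y z :: 'a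
  proof (cases "diam3 x y z = 0")
    case True
    then show ?thesis by (simp add: kernel_def diameter_triple)
  next
    case False
    then show ?thesis using diam3_nonneg[of x y z]
      by (simp add: kernel_def triangle_excess_eq diameter_triple)
  qed
  then show ?thesis by (simp add: menger_beta_def kernel1_def kernel2_def)
qed

lemma excess_le_kernel:
  assumes "diam3 x y z \<in> I" "0 < diam3 x y z" "kernel I x y z \<le> ennreal C" "0 \<le> C"
  shows "excess x y z \<le> C * diam3 x y z ^ 3"
  using assms by (auto simp: kernel_def ennreal_le_iff divide_le_eq)

section \<open>Separability and sigma-finiteness\<close>

lemma nonzero_eq_UN_Markov:
  fixes f :: "'a \<Rightarrow> ennreal"
  shows "{x. f x \<noteq> 0} = (\<Union>n::nat. {x. 1 \<le> of_nat n * f x})"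
proof (intro equalityI subsetI)
  fix x assume "x \<in> {x. f x \<noteq> 0}"
  then have x: "f x \<noteq> 0" by simp
  show "x \<in> (\<Union>n::nat. {x. 1 \<le> of_nat n * f x})"
  proof (cases "f x" rule: ennreal_cases)
    case top
    then have "1 \<le> of_nat 1 * f x" by simp
    then show ?thesis by blast
  next
    case (real r)
    then have r: "0 < r" using x by (cases "r = 0") auto
    obtain n :: nat where n: "1 < n * r" using ex_less_of_nat_mult[OF r] by blast
    have "of_nat n * f x = ennreal (n * r)"
      using real r by (simp add: ennreal_mult ennreal_of_nat_eq_real_of_nat)
    also have "1 \<le> \<dots>" using n by simp
    finally show ?thesis by blast
  qed
qed auto

lemma Markov_set_finite:
  assumes "f \<in> borel_measurable M" "sets M = sets borel" "(\<integral>\<^sup>+ x. f x \<partial>M) < \<infinity>"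
  shows "emeasure M {x. 1 \<le> of_nat n * f x} < \<infinity>" "{x. 1 \<le> of_nat n * f x} \<in> sets M"
proof -
  have sp: "space M = UNIV" using sets_eq_imp_space_eq[OF assms(2)] by simp
  have "emeasure M ({x \<in> UNIV. 1 \<le> of_nat n * f x}) \<le> of_nat n * (\<integral>\<^sup>+ x. f x * indicator UNIV x \<partial>M)"
    using assms(1) sp sets.top[of M] by (intro nn_integral_Markov_inequality) auto
  also have "\<dots> < \<infinity>" using assms(3) by (simp add: ennreal_mult_less_top of_nat_less_top)
  finally show "emeasure M {x. 1 \<le> of_nat n * f x} < \<infinity>" by simp
  have "{x \<in> space M. 1 \<le> of_nat n * f x} \<in> sets M"
    using assms(1) by measurable
  then show "{x. 1 \<le> of_nat n * f x} \<in> sets M" by (simp add: sp)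
qed

definition separated :: "real \<Rightarrow> 'a::metric_space set \<Rightarrow> bool" where
  "separated d D \<longleftrightarrow> (\<forall>x\<in>D. \<forall>y\<in>D. x \<noteq> y \<longrightarrow> d \<le> dist x y)"

text \<open>Finite measure provides a countable cover by sets of diameter at most
  \<open>d/2\<close>, and each of these contains at most one point of \<open>D\<close>.\<close>

lemma countable_Int_separated:
  fixes D U :: "'a::metric_space set"
  assumes D: "separated d D" "0 < d" and U: "hausdorff1 U < \<infinity>"
  shows "countable (D \<inter> U)"
proof -
  have "hausdorff1_delta (d/2) U < top"
    using hausdorff1_delta_le_hausdorff1[of "d/2" U] D U by (auto simp: less_top)
  then obtain V :: "nat \<Rightarrow> 'a set" where V: "U \<subseteq> (\<Union>i. V i)" "\<And>i. bounded (V i)" "\<And>i. diameter (V i) \<le> d/2"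
    unfolding hausdorff1_delta_def INF_less_iff by auto
  have "countable (D \<inter> V i)" for i
  proof -
    have "x = y" if "x \<in> D \<inter> V i" "y \<in> D \<inter> V i" for x y
      using that D V(2,3)[of i] diameter_bounded_bound[of "V i" x y] unfolding separated_def
      by (metis IntD1 IntD2 field_sum_of_halves less_add_same_cancel1 half_gt_zero not_less order_trans)
    then have "D \<inter> V i = {} \<or> (\<exists>x. D \<inter> V i = {x})" by blast
    then show ?thesis by auto
  qed
  then have "countable (\<Union>i. D \<inter> V i)" by (intro countable_UN) auto
  then show ?thesis by (rule countable_subset[rotated]) (use V(1) in blast)
qed

lemma countable_separated_AE:
  fixes D :: "'a::metric_space set"
  assumes D: "separated d D" "0 < d" and P: "AE x in hausdorff1_measure. P x"
  shows "countable {x \<in> D. \<not> P x}"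
proof -
  obtain N where N: "{x \<in> space hausdorff1_measure. \<not> P x} \<subseteq> N"
      "emeasure hausdorff1_measure N = 0" "N \<in> sets hausdorff1_measure"
    using P by (rule AE_E)
  have "hausdorff1 N = 0" using N emeasure_hausdorff1_measure[of N] by simp
  then have "countable (D \<inter> N)" using D by (intro countable_Int_separated) auto
  then show ?thesis by (rule countable_subset[rotated]) (use N(1) in auto)
qed

lemma countable_separated_nonzero:
  fixes D :: "'a::metric_space set"
  assumes D: "separated d D" "0 < d" and f: "f \<in> borel_measurable hausdorff1_measure"
    "(\<integral>\<^sup>+ x. f x \<partial>hausdorff1_measure) < \<infinity>"
  shows "countable {x \<in> D. f x \<noteq> 0}"
proof -
  have "countable (D \<inter> {x. 1 \<le> of_nat n * f x})" for n
  proof -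
    have "hausdorff1 {x. 1 \<le> of_nat n * f x} = emeasure hausdorff1_measure {x. 1 \<le> of_nat n * f x}"
      using Markov_set_finite(2)[OF f(1) _ f(2), of n] by (subst emeasure_hausdorff1_measure) auto
    then show ?thesis
      using Markov_set_finite(1)[OF f(1) _ f(2), of n] D by (intro countable_Int_separated) auto
  qed
  then have "countable (\<Union>n. D \<inter> {x. 1 \<le> of_nat n * f x})" by (intro countable_UN) auto
  moreover have "(\<Union>n. D \<inter> {x. 1 \<le> of_nat n * f x}) = {x \<in> D. f x \<noteq> 0}"
    using nonzero_eq_UN_Markov[of f] by blast
  ultimately show ?thesis by simp
qed

lemma maximal_separated:
  obtains D :: "'a::metric_space set" where "D \<subseteq> A" "separated d D" "\<And>x. x \<in> A \<Longrightarrow> \<exists>y\<in>D. dist x y < d \<or> x = y"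
proof -
  let ?F = "{D. D \<subseteq> A \<and> separated d D}"
  have "\<exists>M\<in>?F. \<forall>X\<in>?F. M \<subseteq> X \<longrightarrow> X = M"
  proof (rule subset_Zorn')
    fix C assume C: "subset.chain ?F C"
    have "d \<le> dist x y" if "x \<in> \<Union>C" "y \<in> \<Union>C" "x \<noteq> y" for x y
    proof -
      from that obtain X Y where "X \<in> C" "Y \<in> C" "x \<in> X" "y \<in> Y" by blast
      moreover have "X \<subseteq> Y \<or> Y \<subseteq> X" using C \<open>X \<in> C\<close> \<open>Y \<in> C\<close> unfolding subset.chain_def by blast
      moreover have "separated d X" "separated d Y" using C \<open>X \<in> C\<close> \<open>Y \<in> C\<close> unfolding subset.chain_def by blast+
      ultimately show ?thesis using that(3) unfolding separated_def by blast
    qed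
    moreover have "\<Union>C \<subseteq> A" using C unfolding subset.chain_def by blast
    ultimately show "\<Union>C \<in> ?F" by (auto simp: separated_def)
  qed
  then obtain M where M: "M \<subseteq> A" "separated d M"
    and max: "\<And>X. X \<subseteq> A \<Longrightarrow> separated d X \<Longrightarrow> M \<subseteq> X \<Longrightarrow> X = M" by auto
  show thesis
  proof (rule that[OF M])
    fix x assume x: "x \<in> A"
    show "\<exists>y\<in>M. dist x y < d \<or> x = y"
    proof (rule ccontr)
      assume c: "\<not> ?thesis"
      then have "separated d (insert x M)"
        using M(2) by (auto simp: separated_def not_less dist_commute)
      then have "insert x M = M" using max[of "insert x M"] M(1) x by blast
      then show False using c by blast
    qed
  qed
qed

lemma diameter_leI:
  fixes S :: "'a::metric_space set"
  assumes "\<And>x y. x \<in> S \<Longrightarrow> y \<in> S \<Longrightarrow> dist x y \<le> h" "0 \<le> h"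
  shows "bounded S" "diameter S \<le> h"
proof -
  show "bounded S"
    using assms unfolding bounded_def by (cases "S = {}") blast+
  show "diameter S \<le> h"
  proof (cases "S = {}")
    case False
    then have "(SUP (x, y)\<in>S \<times> S. dist x y) \<le> h" using assms(1) by (intro cSUP_least) auto
    then show ?thesis using False by (simp add: diameter_def)
  qed (use assms(2) in simp)
qed

lemma hausdorff1_line:
  fixes W :: "'a::metric_space set"
  assumes dist: "\<And>z w. z \<in> W \<Longrightarrow> w \<in> W \<Longrightarrow> dist z w \<le> \<bar>\<phi> z - \<phi> w\<bar>"
    and ran: "\<And>z. z \<in> W \<Longrightarrow> a \<le> \<phi> z \<and> \<phi> z \<le> b" and ab: "a \<le> b"
  shows "hausdorff1 W \<le> ennreal (b - a)"
  unfolding hausdorff1_def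
proof (rule SUP_least)
  fix \<delta> :: real assume "\<delta> \<in> {0<..}"
  then have d: "0 < \<delta>" by simp
  obtain n :: nat where n: "b - a < n * \<delta>" using ex_less_of_nat_mult[OF d] by blast
  have n0: "0 < n" using n ab d by (cases n) auto
  define h where "h = (b - a) / n"
  have h: "0 \<le> h" "h \<le> \<delta>" "n * h = b - a"
    using n n0 ab d by (auto simp: h_def field_simps)
  define U where "U i = (if i < n then {z \<in> W. a + i * h \<le> \<phi> z \<and> \<phi> z \<le> a + Suc i * h} else {})" for i
  have U: "bounded (U i)" "diameter (U i) \<le> h" for i
  proof -
    have "dist x y \<le> h" if "x \<in> U i" "y \<in> U i" for x y
      using that dist[of x y] by (auto simp: U_def algebra_simps split: if_splits)
    then show "bounded (U i)" "diameter (U i) \<le> h" using diameter_leI[of "U i" h] h(1) by auto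
  qed
  have "W \<subseteq> (\<Union>i. U i)"
  proof
    fix z assume z: "z \<in> W"
    show "z \<in> (\<Union>i. U i)"
    proof (cases "h = 0")
      case True
      then have "\<phi> z = a" using ran[OF z] h(3) by simp
      then have "z \<in> U 0" using z n0 True by (simp add: U_def)
      then show ?thesis by blast
    next
      case False
      then have hp: "0 < h" using h(1) by simp
      define k where "k = nat \<lfloor>(\<phi> z - a) / h\<rfloor>"
      have k: "real k \<le> (\<phi> z - a) / h" "(\<phi> z - a) / h < real k + 1"
        using ran[OF z] hp unfolding k_def by (auto simp: le_nat_floor)
      have k': "k * h \<le> \<phi> z - a" "\<phi> z - a < (real k + 1) * h"
        using k unfolding pos_le_divide_eq[OF hp] pos_divide_less_eq[OF hp] by - assumption+
      show ?thesis
      proof (cases "k < n")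
        case True
        then have "z \<in> U k" using z k' by (auto simp: U_def algebra_simps)
        then show ?thesis by blast
      next
        \<comment> \<open>Only the right end point \<open>\<phi> z = b\<close> gets here; it goes to
          the last piece.\<close>
        case False
        then have "n * h \<le> k * h" using hp by (intro mult_right_mono) auto
        then have "\<phi> z = b" using k'(1) ran[OF z] h(3) by linarith
        moreover have "real (Suc (n - 1)) = n" using n0 by simp
        moreover have "real (n - 1) * h \<le> b - a" using h(3) n0 h(1) by (simp add: of_nat_diff algebra_simps)
        ultimately have "z \<in> U (n - 1)" using z n0 h(3) by (auto simp: U_def)
        then show ?thesis by blast
      qed
    qed
  qed
  then have "hausdorff1_delta \<delta> W \<le> (\<Sum>i. ennreal (diameter (U i)))"
    using U h(2) by (intro hausdorff1_delta_le) (auto intro: order_trans)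
  also have "\<dots> = (\<Sum>i<n. ennreal (diameter (U i)))"
    by (rule suminf_finite) (auto simp: U_def)
  also have "\<dots> \<le> (\<Sum>i<n. ennreal h)" using U(2) by (intro sum_mono ennreal_leI)
  also have "\<dots> = ennreal (b - a)" using h by (simp add: ennreal_of_nat_eq_real_of_nat ennreal_mult[symmetric])
  finally show "hausdorff1_delta \<delta> W \<le> ennreal (b - a)" .
qed

section \<open>Lower density\<close>

lemma hausdorff1_singleton: "hausdorff1 {x :: 'a::metric_space} = 0"
proof -
  have "hausdorff1 {x} \<le> ennreal (0 - 0)" by (rule hausdorff1_line[where \<phi> = "\<lambda>_. 0"]) auto
  then show ?thesis by simp
qed

text \<open>Otherwise take a cover with sum of diameters below \<open>3/2 * H\<close>. A piece
  meeting \<open>A\<close> lies in a ball about one of its points with its diameter as radius, so it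
  carries at most half its diameter, and \<open>H \<le> 3/4 * H\<close> follows.\<close>

lemma exists_dense_ball:
  fixes A :: "'a::metric_space set"
  assumes A: "0 < hausdorff1 A" "hausdorff1 A < \<infinity>"
  shows "\<exists>x\<in>A. \<exists>r>0. ennreal (r / 2) \<le> hausdorff1 (A \<inter> cball x r)"
proof (rule ccontr)
  assume "\<not> ?thesis"
  then have sparse: "hausdorff1 (A \<inter> cball x r) < ennreal (r / 2)" if "x \<in> A" "0 < r" for x r
    using that by (auto simp: not_le)
  obtain H where H: "hausdorff1 A = ennreal H" "0 < H"
    using A by (cases "hausdorff1 A" rule: ennreal_cases) auto
  have "hausdorff1_delta 1 A < ennreal (H + H / 2)"
    using hausdorff1_delta_le_hausdorff1[of 1 A] H by (auto simp: ennreal_lessI le_less_trans)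
  then obtain U :: "nat \<Rightarrow> 'a set" where U: "A \<subseteq> (\<Union>i. U i)" "\<And>i. bounded (U i)"
    and sum: "(\<Sum>i. ennreal (diameter (U i))) < ennreal (H + H / 2)"
    unfolding hausdorff1_delta_def INF_less_iff by auto
  have piece: "hausdorff1 (A \<inter> U i) \<le> ennreal (1/2) * ennreal (diameter (U i))" for i
  proof (cases "A \<inter> U i = {}")
    case False
    then obtain x where x: "x \<in> A" "x \<in> U i" by blast
    have sub: "A \<inter> U i \<subseteq> A \<inter> cball x (diameter (U i))"
      using diameter_bounded_bound[OF U(2)[of i] x(2)] by auto
    show ?thesis
    proof (cases "diameter (U i) = 0")
      case True
      then have "A \<inter> U i \<subseteq> {x}" using sub by auto
      then show ?thesis using hausdorff1_mono[of "A \<inter> U i" "{x}"] hausdorff1_singleton[of x] by simp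
    next
      case False
      then have "0 < diameter (U i)" using diameter_ge_0[OF U(2)[of i]] by simp
      then have "hausdorff1 (A \<inter> U i) \<le> ennreal (diameter (U i) / 2)"
        using sparse[OF x(1), of "diameter (U i)"] hausdorff1_mono[OF sub] by (meson le_less_trans less_imp_le)
      also have "ennreal (diameter (U i) / 2) = ennreal (1/2) * ennreal (diameter (U i))"
        using diameter_ge_0[OF U(2)[of i]] by (subst ennreal_mult[symmetric]) auto
      finally show ?thesis .
    qed
  qed simp
  have "hausdorff1 A \<le> hausdorff1 (\<Union>i. A \<inter> U i)" using U(1) by (intro hausdorff1_mono) blast
  also have "\<dots> \<le> (\<Sum>i. hausdorff1 (A \<inter> U i))" by (rule hausdorff1_countably_subadditive)
  also have "\<dots> \<le> (\<Sum>i. ennreal (1/2) * ennreal (diameter (U i)))" by (intro suminf_le piece) auto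
  also have "\<dots> = ennreal (1/2) * (\<Sum>i. ennreal (diameter (U i)))" by (rule ennreal_suminf_cmult)
  also have "\<dots> \<le> ennreal (1/2) * ennreal (H + H / 2)" using sum by (intro mult_left_mono) auto
  also have "\<dots> = ennreal (3/4 * H)" using H(2) by (subst ennreal_mult[symmetric]) auto
  finally show False using H by (simp add: ennreal_le_iff)
qed

text \<open>Doubling the radius must stop since the mass is finite. If \<open>R\<close> is the last
  radius with the lower bound, its failure at \<open>2 * R\<close> says that even the larger ball
  has mass below \<open>R\<close>.\<close>

lemma exists_critical_ball:
  fixes A :: "'a::metric_space set"
  assumes A: "0 < hausdorff1 A" "hausdorff1 A < \<infinity>"
  obtains x r where "x \<in> A" "0 < r" "ennreal (r / 2) \<le> hausdorff1 (A \<inter> cball x r)"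
    "hausdorff1 (A \<inter> cball x r) \<le> ennreal r"
proof -
  obtain x r where x: "x \<in> A" "0 < r" "ennreal (r / 2) \<le> hausdorff1 (A \<inter> cball x r)"
    using exists_dense_ball[OF A] by blast
  obtain H where H: "hausdorff1 A = ennreal H" "0 < H"
    using A by (cases "hausdorff1 A" rule: ennreal_cases) auto
  define P where "P n \<longleftrightarrow> ennreal (r * 2 ^ n / 2) \<le> hausdorff1 (A \<inter> cball x (r * 2 ^ n))" for n
  obtain n :: nat where n: "2 * H / r < 2 ^ n" using real_arch_pow[of 2 "2 * H / r"] by auto
  have bound: "m < n" if "P m" for m
  proof (rule ccontr)
    assume "\<not> m < n"
    then have "(2::real) ^ n \<le> 2 ^ m" by simp
    then have "2 * H < r * 2 ^ m" using n x(2) by (auto simp: pos_divide_less_eq mult.commute intro: less_le_trans)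
    moreover have "ennreal (r * 2 ^ m / 2) \<le> ennreal H"
      using that hausdorff1_mono[of "A \<inter> cball x (r * 2 ^ m)" A] H(1) unfolding P_def by (metis inf_le1 order_trans)
    ultimately show False using H(2) by (simp add: ennreal_le_iff)
  qed
  have "P 0" using x by (simp add: P_def)
  define m where "m = (GREATEST k. P k)"
  have bound': "\<forall>y. P y \<longrightarrow> y \<le> n" using bound by (auto intro: less_imp_le)
  have "P m" "\<And>k. P k \<Longrightarrow> k \<le> m"
    unfolding m_def using GreatestI_nat[where P = P and b = n] Greatest_le_nat[where P = P and b = n] bound' \<open>P 0\<close>
    by blast+
  then have "P m" "\<not> P (Suc m)" by (auto dest: Suc_n_not_le_n[THEN notE])
  have "hausdorff1 (A \<inter> cball x (r * 2 ^ m)) \<le> hausdorff1 (A \<inter> cball x (r * 2 ^ Suc m))"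
  proof (rule hausdorff1_mono)
    have "r * 2 ^ m \<le> r * 2 ^ Suc m" using x(2) by simp
    then show "A \<inter> cball x (r * 2 ^ m) \<subseteq> A \<inter> cball x (r * 2 ^ Suc m)" by auto
  qed
  also have "\<dots> \<le> ennreal (r * 2 ^ m)" using \<open>\<not> P (Suc m)\<close> by (simp add: P_def not_le less_imp_le)
  finally show thesis using that[of x "r * 2 ^ m"] x \<open>P m\<close> by (simp add: P_def)
qed

section \<open>Separability, sigma-finiteness and localization from finite total curvature\<close>

context
  fixes mu :: "'a::metric_space measure" and K :: "real set"
  assumes beta: "menger_beta TYPE('a) < \<infinity>"
  defines "mu \<equiv> hausdorff1_measure" and "K \<equiv> {0<..}"
begin

lemma K_open: "open K" "0 \<notin> K"
  by (auto simp: K_def)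

lemma sets_mu: "sets mu = sets borel"
  by (simp add: mu_def)

lemma space_mu: "space mu = UNIV"
  by (simp add: mu_def)

lemma AE_kernel1: "AE x in mu. kernel1 mu K x < \<infinity>"
proof -
  have "AE x in mu. kernel1 mu K x \<noteq> \<infinity>"
    using beta kernel1_measurable[OF sets_mu K_open]
    by (intro nn_integral_noteq_infinite) (auto simp: menger_beta_eq mu_def K_def)
  then show ?thesis by (auto simp: less_top)
qed

lemma AE_kernel2:
  assumes "kernel2 mu K x y = 0" shows "AE z in mu. kernel K x y z = 0"
  using assms kernel_measurable(1)[OF sets_mu K_open] unfolding kernel2_def
  by (subst (asm) nn_integral_0_iff_AE) auto

lemma kernel_eq_0D:
  assumes "kernel K x y z = 0" "x \<noteq> y" shows "excess x y z = 0"
proof -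
  have "0 < diam3 x y z" using assms by (intro diam3_pos) auto
  then show ?thesis using assms excess_nonneg[of x y z]
    by (auto simp: kernel_def K_def ennreal_eq_0_iff divide_le_0_iff)
qed

text \<open>A null set meets a separated set in countably many points only. So an uncountable
  separated set would contain \<open>p, u, v, w\<close> all of whose triples have excess 0, with
  \<open>u, v, w\<close> in one bin of distances from \<open>p\<close>, against
  \<open>three_in_one_bin\<close> with \<open>t = 0\<close>.\<close>

lemma countable_separated:
  fixes D :: "'a set"
  assumes D: "separated d D" "0 < d" shows "countable D"
proof (rule ccontr)
  assume unc: "uncountable D"
  have c1: "countable {x \<in> D. \<not> kernel1 mu K x < \<infinity>}"
    using countable_separated_AE[OF D AE_kernel1[unfolded mu_def]] unfolding mu_def .
  have c2: "countable {y \<in> D. kernel2 mu K x y \<noteq> 0}" if "kernel1 mu K x < \<infinity>" for x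
    using countable_separated_nonzero[OF D, of "\<lambda>y. kernel2 mu K x y"] that
      kernel2_measurable[OF sets_mu K_open] by (simp add: mu_def kernel1_def)
  have c3: "countable {z \<in> D. kernel K x y z \<noteq> 0}" if "kernel2 mu K x y = 0" for x y
    using countable_separated_AE[OF D AE_kernel2[OF that, unfolded mu_def]] .
  have pick: "\<exists>x\<in>E - C. True" if "uncountable E" "countable C" for E C :: "'a set"
    using uncountable_minus_countable[OF that] by (metis countable_empty equals0I)
  obtain p where p: "p \<in> D" "kernel1 mu K p < \<infinity>" using pick[OF unc c1] by auto
  define D1 where "D1 = D - {x \<in> D. \<not> kernel1 mu K x < \<infinity>} - {y \<in> D. kernel2 mu K p y \<noteq> 0} - {p}"
  have D1: "uncountable D1"
    unfolding D1_def using c1 c2[OF p(2)] unc by (intro uncountable_minus_countable) auto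
  have D1p: "x \<in> D" "kernel1 mu K x < \<infinity>" "kernel2 mu K p x = 0" "x \<noteq> p" if "x \<in> D1" for x
    using that by (auto simp: D1_def)
  have "\<exists>i. uncountable {x \<in> D1. \<lfloor>2 * dist p x / d\<rfloor> = i}"
  proof (rule ccontr)
    assume "\<not> ?thesis"
    then have "countable (\<Union>i. {x \<in> D1. \<lfloor>2 * dist p x / d\<rfloor> = i})" by auto
    moreover have "(\<Union>i. {x \<in> D1. \<lfloor>2 * dist p x / d\<rfloor> = i}) = D1" by auto
    ultimately show False using D1 by simp
  qed
  then obtain i where i: "uncountable {x \<in> D1. \<lfloor>2 * dist p x / d\<rfloor> = i}" by blast
  define D2 where "D2 = {x \<in> D1. \<lfloor>2 * dist p x / d\<rfloor> = i}"
  have bin: "\<bar>dist p x - dist p y\<bar> \<le> d/2" if "x \<in> D2" "y \<in> D2" for x y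
  proof -
    have "2 * dist p x / d < i + 1" "i \<le> 2 * dist p x / d" "2 * dist p y / d < i + 1" "i \<le> 2 * dist p y / d"
      using that unfolding D2_def by (simp_all, linarith+)
    then have "\<bar>2 * dist p x / d - 2 * dist p y / d\<bar> \<le> 1" by linarith
    then have "\<bar>2 * dist p x - 2 * dist p y\<bar> \<le> d"
      using D(2) by (simp add: diff_divide_distrib[symmetric] abs_div pos_divide_le_eq)
    then show ?thesis by linarith
  qed
  obtain u where u: "u \<in> D2" using i unfolding D2_def[symmetric] by (metis countable_empty equals0I)
  have uD1: "u \<in> D1" using u by (simp add: D2_def)
  note up = D1p[OF uD1]
  obtain v where v: "v \<in> D2 - ({y \<in> D. kernel2 mu K u y \<noteq> 0} \<union> {z \<in> D. kernel K p u z \<noteq> 0} \<union> {u})"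
    using pick[OF i[folded D2_def], of "{y \<in> D. kernel2 mu K u y \<noteq> 0} \<union> {z \<in> D. kernel K p u z \<noteq> 0} \<union> {u}"]
      c2[OF up(2)] c3[OF up(3)] by auto
  have vD1: "v \<in> D1" using v by (simp add: D2_def)
  note vp = D1p[OF vD1]
  have v': "kernel2 mu K u v = 0" "kernel K p u v = 0" "u \<noteq> v" "v \<in> D2" using v vp by auto
  obtain w where w: "w \<in> D2 - ({z \<in> D. kernel K p u z \<noteq> 0} \<union> {z \<in> D. kernel K p v z \<noteq> 0} \<union> {z \<in> D. kernel K u v z \<noteq> 0} \<union> {u, v})"
    using pick[OF i[folded D2_def], of "{z \<in> D. kernel K p u z \<noteq> 0} \<union> {z \<in> D. kernel K p v z \<noteq> 0} \<union> {z \<in> D. kernel K u v z \<noteq> 0} \<union> {u, v}"]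
      c3[OF up(3)] c3[OF vp(3)] c3[OF v'(1)] by auto
  have wD1: "w \<in> D1" using w by (simp add: D2_def)
  note wp = D1p[OF wD1]
  have w': "kernel K p u w = 0" "kernel K p v w = 0" "kernel K u v w = 0" "w \<noteq> u" "w \<noteq> v" "w \<in> D2"
    using w wp by auto
  show False
  proof (rule three_in_one_bin[of p u v 0 w d])
    show "excess p u v \<le> 0" "excess p u w \<le> 0" "excess p v w \<le> 0" "excess u v w \<le> 0"
      using kernel_eq_0D v' w' up vp by (metis order_refl)+
    show "d \<le> dist u v" "d \<le> dist u w" "d \<le> dist v w" "d \<le> dist p u" "d \<le> dist p v" "d \<le> dist p w"
      using D(1) p(1) up vp wp v' w' unfolding separated_def by metis+
  qed (use bin u v' w' D in auto)
qed

lemma countable_dense: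
  obtains Q :: "'a set" where "countable Q" "\<And>x e. 0 < e \<Longrightarrow> \<exists>q\<in>Q. dist x q < e"
proof -
  have "\<exists>D :: 'a set. separated (1 / Suc n) D \<and> (\<forall>x. \<exists>y\<in>D. dist x y < 1 / Suc n \<or> x = y)" for n
    by (rule maximal_separated[of UNIV "1 / Suc n"]) auto
  then obtain D :: "nat \<Rightarrow> 'a set" where D: "\<And>n. separated (1 / Suc n) (D n)"
    "\<And>n x. \<exists>y\<in>D n. dist x y < 1 / Suc n \<or> x = y" by metis
  show thesis
  proof
    show "countable (\<Union>n. D n)" using countable_separated[OF D(1)] by auto
    fix x :: 'a and e :: real assume "0 < e"
    then obtain n where n: "1 / Suc n < e" using nat_approx_posE by blast
    then show "\<exists>q\<in>\<Union>n. D n. dist x q < e" using D(2)[of n x] \<open>0 < e\<close>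
      by (metis UN_I UNIV_I dist_self order_less_trans)
  qed
qed

text \<open>Fix \<open>x\<close> with finite \<open>kernel1\<close>. Where
  \<open>kernel2 mu K x\<close> is nonzero, Markov's inequality exhausts by sets of finite measure.
  Where it vanishes, after removal of a null set any two nearby points are aligned with
  \<open>x\<close>, and the distance to \<open>x\<close> embeds small pieces into the line.\<close>

lemma sigma_finite_cover:
  obtains \<C> :: "'a set set" where "countable \<C>" "\<And>C. C \<in> \<C> \<Longrightarrow> C \<in> sets borel"
    "\<And>C. C \<in> \<C> \<Longrightarrow> hausdorff1 C < \<infinity>" "hausdorff1 (- \<Union>\<C>) = 0"
proof (cases "\<exists>x. kernel1 mu K x < \<infinity>")
  case False
  then have "AE x in mu. False" using AE_kernel1 by auto
  then obtain N where N: "{x \<in> space mu. \<not> False} \<subseteq> N" "emeasure mu N = 0" "N \<in> sets mu"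
    by (rule AE_E)
  then have "N = UNIV" by (auto simp: space_mu)
  then have "hausdorff1 (UNIV :: 'a set) = 0"
    using N emeasure_hausdorff1_measure[of "UNIV :: 'a set"] by (simp add: mu_def)
  then show ?thesis by (intro that[of "{}"]) auto
next
  case True
  then obtain x where x: "kernel1 mu K x < \<infinity>" by blast
  obtain Q :: "'a set" where Q: "countable Q" "\<And>x e. 0 < e \<Longrightarrow> \<exists>q\<in>Q. dist x q < e"
    using countable_dense by blast
  have k2m: "(\<lambda>y. kernel2 mu K x y) \<in> borel_measurable mu"
    using kernel2_measurable[OF sets_mu K_open] .
  define A where "A n = {y. 1 \<le> of_nat n * kernel2 mu K x y}" for n :: nat
  have A: "A n \<in> sets borel" "hausdorff1 (A n) < \<infinity>" for n
    using Markov_set_finite[OF k2m sets_mu, of n] x emeasure_hausdorff1_measure[of "A n"]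
    by (auto simp: A_def kernel1_def sets_mu mu_def)
  \<comment> \<open>Two points of this ball are closer to each other than to \<open>x\<close>, so
    \<open>x\<close> is not between them and excess 0 means that their distance is the difference of
    their distances to \<open>x\<close>.\<close>
  define V where "V q = {y. kernel2 mu K x y \<le> 0} \<inter> (- {x}) \<inter> ball q (dist x q / 4)" for q
  have V: "V q \<in> sets borel" for q
    unfolding V_def
    by (intro sets.Int borel_closed[OF lsc_closed_sublevel[OF kernel2_lsc(1)[OF sets_mu K_open]]]) auto
  \<comment> \<open>Separability makes this a countable union of null pieces. For \<open>z\<close>
    in \<open>V q\<close> the set of all \<open>w\<close> with \<open>kernel K x z w > 0\<close> is
    open and null, so its points in \<open>V q\<close> fall into \<open>N q\<close>.\<close>
  define N where "N q = (\<Union>p\<in>Q. \<Union>m. if emeasure mu (ball p (1 / Suc m) \<inter> V q) = 0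
      then ball p (1 / Suc m) \<inter> V q else {})" for q
  have Nsets: "N q \<in> sets borel" for q
    unfolding N_def using V Q(1) by (intro sets.countable_UN'' sets.countable_UN') auto
  have Nnull: "hausdorff1 (N q) = 0" for q
  proof -
    have "N q \<in> null_sets mu"
      unfolding N_def using V Q(1)
      by (intro null_sets_UN') (auto simp: null_sets_def sets_mu)
    then have "emeasure mu (N q) = 0" by auto
    then show ?thesis using emeasure_hausdorff1_measure[OF Nsets, of q] by (simp add: mu_def)
  qed
  define W where "W q = V q - N q" for q
  have exc: "excess x z w = 0" if zw: "z \<in> W q" "w \<in> W q" for q z w
  proof (rule ccontr)
    assume ne: "excess x z w \<noteq> 0"
    have zx: "z \<noteq> x" using zw by (auto simp: W_def V_def)
    define U where "U = {w. 0 < kernel K x z w}"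
    have "open U" unfolding U_def by (intro lsc_open_superlevel kernel_lsc K_open)
    moreover have "w \<in> U" using kernel_eq_0D[of x z w] ne zx by (auto simp: U_def zero_less_iff_neq_zero)
    ultimately obtain e where e: "0 < e" "ball w e \<subseteq> U" using open_contains_ball by blast
    obtain m where m: "1 / Suc m < e / 2" using nat_approx_posE[of "e/2"] e(1) by auto
    obtain p where p: "p \<in> Q" "dist w p < 1 / Suc m" using Q(2)[of "1 / Suc m" w] by auto
    have sub: "ball p (1 / Suc m) \<subseteq> U"
    proof
      fix y assume "y \<in> ball p (1 / Suc m)"
      then have "dist w y < e" using p(2) m dist_triangle[of w y p] by (auto simp: dist_commute)
      then show "y \<in> U" using e(2) by auto
    qed
    have "kernel2 mu K x z = 0" using zw by (auto simp: W_def V_def)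
    then have "AE w in mu. w \<notin> U" using AE_kernel2[of x z] by (auto simp: U_def)
    then have "AE w in mu. w \<notin> ball p (1 / Suc m) \<inter> V q"
      by (rule AE_mp) (use sub in blast)
    then have "emeasure mu (ball p (1 / Suc m) \<inter> V q) = 0"
      using V by (subst (asm) AE_iff_measurable[where N = "ball p (1 / Suc m) \<inter> V q"])
        (auto simp: sets_mu space_mu)
    then have "w \<in> N q"
      unfolding N_def using p zw by (auto simp: W_def dist_commute intro!: bexI[of _ p] exI[of _ m])
    then show False using zw by (auto simp: W_def)
  qed
  have Wfin: "hausdorff1 (W q) < \<infinity>" for q
  proof -
    have "hausdorff1 (W q) \<le> ennreal (2 * dist x q - 0)"
    proof (rule hausdorff1_line[where \<phi> = "dist x"])
      fix z w assume zw: "z \<in> W q" "w \<in> W q"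
      have d: "dist q z < dist x q / 4" "dist q w < dist x q / 4"
        using zw by (auto simp: W_def V_def)
      have "dist z w < dist x q / 2" "dist x q * 3 / 4 < dist x z" "dist x q * 3 / 4 < dist x w"
        using d dist_triangle[of z w q] dist_triangle[of x q z] dist_triangle[of x q w] by (auto simp: dist_commute)
      then show "dist z w \<le> \<bar>dist x z - dist x w\<bar>"
        using exc[OF zw] excess_le_iff[of x z w 0] by (auto simp: detour_def dist_commute)
    next
      fix z assume "z \<in> W q"
      then have "dist q z < dist x q / 4" by (auto simp: W_def V_def)
      moreover have "0 \<le> dist q z" "0 \<le> dist x z" by simp_all
      ultimately show "0 \<le> dist x z \<and> dist x z \<le> 2 * dist x q"
        using dist_triangle[of x z q] by linarith
    qed simp
    then show ?thesis by (simp add: le_less_trans)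
  qed
  define \<C> where "\<C> = range A \<union> {{x}} \<union> W ` Q"
  show ?thesis
  proof (rule that[of \<C>])
    show "countable \<C>" using Q(1) by (auto simp: \<C>_def)
    fix C assume C: "C \<in> \<C>"
    then show "C \<in> sets borel" using A V Nsets by (auto simp: \<C>_def W_def)
    show "hausdorff1 C < \<infinity>" using C A Wfin by (auto simp: \<C>_def hausdorff1_singleton)
  next
    have "- \<Union>\<C> \<subseteq> (\<Union>q\<in>Q. N q)"
    proof
      fix y assume y: "y \<in> - \<Union>\<C>"
      have yx: "y \<noteq> x" using y by (auto simp: \<C>_def)
      have "y \<notin> A n" for n using y by (auto simp: \<C>_def)
      then have k0: "kernel2 mu K x y = 0"
        using nonzero_eq_UN_Markov[of "\<lambda>y. kernel2 mu K x y"] unfolding A_def by blast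
      obtain q where q: "q \<in> Q" "dist y q < dist x y / 10" using Q(2)[of "dist x y / 10" y] yx by auto
      have "dist x y \<le> dist x q + dist y q" using dist_triangle[of x y q] by (simp add: dist_commute)
      moreover have "0 \<le> dist x q" "0 \<le> dist y q" by simp_all
      ultimately have "dist y q < dist x q / 4" using q(2) by linarith
      then have "y \<in> V q" using k0 yx by (auto simp: V_def dist_commute)
      moreover have "y \<notin> W q" using y q(1) by (auto simp: \<C>_def)
      ultimately show "y \<in> (\<Union>q\<in>Q. N q)" using q(1) by (auto simp: W_def)
    qed
    then have "hausdorff1 (- \<Union>\<C>) \<le> hausdorff1 (\<Union>q\<in>Q. N q)" by (rule hausdorff1_mono)
    also have "hausdorff1 (\<Union>q\<in>Q. N q) = 0"
    proof -
      have "(\<Union>q\<in>Q. N q) \<in> null_sets mu"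
        using Q(1) Nnull Nsets emeasure_hausdorff1_measure[OF Nsets]
        by (intro null_sets_UN') (auto simp: mu_def null_sets_def)
      then have "emeasure mu (\<Union>q\<in>Q. N q) = 0" by auto
      moreover have "(\<Union>q\<in>Q. N q) \<in> sets borel" using Q(1) Nsets by (intro sets.countable_UN'') auto
      ultimately show ?thesis using emeasure_hausdorff1_measure[of "\<Union>q\<in>Q. N q"] by (simp add: mu_def)
    qed
    finally show "hausdorff1 (- \<Union>\<C>) = 0" by simp
  qed
qed

text \<open>When one variable of the curvature based at \<open>x\<close> is confined to a shrinking
  ball around \<open>x\<close>, the integral tends to 0 by dominated convergence, since points are
  null. Fix a radius that works on a set of positive measure and cut out a piece of smaller
  diameter.\<close>

lemma localize:
  assumes R: "R \<in> sets borel" "0 < hausdorff1 R" "hausdorff1 R < \<infinity>" and eta: "0 < \<eta>"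
  obtains A where "A \<in> sets borel" "A \<subseteq> R" "0 < hausdorff1 A"
    "\<And>x. x \<in> A \<Longrightarrow> (\<integral>\<^sup>+ y. indicator A y * kernel2 mu K x y \<partial>mu) \<le> ennreal \<eta>"
proof -
  define h where "h n x = (\<integral>\<^sup>+ y. (if x \<in> ball y (1 / Suc n) then kernel2 mu K x y else 0) \<partial>mu)" for n x
  have meas: "(\<lambda>y. if x \<in> ball y (1 / Suc n) then kernel2 mu K x y else 0) \<in> borel_measurable mu" for n x
  proof -
    have "lsc (\<lambda>y. if y \<in> ball x (1 / Suc n) then kernel2 mu K x y else 0)"
      by (intro lsc_indicator kernel2_lsc(1) sets_mu K_open) simp
    from lsc_measurable_M[OF sets_mu K_open this] show ?thesis by (simp add: dist_commute)
  qed
  have "lsc (h n)" for n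
    unfolding h_def by (intro lsc_nn_integral lsc_indicator kernel2_lsc(2) sets_mu K_open meas) simp
  then have cl: "closed {x. h n x \<le> ennreal \<eta>}" for n by (rule lsc_closed_sublevel)
  define R' where "R' n = R \<inter> {x. h n x \<le> ennreal \<eta>}" for n
  have R': "R' n \<in> sets borel" for n using R(1) borel_closed[OF cl] by (simp add: R'_def)
  have key: "x \<in> (\<Union>n. R' n)" if fin: "kernel1 mu K x < \<infinity>" and "x \<in> R" for x
  proof -
    have "(\<lambda>n. h n x) \<longlonglongrightarrow> (\<integral>\<^sup>+ y. 0 \<partial>mu)"
      unfolding h_def
    proof (rule nn_integral_dominated_convergence[where w = "\<lambda>y. kernel2 mu K x y"])
      show "(\<integral>\<^sup>+ y. kernel2 mu K x y \<partial>mu) < \<infinity>" using fin by (simp add: kernel1_def)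
      have "emeasure mu {x} = 0" using emeasure_hausdorff1_measure[of "{x}"] by (simp add: mu_def hausdorff1_singleton)
      then have "AE y in mu. y \<noteq> x" by (intro AE_I[where N = "{x}"]) (auto simp: sets_mu)
      then show "AE y in mu. (\<lambda>n. if x \<in> ball y (1 / Suc n) then kernel2 mu K x y else 0) \<longlonglongrightarrow> 0"
      proof eventually_elim
        case (elim y)
        then obtain n where n: "1 / Suc n < dist y x" using nat_approx_posE[of "dist y x"] by auto
        have "eventually (\<lambda>m. (if x \<in> ball y (1 / Suc m) then kernel2 mu K x y else 0) = 0) sequentially"
          unfolding eventually_sequentially
        proof (intro exI[of _ n] allI impI)
          fix m assume "n \<le> m"
          then have "1 / real (Suc m) \<le> 1 / real (Suc n)" by (intro divide_left_mono) auto
          then show "(if x \<in> ball y (1 / Suc m) then kernel2 mu K x y else 0) = 0" using n by auto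
        qed
        then show "(\<lambda>n. if x \<in> ball y (1 / Suc n) then kernel2 mu K x y else 0) \<longlonglongrightarrow> 0"
          by (rule tendsto_eventually)
      qed
    qed (use meas kernel2_measurable[OF sets_mu K_open] in auto)
    then have "eventually (\<lambda>n. h n x < ennreal \<eta>) sequentially"
      using eta by (intro order_tendstoD(2)) auto
    then obtain n where "h n x < ennreal \<eta>" using eventually_happens'[OF sequentially_bot] by blast
    then show "x \<in> (\<Union>n. R' n)" using \<open>x \<in> R\<close> by (auto simp: R'_def intro: less_imp_le)
  qed
  have "AE x in mu. x \<in> R \<longrightarrow> x \<in> (\<Union>n. R' n)"
    using AE_kernel1 by eventually_elim (use key in blast)
  then have ae: "emeasure mu R \<le> emeasure mu (\<Union>n. R' n)"
    using R' by (intro emeasure_mono_AE) (auto simp: sets_mu)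
  have pos: "0 < hausdorff1 (\<Union>n. R' n)"
  proof -
    show ?thesis
      using ae R R' emeasure_hausdorff1_measure[of R] emeasure_hausdorff1_measure[of "\<Union>n. R' n"]
      by (auto simp: mu_def)
  qed
  have "\<exists>n. 0 < hausdorff1 (R' n)"
  proof (rule ccontr)
    assume "\<not> ?thesis"
    then have "(\<Sum>n. hausdorff1 (R' n)) = 0" by (simp add: not_less)
    then show False using pos hausdorff1_countably_subadditive[of R'] by simp
  qed
  then obtain n where n: "0 < hausdorff1 (R' n)" by blast
  obtain Q :: "'a set" where Q: "countable Q" "\<And>x e. 0 < e \<Longrightarrow> \<exists>q\<in>Q. dist x q < e"
    using countable_dense by blast
  have "\<exists>q\<in>Q. 0 < hausdorff1 (R' n \<inter> ball q (1 / (2 * Suc n)))"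
  proof (rule ccontr)
    assume c: "\<not> ?thesis"
    have "(\<Union>q\<in>Q. R' n \<inter> ball q (1 / (2 * Suc n))) \<in> null_sets mu"
      using c R' emeasure_hausdorff1_measure[of "R' n \<inter> ball q (1 / (2 * Suc n))" for q] Q(1)
      by (intro null_sets_UN') (auto simp: null_sets_def mu_def)
    moreover have "(\<Union>q\<in>Q. R' n \<inter> ball q (1 / (2 * Suc n))) = R' n"
      using Q(2)[of "1 / (2 * Suc n)"] by (fastforce simp: dist_commute)
    ultimately show False using n emeasure_hausdorff1_measure[OF R', of n] by (auto simp: mu_def)
  qed
  then obtain q where q: "0 < hausdorff1 (R' n \<inter> ball q (1 / (2 * Suc n)))" by blast
  define A where "A = R' n \<inter> ball q (1 / (2 * Suc n))"
  show thesis
  proof (rule that[of A])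
    show "A \<in> sets borel" "A \<subseteq> R" "0 < hausdorff1 A" using R' q by (auto simp: A_def R'_def)
    fix x assume x: "x \<in> A"
    have near: "dist y x < 1 / Suc n" if "y \<in> A" for y
    proof -
      have "dist q x < 1 / (2 * Suc n)" "dist q y < 1 / (2 * Suc n)" using x that by (auto simp: A_def)
      then have "dist y x < 1 / (2 * Suc n) + 1 / (2 * Suc n)"
        using dist_triangle[of y x q] by (simp add: dist_commute)
      also have "\<dots> = 1 / Suc n" by (simp add: field_simps)
      finally show ?thesis .
    qed
    have "(\<integral>\<^sup>+ y. indicator A y * kernel2 mu K x y \<partial>mu) \<le> h n x"
      unfolding h_def by (intro nn_integral_mono) (use near in \<open>auto simp: indicator_def\<close>)
    also have "\<dots> \<le> ennreal \<eta>" using x by (auto simp: A_def R'_def)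
    finally show "(\<integral>\<^sup>+ y. indicator A y * kernel2 mu K x y \<partial>mu) \<le> ennreal \<eta>" .
  qed
qed

text \<open>Shrinking the set preserves the curvature bound, so the critical ball can be chosen
  after the localization.\<close>

lemma critical_piece:
  assumes R: "R \<in> sets borel" "0 < hausdorff1 R" "hausdorff1 R < \<infinity>" and eta: "0 < \<eta>"
  obtains A x0 r0 where "A \<in> sets borel" "A \<subseteq> R" "x0 \<in> A" "0 < r0" "A \<subseteq> cball x0 r0"
    "ennreal (r0 / 2) \<le> hausdorff1 A" "hausdorff1 A \<le> ennreal r0"
    "\<And>x. x \<in> A \<Longrightarrow> kernel1 (density mu (indicator A)) K x \<le> ennreal \<eta>"
proof -
  obtain A where A: "A \<in> sets borel" "A \<subseteq> R" "0 < hausdorff1 A"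
    and eta: "\<And>x. x \<in> A \<Longrightarrow> (\<integral>\<^sup>+ y. indicator A y * kernel2 mu K x y \<partial>mu) \<le> ennreal \<eta>"
    using localize[OF R eta] by blast
  have fin: "hausdorff1 A < \<infinity>" using hausdorff1_mono[OF A(2)] R(3) by (auto intro: le_less_trans)
  obtain x r where x: "x \<in> A" "0 < r" "ennreal (r / 2) \<le> hausdorff1 (A \<inter> cball x r)"
    "hausdorff1 (A \<inter> cball x r) \<le> ennreal r"
    using exists_critical_ball[OF A(3) fin] by blast
  define B where "B = A \<inter> cball x r"
  have B: "B \<in> sets borel" using A(1) by (simp add: B_def)
  show thesis
  proof (rule that[of B x r])
    fix y assume y: "y \<in> B"
    have ind: "indicator B \<in> borel_measurable mu" using B by (intro borel_measurable_indicator) (simp add: sets_mu)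
    have k2: "kernel2 (density mu (indicator B)) K y z \<le> kernel2 mu K y z" for z
      unfolding kernel2_def
      by (subst nn_integral_density[OF ind kernel_measurable(1)[OF sets_mu K_open]])
         (auto intro!: nn_integral_mono simp: indicator_def)
    have sd: "sets (density mu (indicator B)) = sets borel" by (simp add: sets_mu)
    have m: "(\<lambda>z. kernel2 (density mu (indicator B)) K y z) \<in> borel_measurable mu"
      using kernel2_measurable[OF sd K_open] by simp
    have "kernel1 (density mu (indicator B)) K y
        = (\<integral>\<^sup>+ z. indicator B z * kernel2 (density mu (indicator B)) K y z \<partial>mu)"
      unfolding kernel1_def by (rule nn_integral_density[OF ind m])
    also have "\<dots> \<le> (\<integral>\<^sup>+ z. indicator A z * kernel2 mu K y z \<partial>mu)"
      by (intro nn_integral_mono mult_mono k2) (auto simp: B_def indicator_def)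
    also have "\<dots> \<le> ennreal \<eta>" using eta y by (auto simp: B_def)
    finally show "kernel1 (density mu (indicator B)) K y \<le> ennreal \<eta>" .
  qed (use x A(2) B in \<open>auto simp: B_def\<close>)
qed

end

section \<open>Polygonal paths\<close>

fun psum :: "('a \<Rightarrow> 'a \<Rightarrow> real) \<Rightarrow> 'a list \<Rightarrow> real" where
  "psum g (x # y # zs) = g x y + psum g (y # zs)"
| "psum g _ = 0"

fun chain3 :: "('a \<Rightarrow> 'a \<Rightarrow> 'a \<Rightarrow> bool) \<Rightarrow> 'a list \<Rightarrow> bool" where
  "chain3 P (x # y # z # zs) \<longleftrightarrow> P x y z \<and> chain3 P (y # z # zs)"
| "chain3 P _ \<longleftrightarrow> True"

lemma psum_split: "psum g (us @ a # vs) = psum g (us @ [a]) + psum g (a # vs)"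
proof (induction us)
  case (Cons u us)
  then show ?case by (cases us) auto
qed simp

lemma psum_snoc: "us \<noteq> [] \<Longrightarrow> psum g (us @ [w]) = psum g us + g (last us) w"
  using psum_split[of g _ _ "[w]"] by (cases us rule: rev_cases) auto

lemma psum_Cons: "vs \<noteq> [] \<Longrightarrow> psum g (w # vs) = g w (hd vs) + psum g vs"
  by (cases vs) auto

lemma psum_append:
  "us \<noteq> [] \<Longrightarrow> vs \<noteq> [] \<Longrightarrow> psum g (us @ vs) = psum g us + g (last us) (hd vs) + psum g vs"
  using psum_split[of g us "hd vs" "tl vs"] psum_snoc[of us g "hd vs"] by simp

lemma psum_insert:
  "us \<noteq> [] \<Longrightarrow> vs \<noteq> [] \<Longrightarrow>
   psum g (us @ w # vs) = psum g (us @ vs) + g (last us) w + g w (hd vs) - g (last us) (hd vs)"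
  using psum_append[of us "w # vs" g] psum_append[of us vs g] psum_Cons[of vs g w] by simp

lemma psum_nonneg: "(\<And>x y. 0 \<le> g x y) \<Longrightarrow> 0 \<le> psum g xs"
  by (induction g xs rule: psum.induct) auto

lemma psum_mono: "successively (\<lambda>a b. g a b \<le> h a b) xs \<Longrightarrow> psum g xs \<le> psum h xs"
  by (induction g xs rule: psum.induct) (auto simp: add_mono)

lemma psum_dist_insert:
  fixes us :: "'a::metric_space list"
  assumes "(us \<noteq> [] \<and> last us = f) \<or> (vs \<noteq> [] \<and> hd vs = f)"
  shows "psum dist (us @ w # vs) \<le> psum dist (us @ vs) + 2 * dist f w"
proof (cases "us = []")
  case True
  then show ?thesis using assms psum_Cons[of vs dist w] by (auto simp: dist_commute)
next
  case us: False
  show ?thesis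
  proof (cases "vs = []")
    case True
    then show ?thesis using assms us psum_snoc[of us dist w] by auto
  next
    case False
    then show ?thesis
      using psum_insert[OF us False, of dist w] assms dist_triangle[of "last us" w "hd vs"]
        dist_triangle[of w "hd vs" "last us"]
      by (auto simp: dist_commute)
  qed
qed

lemma chain3_append2: "chain3 P (us @ a # b # vs) \<longleftrightarrow> chain3 P (us @ [a, b]) \<and> chain3 P (a # b # vs)"
proof (induction us)
  case (Cons u us)
  then show ?case
  proof (cases us)
    case (Cons v us')
    then show ?thesis using Cons.IH by (cases us') auto
  qed auto
qed simp

lemma chain3_snoc: "chain3 P (us @ [l, f, w]) \<longleftrightarrow> chain3 P (us @ [l, f]) \<and> P l f w"
  using chain3_append2[of P us l f "[w]"] by simp

lemma chain3_ConsD: "chain3 P (x # xs) \<Longrightarrow> chain3 P xs"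
  by (cases "(P, x # xs)" rule: chain3.cases) auto

lemma chain3_appendD: "chain3 P (us @ vs) \<Longrightarrow> chain3 P us \<and> chain3 P vs"
proof
  assume *: "chain3 P (us @ vs)"
  show "chain3 P us" using * by (induction P us rule: chain3.induct) auto
  show "chain3 P vs" using *
  proof (induction us)
    case (Cons u us)
    then have "chain3 P (us @ vs)" using chain3_ConsD by simp
    then show ?case by (rule Cons.IH)
  qed simp
qed

lemma chain3_mono: "chain3 P xs \<Longrightarrow> (\<And>a b c. P a b c \<Longrightarrow> Q a b c) \<Longrightarrow> chain3 Q xs"
  by (induction P xs rule: chain3.induct) auto

text \<open>Exactly the edges longer than \<open>m\<close> are cut; each cut removes more than
  \<open>m\<close> of length and adds one piece, hence the \<open>- 1\<close>.\<close>

lemma split_long_edges: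
  fixes xs :: "'a::metric_space list"
  assumes "xs \<noteq> []"
  shows "\<exists>xss. concat xss = xs \<and> [] \<notin> set xss \<and> xss \<noteq> [] \<and>
     (\<forall>ys\<in>set xss. successively (\<lambda>a b. dist a b \<le> m) ys) \<and>
     (\<Sum>ys\<leftarrow>xss. psum dist ys) + m * (real (length xss) - 1) \<le> psum dist xs"
  using assms
proof (induction xs rule: induct_list012)
  case (2 x)
  show ?case by (rule exI[of _ "[[x]]"]) simp
next
  case (3 x y zs)
  obtain ys yss where "concat (ys # yss) = y # zs" "[] \<notin> set (ys # yss)"
     and *: "\<forall>xs\<in>set (ys # yss). successively (\<lambda>a b. dist a b \<le> m) xs"
     "(\<Sum>xs\<leftarrow>ys # yss. psum dist xs) + m * (real (length (ys # yss)) - 1) \<le> psum dist (y # zs)"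
    using 3(2) by (metis list.exhaust list.distinct(1))
  then obtain ys' where ys: "ys = y # ys'" "ys' @ concat yss = zs" "[] \<notin> set yss"
    by (cases ys) auto
  show ?case
  proof (cases "dist x y \<le> m")
    case True
    then show ?thesis using ys * by (intro exI[of _ "(x # ys) # yss"]) auto
  next
    case False
    then show ?thesis using ys * by (intro exI[of _ "[x] # ys # yss"]) (auto simp: algebra_simps)
  qed
qed simp

section \<open>Subsets of a metric space that expand into the line\<close>

text \<open>No continuity is asked of \<open>t\<close>, only that it does not shrink distances. This
  freedom allows pieces to be laid out anywhere on the line.\<close>

definition expands :: "'a::metric_space set \<Rightarrow> bool" where
  "expands Z \<longleftrightarrow> (\<exists>t::'a \<Rightarrow> real. \<forall>z\<in>Z. \<forall>z'\<in>Z. dist z z' \<le> \<bar>t z - t z'\<bar>)"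

lemma psum_take_dist:
  fixes p :: "'a::metric_space list"
  assumes "i \<le> j" "j < length p"
  shows "dist (p ! i) (p ! j) \<le> psum dist (take (Suc j) p) - psum dist (take (Suc i) p)"
  using assms
proof (induction j)
  case (Suc j)
  show ?case
  proof (cases "i = Suc j")
    case False
    have ne: "take (Suc j) p \<noteq> []" "last (take (Suc j) p) = p ! j"
      using Suc.prems by (auto simp: take_Suc_conv_app_nth)
    have "psum dist (take (Suc (Suc j)) p) = psum dist (take (Suc j) p) + dist (p ! j) (p ! Suc j)"
      using psum_snoc[OF ne(1), of dist "p ! Suc j"] ne(2) take_Suc_conv_app_nth[OF Suc.prems(2)] by simp
    moreover have "dist (p ! i) (p ! j) \<le> psum dist (take (Suc j) p) - psum dist (take (Suc i) p)"
      using Suc False by auto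
    ultimately show ?thesis using dist_triangle[of "p ! i" "p ! Suc j" "p ! j"] by linarith
  qed simp
qed simp

lemma psum_take_le: "psum dist (take n p) \<le> psum dist (p :: 'a::metric_space list)"
proof (cases "take n p = [] \<or> drop n p = []")
  case True
  then show ?thesis using psum_nonneg[of dist p] by auto
next
  case False
  then show ?thesis
    using psum_append[of "take n p" "drop n p" dist] psum_nonneg[of dist "drop n p"]
    by (auto simp: add_nonneg_nonneg)
qed

lemma compact_box_fun: "compact {g :: 'a \<Rightarrow> real. \<forall>x. 0 \<le> g x \<and> g x \<le> L}"
proof -
  have "compactin (product_topology (\<lambda>_::'a. euclidean :: real topology) UNIV) (PiE UNIV (\<lambda>_. {0..L}))"
    by (simp add: compactin_PiE)
  then have "compact (PiE UNIV (\<lambda>_::'a. {0..L}))" by (simp add: euclidean_product_topology)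
  moreover have "PiE UNIV (\<lambda>_::'a. {0..L}) = {g. \<forall>x. 0 \<le> g x \<and> g x \<le> L}" by (auto simp: PiE_def Pi_def)
  ultimately show ?thesis by simp
qed

text \<open>Arc-length positions along approximating paths of bounded length have a pointwise cluster point,
  by Tychonoff's theorem.\<close>

lemma expands_if_approximable:
  fixes Z :: "'a::metric_space set" and p :: "nat \<Rightarrow> 'a list"
  assumes L: "\<And>k. psum dist (p k) \<le> L" and r: "r \<longlonglongrightarrow> (0::real)"
    and cov: "\<And>k z. z \<in> Z \<Longrightarrow> \<exists>x\<in>set (p k). dist z x \<le> r k"
  shows "expands Z"
proof -
  have "\<exists>i. i < length (p k) \<and> dist z (p k ! i) \<le> r k" if "z \<in> Z" for k z
    using cov[OF that, of k] by (metis in_set_conv_nth)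
  then have ex: "\<exists>i. z \<in> Z \<longrightarrow> i < length (p k) \<and> dist z (p k ! i) \<le> r k" for k z by blast
  define idx where "idx k z = (SOME i. z \<in> Z \<longrightarrow> i < length (p k) \<and> dist z (p k ! i) \<le> r k)" for k z
  have idx: "idx k z < length (p k)" "dist z (p k ! idx k z) \<le> r k" if "z \<in> Z" for k z
    using someI_ex[OF ex[of z k]] that unfolding idx_def by auto
  define t where "t k z = (if z \<in> Z then psum dist (take (Suc (idx k z)) (p k)) else 0)" for k z
  have close: "dist z z' \<le> \<bar>t k z - t k z'\<bar> + 2 * r k" if z: "z \<in> Z" "z' \<in> Z" for z z' k
  proof -
    have "dist (p k ! idx k z) (p k ! idx k z') \<le> \<bar>t k z - t k z'\<bar>"
      using psum_take_dist[of "idx k z" "idx k z'" "p k"] psum_take_dist[of "idx k z'" "idx k z" "p k"]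
        idx z by (cases "idx k z \<le> idx k z'") (auto simp: t_def dist_commute)
    then show ?thesis
      using idx(2)[OF z(1), of k] idx(2)[OF z(2), of k]
        dist_triangle[of z z' "p k ! idx k z"] dist_triangle[of "p k ! idx k z" z' "p k ! idx k z'"]
      by (simp add: dist_commute)
  qed
  have L0: "0 \<le> L" using L[of 0] psum_nonneg[of dist "p 0"] by (meson order_trans zero_le_dist)
  have box: "t k \<in> {g. \<forall>x. 0 \<le> g x \<and> g x \<le> L}" for k
    using psum_take_le L psum_nonneg[of dist] L0 by (auto simp: t_def intro: order_trans)
  let ?F = "filtermap t sequentially"
  have "?F \<noteq> bot" by (simp add: filtermap_bot_iff)
  moreover have "eventually (\<lambda>g. g \<in> {g. \<forall>x. 0 \<le> g x \<and> g x \<le> L}) ?F"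
    using box by (simp add: eventually_filtermap)
  ultimately obtain g where g: "inf (nhds g) ?F \<noteq> bot"
    using compact_box_fun[of L] unfolding compact_filter by blast
  have "dist z z' \<le> \<bar>g z - g z'\<bar>" if z: "z \<in> Z" "z' \<in> Z" for z z'
  proof (rule field_le_epsilon)
    fix e :: real assume e: "0 < e"
    let ?U = "{h. \<bar>h z - g z\<bar> < e / 4} \<inter> {h. \<bar>h z' - g z'\<bar> < e / 4}"
    have "open ?U"
      by (intro open_Int open_Collect_less continuous_intros continuous_on_product_coordinates)
    moreover have "g \<in> ?U" using e by simp
    ultimately have "eventually (\<lambda>h. h \<in> ?U) (nhds g)" by (rule eventually_nhds_in_open)
    moreover have "eventually (\<lambda>h. \<exists>k. h = t k \<and> r k < e / 4) ?F"
      unfolding eventually_filtermap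
      using order_tendstoD(2)[OF r, of "e / 4"] e by (auto elim: eventually_mono)
    ultimately have "eventually (\<lambda>h. h \<in> ?U \<and> (\<exists>k. h = t k \<and> r k < e / 4)) (inf (nhds g) ?F)"
      unfolding eventually_inf by blast
    then obtain h where "h \<in> ?U" "\<exists>k. h = t k \<and> r k < e / 4"
      using eventually_happens'[OF g] by blast
    then obtain k where "\<bar>t k z - g z\<bar> < e / 4" "\<bar>t k z' - g z'\<bar> < e / 4" "r k < e / 4" by auto
    then show "dist z z' \<le> \<bar>g z - g z'\<bar> + e" using close[OF z, of k] by linarith
  qed
  then show ?thesis unfolding expands_def by blast
qed

text \<open>The pieces are cut down to length one and laid out far apart from each other.\<close>

lemma expands_UN:
  fixes Z :: "nat \<Rightarrow> 'a::metric_space set"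
  assumes "\<And>n. expands (Z n)"
  shows "expands (\<Union>n. Z n)"
proof -
  obtain t :: "nat \<Rightarrow> 'a \<Rightarrow> real" where t: "\<And>n z z'. z \<in> Z n \<Longrightarrow> z' \<in> Z n \<Longrightarrow> dist z z' \<le> \<bar>t n z - t n z'\<bar>"
    using assms unfolding expands_def by metis
  define n where "n z = (LEAST n. z \<in> Z n)" for z
  have n: "z \<in> Z (n z)" if "z \<in> (\<Union>n. Z n)" for z
    using that unfolding n_def by (auto intro: LeastI)
  define m where "m z = \<lfloor>t (n z) z\<rfloor>" for z
  define c where "c z = to_nat (n z, m z)" for z
  define \<tau> where "\<tau> z = t (n z) z - m z" for z
  have \<tau>: "0 \<le> \<tau> z" "\<tau> z < 1" for z unfolding \<tau>_def m_def by linarith+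
  have same: "dist z z' \<le> \<bar>\<tau> z - \<tau> z'\<bar>" if "z \<in> (\<Union>n. Z n)" "z' \<in> (\<Union>n. Z n)" "c z = c z'" for z z'
  proof -
    have "n z = n z'" "m z = m z'" using that(3) by (auto simp: c_def)
    then show ?thesis using t[OF n[OF that(1)], of z'] n[OF that(2)] by (simp add: \<tau>_def)
  qed
  define y where "y i = (SOME z. z \<in> (\<Union>n. Z n) \<and> c z = i)" for i
  have y: "y (c z) \<in> (\<Union>n. Z n)" "c (y (c z)) = c z" if "z \<in> (\<Union>n. Z n)" for z
    using someI[of "\<lambda>z'. z' \<in> (\<Union>n. Z n) \<and> c z' = c z" z] that unfolding y_def by auto
  \<comment> \<open>The 3 covers two distances of at most 1 to the representatives and the
    difference of the \<open>\<tau>\<close>. For an index with empty class \<open>y i\<close> is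
    arbitrary, which only widens the gaps.\<close>
  define s where "s i = 3 * real i + (\<Sum>k<i. dist (y k) (y (Suc k)))" for i
  have s: "3 + dist (y i) (y j) \<le> s j - s i" if "i < j" for i j
    using that
  proof (induction j)
    case (Suc j)
    have "s (Suc j) = s j + 3 + dist (y j) (y (Suc j))" by (simp add: s_def)
    then show ?case
      using Suc dist_triangle[of "y i" "y (Suc j)" "y j"] zero_le_dist[of "y j" "y (Suc j)"]
      by (cases "i = j") (auto simp del: zero_le_dist)
  qed simp
  have less: "dist z z' \<le> \<bar>(s (c z) + \<tau> z) - (s (c z') + \<tau> z')\<bar>"
    if z: "z \<in> (\<Union>n. Z n)" "z' \<in> (\<Union>n. Z n)" "c z < c z'" for z z'
  proof -
    have "dist z (y (c z)) \<le> 1" "dist z' (y (c z')) \<le> 1"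
      using same[OF z(1) y(1)[OF z(1)]] same[OF z(2) y(1)[OF z(2)]] y(2)[OF z(1)] y(2)[OF z(2)]
        \<tau>[of z] \<tau>[of z'] \<tau>[of "y (c z)"] \<tau>[of "y (c z')"] by auto
    moreover have "dist z z' \<le> dist z (y (c z)) + dist (y (c z)) (y (c z')) + dist z' (y (c z'))"
      using dist_triangle[of z z' "y (c z)"] dist_triangle[of "y (c z)" z' "y (c z')"] by (simp add: dist_commute)
    ultimately show ?thesis using s[OF z(3)] \<tau>[of z] \<tau>[of z'] by linarith
  qed
  show ?thesis
    unfolding expands_def
  proof (intro exI[of _ "\<lambda>z. s (c z) + \<tau> z"] ballI)
    fix z z' assume z: "z \<in> (\<Union>n. Z n)" "z' \<in> (\<Union>n. Z n)"
    show "dist z z' \<le> \<bar>(s (c z) + \<tau> z) - (s (c z') + \<tau> z')\<bar>"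
      using less[OF z] less[OF z(2,1)] same[OF z] by (cases "c z" "c z'" rule: linorder_cases) (auto simp: dist_commute abs_minus_commute)
  qed
qed

section \<open>Nearly flat configurations\<close>

text \<open>Sort the points other than a fixed \<open>p\<close> by \<open>dist p y\<close> into bins
  of width \<open>s/2\<close>. By \<open>three_in_one_bin\<close> each of the at most
  \<open>4 * R / s + 1\<close> bins holds at most two of them.\<close>

lemma card_flat_separated_le:
  fixes Y :: "'a::metric_space set"
  assumes fin: "finite Y" and sub: "Y \<subseteq> cball x R"
    and sep: "\<And>u v. u \<in> Y \<Longrightarrow> v \<in> Y \<Longrightarrow> u \<noteq> v \<Longrightarrow> s \<le> dist u v"
    and flat: "\<And>u v w. u \<in> Y \<Longrightarrow> v \<in> Y \<Longrightarrow> w \<in> Y \<Longrightarrow> u \<noteq> v \<Longrightarrow> v \<noteq> w \<Longrightarrow> u \<noteq> w \<Longrightarrow> excess u v w \<le> t"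
    and t: "8 * t < s" "0 < s" "0 \<le> R"
  shows "real (card Y) \<le> 8 * R / s + 3"
proof (cases "Y = {}")
  case True
  then show ?thesis using t by simp
next
  case False
  then obtain p where p: "p \<in> Y" by blast
  define f where "f y = \<lfloor>2 * dist p y / s\<rfloor>" for y
  have bin: "\<bar>dist p u - dist p v\<bar> \<le> s/2" if "f u = f v" for u v
  proof -
    have "\<bar>2 * dist p u / s - 2 * dist p v / s\<bar> \<le> 1"
      using that unfolding f_def by linarith
    then have "\<bar>2 * dist p u - 2 * dist p v\<bar> \<le> s"
      using t(2) by (simp add: diff_divide_distrib[symmetric] abs_div pos_divide_le_eq)
    then show ?thesis by linarith
  qed
  have fib: "card {y \<in> Y - {p}. f y = i} \<le> 2" for i
  proof (rule ccontr)
    assume "\<not> ?thesis"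
    then have "3 \<le> card {y \<in> Y - {p}. f y = i}" by simp
    then obtain S where S: "S \<subseteq> {y \<in> Y - {p}. f y = i}" "card S = 3"
      by (metis obtain_subset_with_card_n)
    then obtain u v w where S: "u \<noteq> v" "v \<noteq> w" "u \<noteq> w" "S = {u, v, w}" "u \<in> Y" "v \<in> Y" "w \<in> Y"
      "u \<noteq> p" "v \<noteq> p" "w \<noteq> p" "f u = f v" "f u = f w" "f v = f w"
      by (auto simp: card_3_iff)
    show False
      by (rule three_in_one_bin[of p u v t w s]) (use S flat sep bin p t in auto)
  qed
  define I where "I = {0..\<lfloor>4 * R / s\<rfloor>}"
  have "f y \<in> I" if "y \<in> Y" for y
  proof -
    have "dist x p \<le> R" "dist x y \<le> R" using p that sub by auto
    then have "dist p y \<le> 2 * R" using dist_triangle[of p y x] by (simp add: dist_commute)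
    then have "2 * dist p y / s \<le> 4 * R / s" using t(2) by (simp add: divide_right_mono)
    then show ?thesis using t(2) unfolding I_def f_def by (auto simp: floor_mono)
  qed
  then have "Y - {p} = (\<Union>i\<in>I. {y \<in> Y - {p}. f y = i})" by auto
  then have "card (Y - {p}) = card (\<Union>i\<in>I. {y \<in> Y - {p}. f y = i})" by (rule arg_cong)
  also have "\<dots> \<le> (\<Sum>i\<in>I. card {y \<in> Y - {p}. f y = i})"
    by (rule card_UN_le) (simp add: I_def)
  also have "\<dots> \<le> (\<Sum>i\<in>I. 2)" by (intro sum_mono fib)
  also have "\<dots> = 2 * card I" by simp
  finally have "real (card (Y - {p})) \<le> 2 * real (card I)" by linarith
  moreover have "real (card I) \<le> 4 * R / s + 1"
    using t unfolding I_def by (simp add: of_nat_nat)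
  moreover have "real (card Y) = real (card (Y - {p})) + 1"
    using card_Suc_Diff1[OF fin p] by linarith
  ultimately show ?thesis by linarith
qed

text \<open>Pure linear arithmetic in the ten distances. The three consecutive triples fix the order
  locally; the alternatives are the possible orders of the other flat triples.\<close>

lemma five_points_real:
  fixes d12 d13 d14 d15 d23 d24 d25 d34 d35 d45 s t :: real
  assumes "20 * t < s" "0 \<le> t"
    and "s \<le> d12" "s \<le> d13" "s \<le> d14" "s \<le> d15" "s \<le> d23" "s \<le> d24" "s \<le> d25" "s \<le> d34" "s \<le> d35" "s \<le> d45"
    and "d12 + d23 - d13 \<le> t" "d23 + d34 - d24 \<le> t" "d34 + d45 - d35 \<le> t"
    and "d12 + d24 - d14 \<le> t \<or> d14 + d24 - d12 \<le> t \<or> d12 + d14 - d24 \<le> t"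
      "d12 + d25 - d15 \<le> t \<or> d15 + d25 - d12 \<le> t \<or> d12 + d15 - d25 \<le> t"
      "d13 + d34 - d14 \<le> t \<or> d14 + d34 - d13 \<le> t \<or> d13 + d14 - d34 \<le> t"
      "d13 + d35 - d15 \<le> t \<or> d15 + d35 - d13 \<le> t \<or> d13 + d15 - d35 \<le> t"
      "d14 + d45 - d15 \<le> t \<or> d15 + d45 - d14 \<le> t \<or> d14 + d15 - d45 \<le> t"
      "d23 + d35 - d25 \<le> t \<or> d25 + d35 - d23 \<le> t \<or> d23 + d25 - d35 \<le> t"
      "d24 + d45 - d25 \<le> t \<or> d25 + d45 - d24 \<le> t \<or> d24 + d25 - d45 \<le> t"
    and "d13 \<le> d12 + d23" "d23 \<le> d12 + d13" "d12 \<le> d13 + d23"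
      "d14 \<le> d12 + d24" "d24 \<le> d12 + d14" "d12 \<le> d14 + d24"
      "d15 \<le> d12 + d25" "d25 \<le> d12 + d15" "d12 \<le> d15 + d25"
      "d14 \<le> d13 + d34" "d34 \<le> d13 + d14" "d13 \<le> d14 + d34"
      "d15 \<le> d13 + d35" "d35 \<le> d13 + d15" "d13 \<le> d15 + d35"
      "d15 \<le> d14 + d45" "d45 \<le> d14 + d15" "d14 \<le> d15 + d45"
      "d24 \<le> d23 + d34" "d34 \<le> d23 + d24" "d23 \<le> d24 + d34"
      "d25 \<le> d23 + d35" "d35 \<le> d23 + d25" "d23 \<le> d25 + d35"
      "d25 \<le> d24 + d45" "d45 \<le> d24 + d25" "d24 \<le> d25 + d45"
      "d35 \<le> d34 + d45" "d45 \<le> d34 + d35" "d34 \<le> d35 + d45"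
  shows "d13 + d35 - d15 \<le> t" "d13 + d34 - d14 \<le> t" "d23 + d35 - d25 \<le> t"
  using assms by (smt (z3), smt (z3), smt (z3))

text \<open>Five points are needed: all triples of the four-cycle are degenerate, but it does not embed
  into the line.\<close>

lemma five_points_detour:
  fixes x1 x2 x3 x4 x5 :: "'a::metric_space"
  assumes t: "20 * t < s" "0 \<le> t"
    and sep: "s \<le> dist x1 x2" "s \<le> dist x1 x3" "s \<le> dist x1 x4" "s \<le> dist x1 x5" "s \<le> dist x2 x3" "s \<le> dist x2 x4" "s \<le> dist x2 x5" "s \<le> dist x3 x4" "s \<le> dist x3 x5" "s \<le> dist x4 x5"
    and mono: "detour x1 x2 x3 \<le> t" "detour x2 x3 x4 \<le> t" "detour x3 x4 x5 \<le> t"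
    and flat: "excess x1 x2 x4 \<le> t" "excess x1 x2 x5 \<le> t" "excess x1 x3 x4 \<le> t" "excess x1 x3 x5 \<le> t" "excess x1 x4 x5 \<le> t" "excess x2 x3 x5 \<le> t" "excess x2 x4 x5 \<le> t"
  shows "detour x1 x3 x5 \<le> t" "detour x1 x3 x4 \<le> t" "detour x2 x3 x5 \<le> t" "detour x2 x3 x4 \<le> t"
proof -
  have flat': "dist a b + dist b c - dist a c \<le> t \<or> dist a c + dist b c - dist a b \<le> t \<or> dist a b + dist a c - dist b c \<le> t"
    if "excess a b c \<le> t" for a b c :: 'a
    using that by (auto simp: excess_le_iff detour_def dist_commute)
  have tri1: "dist a c \<le> dist a b + dist b c" for a c b :: 'a by (rule dist_triangle)
  have tri2: "dist b c \<le> dist a b + dist a c" for b c a :: 'a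
    using dist_triangle[of b c a] by (simp add: dist_commute)
  have tri3: "dist a b \<le> dist a c + dist b c" for a b c :: 'a
    using dist_triangle[of a b c] by (simp add: dist_commute)
  note R = five_points_real[OF t sep mono[unfolded detour_def] flat[THEN flat']
    tri1[of x1 x3 x2] tri2[of x2 x3 x1] tri3[of x1 x2 x3]
    tri1[of x1 x4 x2] tri2[of x2 x4 x1] tri3[of x1 x2 x4]
    tri1[of x1 x5 x2] tri2[of x2 x5 x1] tri3[of x1 x2 x5]
    tri1[of x1 x4 x3] tri2[of x3 x4 x1] tri3[of x1 x3 x4]
    tri1[of x1 x5 x3] tri2[of x3 x5 x1] tri3[of x1 x3 x5]
    tri1[of x1 x5 x4] tri2[of x4 x5 x1] tri3[of x1 x4 x5]
    tri1[of x2 x4 x3] tri2[of x3 x4 x2] tri3[of x2 x3 x4]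
    tri1[of x2 x5 x3] tri2[of x3 x5 x2] tri3[of x2 x3 x5]
    tri1[of x2 x5 x4] tri2[of x4 x5 x2] tri3[of x2 x4 x5]
    tri1[of x3 x5 x4] tri2[of x4 x5 x3] tri3[of x3 x4 x5]]
  show "detour x1 x3 x5 \<le> t" "detour x1 x3 x4 \<le> t" "detour x2 x3 x5 \<le> t" "detour x2 x3 x4 \<le> t"
    using R mono(2) unfolding detour_def by blast+
qed

section \<open>A nearly flat measure at all scales\<close>

lemma ennreal_enn2real_le: "x \<le> ennreal C \<Longrightarrow> ennreal (enn2real x) = x"
  by (rule ennreal_enn2real) (rule le_less_trans[OF _ ennreal_less_top])

text \<open>By Markov's inequality each \<open>f\<close> fails its bound on at most the fraction
  \<open>1 / (card F + 1)\<close> of \<open>B\<close>, so all failures together leave positive mass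
  outside \<open>N\<close>.\<close>

lemma exists_Markov_point:
  assumes fin: "finite F" and F: "\<And>f. f \<in> F \<Longrightarrow> f \<in> borel_measurable M"
    and B: "B \<in> sets M" "0 < emeasure M B" "emeasure M B < \<infinity>"
    and N: "N \<in> null_sets M"
  shows "\<exists>w\<in>B - N. \<forall>f\<in>F. f w * emeasure M B \<le> of_nat (card F + 1) * (\<integral>\<^sup>+ x\<in>B. f x \<partial>M)"
proof (rule ccontr)
  assume neg: "\<not> ?thesis"
  obtain b where b: "emeasure M B = ennreal b" "0 < b"
    using B by (cases "emeasure M B" rule: ennreal_cases) auto
  define n where "n = card F + 1"
  have n: "0 < n" by (simp add: n_def)
  define bad where "bad f = {x \<in> B. of_nat n * (\<integral>\<^sup>+ x\<in>B. f x \<partial>M) < f x * emeasure M B}" for f :: "'a \<Rightarrow> ennreal"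
  have meas: "bad f \<in> sets M" if "f \<in> F" for f
  proof -
    have [measurable]: "f \<in> borel_measurable M" "B \<in> sets M" using F[OF that] B(1) by auto
    have "bad f = {x \<in> space M. x \<in> B \<and> of_nat n * (\<integral>\<^sup>+ x\<in>B. f x \<partial>M) < f x * emeasure M B}"
      using sets.sets_into_space[OF B(1)] by (auto simp: bad_def)
    then show ?thesis by simp
  qed
  have small: "emeasure M (bad f) \<le> ennreal (b / n)" if f: "f \<in> F" for f
  proof -
    have [measurable]: "f \<in> borel_measurable M" "B \<in> sets M" using F[OF f] B(1) by auto
    let ?I = "\<integral>\<^sup>+ x\<in>B. f x \<partial>M"
    consider "?I = top" | "?I = 0" | i where "?I = ennreal i" "0 < i"
      by (cases ?I rule: ennreal_cases) (auto, metis ennreal_0 less_eq_real_def)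
    then show ?thesis
    proof cases
      case 1
      then have "bad f = {}" using n by (auto simp: bad_def ennreal_mult_top)
      then show ?thesis by simp
    next
      case 2
      have "AE x in M. f x * indicator B x = 0"
        using 2 by (subst (asm) nn_integral_0_iff_AE) auto
      then have "AE x in M. x \<notin> bad f"
        by eventually_elim (auto simp: bad_def indicator_def split: if_splits)
      then have "emeasure M (bad f) = 0"
        using meas[OF f] sets.sets_into_space[OF meas[OF f]]
        by (subst (asm) AE_iff_measurable[of "bad f"]) auto
      then show ?thesis by simp
    next
      case 3
      have "bad f \<subseteq> {x \<in> B. 1 \<le> ennreal (b / (n * i)) * f x}"
      proof
        fix x assume x: "x \<in> bad f"
        then have lt: "ennreal (n * i) \<le> f x * ennreal b"
          using 3 b by (auto simp: bad_def ennreal_mult ennreal_of_nat_eq_real_of_nat)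
        have "1 = ennreal (1 / (n * i)) * ennreal (n * i)"
          using n 3(2) by (subst ennreal_mult[symmetric]) auto
        also have "\<dots> \<le> ennreal (1 / (n * i)) * (f x * ennreal b)" by (intro mult_left_mono lt) simp
        also have "\<dots> = (ennreal (1 / (n * i)) * ennreal b) * f x" by (simp add: ac_simps)
        also have "ennreal (1 / (n * i)) * ennreal b = ennreal (b / (n * i))"
          using n 3(2) b(2) by (subst ennreal_mult[symmetric]) auto
        finally show "x \<in> {x \<in> B. 1 \<le> ennreal (b / (n * i)) * f x}" using x by (auto simp: bad_def)
      qed
      then have "emeasure M (bad f) \<le> emeasure M {x \<in> B. 1 \<le> ennreal (b / (n * i)) * f x}"
        by (intro emeasure_mono) (auto simp: sets_Collect_restrict_space_iff)
      also have "\<dots> \<le> ennreal (b / (n * i)) * ?I"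
        by (rule nn_integral_Markov_inequality) auto
      also have "\<dots> = ennreal (b / n)"
        using 3 b(2) n by (subst 3(1), subst ennreal_mult[symmetric]) auto
      finally show ?thesis .
    qed
  qed
  have "B \<subseteq> N \<union> (\<Union>f\<in>F. bad f)"
    using neg by (auto simp: bad_def n_def not_le)
  then have "emeasure M B \<le> emeasure M (N \<union> (\<Union>f\<in>F. bad f))"
    using meas N fin by (intro emeasure_mono) auto
  also have "\<dots> \<le> emeasure M N + emeasure M (\<Union>f\<in>F. bad f)"
    using meas N fin by (intro emeasure_subadditive) auto
  also have "\<dots> \<le> 0 + (\<Sum>f\<in>F. emeasure M (bad f))"
    using N meas fin by (intro add_mono emeasure_subadditive_finite) auto
  also have "\<dots> \<le> (\<Sum>f\<in>F. ennreal (b / n))" unfolding add_0 by (intro sum_mono small)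
  also have "\<dots> = ennreal (card F * (b / n))"
    using b(2) by (simp add: ennreal_of_nat_eq_real_of_nat ennreal_mult[symmetric])
  also have "\<dots> < ennreal b"
    using b(2) n by (intro ennreal_lessI) (auto simp: n_def field_simps)
  finally show False using b(1) by simp
qed

text \<open>Radius of the selection balls relative to the scale. A displacement of this size must be
  negligible against the separation and, even after the factor 400 in \<open>excess_recents\<close>,
  against the flatness tolerance.\<close>

definition alpha :: real where "alpha = 1 / 1000000"

text \<open>\<open>\<delta>\<close> is the density below which a ball will count as sparse. The
  bound \<open>flat\<close> is demanded at every point of \<open>S\<close> because it will be
  applied to sparse points, which are not selected by Markov's inequality.\<close>

locale flat_measure =
  fixes \<nu> :: "'a::metric_space measure" and S :: "'a set" and x0 :: 'a and r0 \<delta> \<eta> :: real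
  assumes sets_nu: "sets \<nu> = sets borel"
    and S_borel: "S \<in> sets borel"
    and null_Compl: "emeasure \<nu> (- S) = 0"
    and x0: "x0 \<in> S" and r0: "0 < r0" and S_sub: "S \<subseteq> cball x0 r0"
    and mass: "emeasure \<nu> UNIV \<le> ennreal r0"
    and flat: "\<And>x. x \<in> S \<Longrightarrow> kernel1 \<nu> {0<..} x \<le> ennreal \<eta>"
    and \<delta>: "0 < \<delta>" "\<delta> \<le> 1" and \<eta>: "0 < \<eta>"
begin

section \<open>Scales and the curvature at one scale\<close>

definition r :: "nat \<Rightarrow> real" where "r k = r0 * (2/3) ^ k"

text \<open>The window contains the diameters of all triples tested when a point is inserted: at
  least \<open>98/100 * r k\<close> by separation and at most \<open>9152/100 * r k\<close>.\<close>

definition I :: "nat \<Rightarrow> real set" where "I k = {9/10 * r k <..< 180 * r k}"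

abbreviation c where "c k \<equiv> kernel (I k)"
abbreviation B where "B k \<equiv> kernel2 \<nu> (I k)"
abbreviation A where "A k \<equiv> kernel1 \<nu> (I k)"

lemma r_pos: "0 < r k" using r0 by (simp add: r_def)

lemma r_Suc: "r (Suc k) = 2/3 * r k" by (simp add: r_def)

lemma r_antimono: "j \<le> k \<Longrightarrow> r k \<le> r j"
  using r0 by (auto simp: r_def intro!: power_decreasing)

lemma r_add: "r (k + j) = r k * (2/3) ^ j" by (simp add: r_def power_add)

lemma r_0: "r 0 = r0" by (simp add: r_def)

lemma space_nu: "space \<nu> = UNIV" using sets_eq_imp_space_eq[OF sets_nu] by simp

sublocale finite_measure \<nu>
  by (rule finite_measureI) (use mass in \<open>auto simp: space_nu top_unique\<close>)

lemma measure_UNIV_le: "measure \<nu> X \<le> r0"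
proof -
  have "emeasure \<nu> X \<le> ennreal r0" using emeasure_space[of \<nu> X] mass by (simp add: space_nu)
  then show ?thesis using r0 by (simp add: emeasure_eq_measure)
qed

lemma Compl_null: "- S \<in> null_sets \<nu>"
  using null_Compl S_borel by (auto simp: null_sets_def sets_nu)

lemma AE_S: "AE x in \<nu>. x \<in> S"
  using Compl_null by (intro AE_I'[of "- S"]) auto

lemma I_open: "open (I k)" "0 \<notin> I k" using r_pos[of k] by (auto simp: I_def)

lemma pos_open: "open {0::real<..}" "0 \<notin> {0::real<..}" by auto

lemma c_measurable: "(\<lambda>z. c k x y z) \<in> borel_measurable \<nu>"
  by (intro kernel_measurable sets_nu I_open)

lemma B_measurable: "(\<lambda>y. B k x y) \<in> borel_measurable \<nu>"
  by (intro kernel2_measurable sets_nu I_open)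

lemma A_measurable: "A k \<in> borel_measurable \<nu>"
  by (intro kernel1_measurable sets_nu I_open)

text \<open>Each diameter is comparable to boundedly many scales: \<open>(3/2)^14 > 200\<close>.\<close>

lemma sum_c_le: "(\<Sum>k. c k x y z) \<le> 14 * kernel {0<..} x y z"
proof -
  define D where "D = diam3 x y z"
  define Ks where "Ks = {k. D \<in> I k}"
  show ?thesis
  proof (cases "Ks = {}")
    case True
    then have "c k x y z = 0" for k by (auto simp: kernel_def Ks_def D_def)
    then show ?thesis by simp
  next
    case False
    define k0 where "k0 = (LEAST k. k \<in> Ks)"
    have k0: "k0 \<in> Ks" "\<And>k. k \<in> Ks \<Longrightarrow> k0 \<le> k"
      using False unfolding k0_def by (auto intro: LeastI Least_le)
    have "k < k0 + 14" if k: "k \<in> Ks" for k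
    proof (rule ccontr)
      assume "\<not> k < k0 + 14"
      then have "r k \<le> r (k0 + 14)" by (intro r_antimono) simp
      moreover have "r (k0 + 14) = r k0 * (2/3) ^ 14" by (rule r_add)
      moreover have "9/10 * r k0 < D" "D < 180 * r k" using k k0(1) by (auto simp: Ks_def I_def)
      ultimately have "9/10 * r k0 < 180 * (r k0 * (2/3) ^ 14)" by linarith
      then show False using r_pos[of k0] by (simp add: power_numeral_reduce)
    qed
    then have sub: "Ks \<subseteq> {k0..<k0 + 14}" using k0 by auto
    then have fin: "finite Ks" and card: "card Ks \<le> 14" using card_mono[OF _ sub] finite_subset by auto
    have D: "0 < D" using k0(1) r_pos[of k0] by (auto simp: Ks_def I_def)
    have "(\<Sum>k. c k x y z) = (\<Sum>k\<in>Ks. c k x y z)"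
      by (rule suminf_finite[OF fin]) (auto simp: Ks_def kernel_def D_def)
    also have "\<dots> = (\<Sum>k\<in>Ks. kernel {0<..} x y z)"
      using D by (intro sum.cong) (auto simp: Ks_def kernel_def D_def)
    also have "\<dots> = of_nat (card Ks) * kernel {0<..} x y z" by simp
    also have "\<dots> \<le> of_nat 14 * kernel {0<..} x y z" using card by (intro mult_right_mono of_nat_mono) auto
    finally show ?thesis by simp
  qed
qed

lemma sum_A_le: assumes "x \<in> S" shows "(\<Sum>k. A k x) \<le> ennreal (14 * \<eta>)"
proof -
  have "(\<Sum>k. A k x) = (\<integral>\<^sup>+ y. (\<Sum>k. B k x y) \<partial>\<nu>)"
    unfolding kernel1_def by (rule nn_integral_suminf[symmetric]) (rule B_measurable)
  also have "\<dots> = (\<integral>\<^sup>+ y. (\<integral>\<^sup>+ z. (\<Sum>k. c k x y z) \<partial>\<nu>) \<partial>\<nu>)"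
    unfolding kernel2_def by (intro nn_integral_cong nn_integral_suminf[symmetric] c_measurable)
  also have "\<dots> \<le> (\<integral>\<^sup>+ y. (\<integral>\<^sup>+ z. 14 * kernel {0<..} x y z \<partial>\<nu>) \<partial>\<nu>)"
    by (intro nn_integral_mono sum_c_le)
  also have "\<dots> = (\<integral>\<^sup>+ y. 14 * kernel2 \<nu> {0<..} x y \<partial>\<nu>)"
    unfolding kernel2_def by (intro nn_integral_cong nn_integral_cmult kernel_measurable sets_nu pos_open)
  also have "\<dots> = 14 * kernel1 \<nu> {0<..} x"
    unfolding kernel1_def by (intro nn_integral_cmult kernel2_measurable sets_nu pos_open)
  also have "\<dots> \<le> 14 * ennreal \<eta>" by (intro mult_left_mono flat assms) simp
  also have "\<dots> = ennreal (14 * \<eta>)" using \<eta> by (simp add: ennreal_mult)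
  finally show ?thesis .
qed

text \<open>The weights are \<open>r (k + j) / r k\<close>, so \<open>r k * H k x\<close> sums
  \<open>r i * A i x\<close> over \<open>i \<ge> k\<close>: all that \<open>x\<close> may be charged
  from level \<open>k\<close> on. Its real version is \<open>e\<close>.\<close>

definition H :: "nat \<Rightarrow> 'a \<Rightarrow> ennreal" where "H k x = (\<Sum>j. ennreal ((2/3) ^ j) * A (k + j) x)"

lemma H_measurable: "H k \<in> borel_measurable \<nu>"
  unfolding H_def using A_measurable by measurable

lemma H_eq: "H k x = A k x + ennreal (2/3) * H (Suc k) x"
proof -
  have "H k x = (\<Sum>j. ennreal ((2/3) ^ (j + 1)) * A (k + (j + 1)) x) + (\<Sum>j<1. ennreal ((2/3) ^ j) * A (k + j) x)"
    unfolding H_def by (rule suminf_offset) auto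
  also have "(\<Sum>j. ennreal ((2/3) ^ (j + 1)) * A (k + (j + 1)) x) = (\<Sum>j. ennreal (2/3) * (ennreal ((2/3) ^ j) * A (Suc k + j) x))"
  proof (intro suminf_cong)
    fix j
    have "ennreal ((2/3) ^ (j + 1)) = ennreal (2/3) * ennreal ((2/3) ^ j)"
      by (subst ennreal_mult[symmetric]) auto
    moreover have "k + (j + 1) = Suc k + j" by simp
    ultimately show "ennreal ((2/3) ^ (j + 1)) * A (k + (j + 1)) x = ennreal (2/3) * (ennreal ((2/3) ^ j) * A (Suc k + j) x)"
      by (simp only: mult.assoc)
  qed
  also have "\<dots> = ennreal (2/3) * H (Suc k) x" unfolding H_def by (rule ennreal_suminf_cmult)
  finally show ?thesis by (simp add: add.commute)
qed

lemma H_le: assumes "x \<in> S" shows "H k x \<le> ennreal (14 * \<eta>)"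
proof -
  have "H k x \<le> (\<Sum>j. A (j + k) x)"
    unfolding H_def
  proof (intro suminf_le)
    fix j
    have "ennreal ((2/3) ^ j) * A (k + j) x \<le> 1 * A (k + j) x"
      by (intro mult_right_mono) (auto simp: power_le_one)
    then show "ennreal ((2/3) ^ j) * A (k + j) x \<le> A (j + k) x" by (simp add: add.commute)
  qed auto
  also have "\<dots> \<le> (\<Sum>j. A j x)"
    by (subst suminf_offset[of "\<lambda>j. A j x" k]) auto
  also have "\<dots> \<le> ennreal (14 * \<eta>)" by (rule sum_A_le[OF assms])
  finally show ?thesis .
qed

lemma A_le_H: "A k x \<le> H k x"
  by (subst H_eq) simp

definition a :: "nat \<Rightarrow> 'a \<Rightarrow> real" where "a k x = enn2real (A k x)"
definition e :: "nat \<Rightarrow> 'a \<Rightarrow> real" where "e k x = r k * enn2real (H k x)"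

lemma A_eq: "x \<in> S \<Longrightarrow> A k x = ennreal (a k x)"
  unfolding a_def by (rule ennreal_enn2real_le[symmetric, OF order_trans[OF A_le_H H_le]])

lemma H_ennreal: "x \<in> S \<Longrightarrow> H k x = ennreal (e k x / r k)"
  unfolding e_def using ennreal_enn2real_le[OF H_le, of x k] r_pos[of k] by simp

lemma a_nonneg: "0 \<le> a k x" by (simp add: a_def)

lemma e_nonneg: "0 \<le> e k x" using r_pos[of k] by (simp add: e_def)

lemma a_le: "x \<in> S \<Longrightarrow> a k x \<le> 14 * \<eta>"
  using order_trans[OF A_le_H H_le, of x k] A_eq[of x k] \<eta> by simp

lemma e_le: "x \<in> S \<Longrightarrow> e k x \<le> 14 * \<eta> * r k"
  using H_le[of x k] H_ennreal[of x k] \<eta> r_pos[of k] by (simp add: pos_divide_le_eq)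

lemma e_Suc: assumes "x \<in> S" shows "e k x = r k * a k x + e (Suc k) x"
proof -
  have "ennreal (e k x / r k) = ennreal (a k x + 2/3 * (e (Suc k) x / r (Suc k)))"
    using H_eq[of k x] r_pos[of "Suc k"] unfolding H_ennreal[OF assms] A_eq[OF assms]
    by (simp add: ennreal_mult[symmetric] ennreal_plus[symmetric] a_nonneg e_nonneg del: ennreal_plus)
  then have "e k x / r k = a k x + 2/3 * (e (Suc k) x / r (Suc k))"
    using r_pos[of k] r_pos[of "Suc k"] a_nonneg[of k x] e_nonneg[of k x] e_nonneg[of "Suc k" x]
    by (subst (asm) ennreal_inj) auto
  then show ?thesis using r_pos[of k] by (simp add: r_Suc field_simps)
qed

definition budget :: "nat \<Rightarrow> real" where "budget k = enn2real (\<integral>\<^sup>+ x. H k x \<partial>\<nu>)"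

lemma nn_integral_le_r0:
  assumes "\<And>x. x \<in> S \<Longrightarrow> f x \<le> ennreal C" "0 \<le> C"
  shows "(\<integral>\<^sup>+ x. f x \<partial>\<nu>) \<le> ennreal (C * r0)"
proof -
  have "(\<integral>\<^sup>+ x. f x \<partial>\<nu>) \<le> (\<integral>\<^sup>+ x. ennreal C \<partial>\<nu>)"
    using AE_S by (intro nn_integral_mono_AE) (use assms in \<open>auto elim: eventually_mono\<close>)
  also have "\<dots> \<le> ennreal C * ennreal r0" using mass by (auto simp: space_nu intro: mult_left_mono)
  finally show ?thesis using assms(2) r0 by (simp add: ennreal_mult)
qed

lemma int_H: "(\<integral>\<^sup>+ x. H k x \<partial>\<nu>) = ennreal (budget k)"
  unfolding budget_def
  using nn_integral_le_r0[of "H k" "14 * \<eta>"] H_le \<eta>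
  by (intro ennreal_enn2real_le[symmetric, of _ "14 * \<eta> * r0"]) auto

lemma budget_nonneg: "0 \<le> budget k" by (simp add: budget_def)

text \<open>Summing the recursion \<open>rec\<close> over the levels leaves a third of the sum on
  the left, up to the boundary term at \<open>n\<close>:
  \<open>3 * 14 + 2 * 14 = 70\<close>.\<close>

lemma sum_budget_le: "(\<Sum>k<n. budget k) \<le> 70 * \<eta> * r0"
proof -
  define ia where "ia k = enn2real (\<integral>\<^sup>+ x. A k x \<partial>\<nu>)" for k
  have iA: "(\<integral>\<^sup>+ x. A k x \<partial>\<nu>) = ennreal (ia k)" for k
  proof -
    have "(\<integral>\<^sup>+ x. A k x \<partial>\<nu>) \<le> ennreal (14 * \<eta> * r0)"
      by (rule nn_integral_le_r0[OF order_trans[OF A_le_H H_le]]) (use \<eta> in simp_all)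
    from ennreal_enn2real_le[OF this] show ?thesis unfolding ia_def ..
  qed
  have rec: "budget k = ia k + 2/3 * budget (Suc k)" for k
  proof -
    have "(\<integral>\<^sup>+ x. H k x \<partial>\<nu>) = (\<integral>\<^sup>+ x. A k x + ennreal (2/3) * H (Suc k) x \<partial>\<nu>)" by (simp add: H_eq[of k])
    also have "\<dots> = (\<integral>\<^sup>+ x. A k x \<partial>\<nu>) + ennreal (2/3) * (\<integral>\<^sup>+ x. H (Suc k) x \<partial>\<nu>)"
      using A_measurable H_measurable by (subst nn_integral_add) (auto simp: nn_integral_cmult)
    finally have "ennreal (budget k) = ennreal (ia k + 2/3 * budget (Suc k))"
      unfolding int_H iA by (simp add: ennreal_mult[symmetric] ennreal_plus[symmetric] budget_nonneg ia_def del: ennreal_plus)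
    then show ?thesis by (subst (asm) ennreal_inj) (auto simp: budget_nonneg ia_def)
  qed
  have "ennreal (\<Sum>k<n. ia k) = (\<Sum>k<n. \<integral>\<^sup>+ x. A k x \<partial>\<nu>)"
    unfolding iA by (rule sum_ennreal[symmetric]) (simp add: ia_def)
  also have "\<dots> = (\<integral>\<^sup>+ x. (\<Sum>k<n. A k x) \<partial>\<nu>)" using A_measurable by (simp add: nn_integral_sum)
  also have "\<dots> \<le> ennreal (14 * \<eta> * r0)"
  proof (rule nn_integral_le_r0)
    fix x assume "x \<in> S"
    have "(\<Sum>k<n. A k x) \<le> (\<Sum>k. A k x)" by (intro sum_le_suminf) auto
    then show "(\<Sum>k<n. A k x) \<le> ennreal (14 * \<eta>)" using sum_A_le[OF \<open>x \<in> S\<close>] by (rule order_trans)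
  qed (use \<eta> in simp)
  finally have ia: "(\<Sum>k<n. ia k) \<le> 14 * \<eta> * r0" using \<eta> r0 by (simp add: ennreal_le_iff)
  have "(\<integral>\<^sup>+ x. H n x \<partial>\<nu>) \<le> ennreal (14 * \<eta> * r0)"
    by (rule nn_integral_le_r0[OF H_le]) (use \<eta> in simp_all)
  then have bn: "budget n \<le> 14 * \<eta> * r0" "0 \<le> budget 0"
    using \<eta> r0 unfolding int_H by (simp_all add: budget_nonneg ennreal_le_iff)
  have "(\<Sum>k<n. budget (Suc k)) = (\<Sum>k<n. budget k) + budget n - budget 0"
    by (induction n) auto
  moreover have "(\<Sum>k<n. budget k) = (\<Sum>k<n. ia k + 2/3 * budget (Suc k))"
    by (intro sum.cong rec refl)
  moreover have "\<dots> = (\<Sum>k<n. ia k) + 2/3 * (\<Sum>k<n. budget (Suc k))"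
    by (simp only: sum.distrib sum_distrib_left)
  ultimately show ?thesis using ia bn by linarith
qed

section \<open>Selecting a point by Markov's inequality\<close>

definition mball :: "'a \<Rightarrow> real \<Rightarrow> real" where "mball v s = measure \<nu> (cball v s)"

lemma cball_sets: "cball v s \<in> sets \<nu>" by (simp add: sets_nu)

lemma mball_mono: "cball v s \<subseteq> cball w t \<Longrightarrow> mball v s \<le> mball w t"
  unfolding mball_def by (intro finite_measure_mono cball_sets)

text \<open>\<open>select_point\<close> imposes \<open>5 * 5 + 5 * 12 + 1 = 86\<close> Markov bounds at once.\<close>

definition N :: real where "N = 87"

lemma select_point:
  assumes v: "\<delta> * alpha * r k \<le> mball v (alpha * r k)" and Nb: "finite Nb" "card Nb \<le> 5"
  obtains w where "w \<in> S" "dist v w \<le> alpha * r k"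
    "\<And>x y. x \<in> Nb \<Longrightarrow> y \<in> Nb \<Longrightarrow> ennreal (\<delta> * alpha * r k) * c k x y w \<le> ennreal N * B k x y"
    "\<And>x j. x \<in> Nb \<Longrightarrow> k \<le> j \<Longrightarrow> j \<le> k + 11 \<Longrightarrow> ennreal (\<delta> * alpha * r k) * B j x w \<le> ennreal N * A j x"
    "\<delta> * alpha * e k w \<le> N * enn2real (\<integral>\<^sup>+ x\<in>cball v (alpha * r k). H k x \<partial>\<nu>)"
proof -
  define X where "X = cball v (alpha * r k)"
  \<comment> \<open>\<open>c k x y\<close> gives flatness with pairs of neighbours,
    \<open>B j x\<close> the control of the new pairs at this scale and eleven finer ones, and
    \<open>H k\<close> the total charge of the new point.\<close>
  define F where "F = (\<lambda>(x, y). c k x y) ` (Nb \<times> Nb) \<union> (\<lambda>(x, j). B j x) ` (Nb \<times> {k..k+11}) \<union> {H k}"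
  have fin: "finite F" using Nb(1) by (simp add: F_def)
  have "card F \<le> card ((\<lambda>(x, y). c k x y) ` (Nb \<times> Nb)) + card ((\<lambda>(x, j). B j x) ` (Nb \<times> {k..k+11})) + card {H k}"
    unfolding F_def by (meson add_le_mono card_Un_le le_refl order_trans)
  also have "\<dots> \<le> card (Nb \<times> Nb) + card (Nb \<times> {k..k+11}) + 1"
    using Nb(1) by (intro add_mono card_image_le) auto
  also have "\<dots> \<le> 5 * 5 + 5 * 12 + 1"
    unfolding card_cartesian_product using Nb(2) by (intro add_mono mult_mono) auto
  finally have card: "real (card F + 1) \<le> N" by (simp add: N_def)
  have pos: "0 < \<delta> * alpha * r k" using \<delta> r_pos[of k] by (simp add: alpha_def)
  have mX: "ennreal (\<delta> * alpha * r k) \<le> emeasure \<nu> X"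
    using v pos by (simp add: X_def mball_def emeasure_eq_measure)
  have "f \<in> borel_measurable \<nu>" if "f \<in> F" for f
    using that c_measurable B_measurable H_measurable by (auto simp: F_def)
  then obtain w where w: "w \<in> X" "w \<in> S"
    and *: "\<And>f. f \<in> F \<Longrightarrow> f w * emeasure \<nu> X \<le> of_nat (card F + 1) * (\<integral>\<^sup>+ x\<in>X. f x \<partial>\<nu>)"
    using exists_Markov_point[of F \<nu> X "- S"] fin Compl_null mX pos cball_sets[of v "alpha * r k"]
    by (auto simp: X_def emeasure_eq_measure)
  have **: "ennreal (\<delta> * alpha * r k) * f w \<le> ennreal N * (\<integral>\<^sup>+ x\<in>X. f x \<partial>\<nu>)" if "f \<in> F" for f
  proof -
    have "ennreal (\<delta> * alpha * r k) * f w \<le> f w * emeasure \<nu> X"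
      using mX by (subst mult.commute) (intro mult_left_mono, auto)
    also have "\<dots> \<le> of_nat (card F + 1) * (\<integral>\<^sup>+ x\<in>X. f x \<partial>\<nu>)" by (rule *[OF that])
    also have "\<dots> \<le> ennreal N * (\<integral>\<^sup>+ x\<in>X. f x \<partial>\<nu>)"
      using card by (intro mult_right_mono) (auto simp: ennreal_of_nat_eq_real_of_nat simp del: of_nat_Suc of_nat_add)
    finally show ?thesis .
  qed
  have part: "(\<integral>\<^sup>+ x\<in>X. f x \<partial>\<nu>) \<le> (\<integral>\<^sup>+ x. f x \<partial>\<nu>)" for f :: "'a \<Rightarrow> ennreal"
    by (intro nn_integral_mono) (auto simp: indicator_def)
  show thesis
  proof (rule that[of w])
    show "w \<in> S" "dist v w \<le> alpha * r k" using w by (auto simp: X_def)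
    show "ennreal (\<delta> * alpha * r k) * c k x y w \<le> ennreal N * B k x y" if "x \<in> Nb" "y \<in> Nb" for x y
    proof -
      have "c k x y \<in> F" using that by (auto simp: F_def)
      then show ?thesis using **[of "c k x y"] part[of "c k x y"] unfolding kernel2_def
        by (meson mult_left_mono order_trans zero_le)
    qed
    show "ennreal (\<delta> * alpha * r k) * B j x w \<le> ennreal N * A j x" if "x \<in> Nb" "k \<le> j" "j \<le> k + 11" for x j
    proof -
      have "B j x \<in> F" using that by (auto simp: F_def)
      then show ?thesis using **[of "B j x"] part[of "B j x"] unfolding kernel1_def
        by (meson mult_left_mono order_trans zero_le)
    qed
    have HX: "(\<integral>\<^sup>+ x\<in>X. H k x \<partial>\<nu>) < top"
      using part[of "H k"] unfolding int_H by (rule le_less_trans[OF _ ennreal_less_top])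
    have "ennreal (\<delta> * alpha * e k w) = ennreal (\<delta> * alpha * r k) * H k w"
      unfolding H_ennreal[OF w(2)] using pos r_pos[of k] e_nonneg[of k w] by (subst ennreal_mult[symmetric]) (auto simp: mult.assoc)
    also have "\<dots> \<le> ennreal N * (\<integral>\<^sup>+ x\<in>X. H k x \<partial>\<nu>)" by (intro **) (simp add: F_def)
    also have "\<dots> = ennreal (N * enn2real (\<integral>\<^sup>+ x\<in>X. H k x \<partial>\<nu>))"
      using HX by (simp add: ennreal_mult N_def)
    finally show "\<delta> * alpha * e k w \<le> N * enn2real (\<integral>\<^sup>+ x\<in>cball v (alpha * r k). H k x \<partial>\<nu>)"
      by (simp add: X_def N_def ennreal_le_iff)
  qed
qed

end

section \<open>Inserting a point into a chain\<close>

definition eps :: real where "eps = 1 / 100000"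

context flat_measure
begin

text \<open>Each selection loses a factor \<open>C2\<close>. Flatness of a triple with a new point
  rests on two selections, that of the pair and that of the point; the cube in \<open>C3\<close>
  comes from the upper end of \<open>I k\<close>.\<close>

definition C2 :: real where "C2 = N / (\<delta> * alpha)"
definition C3 :: real where "C3 = 180 ^ 3 * C2\<^sup>2"

text \<open>Controlled pairs: their curvature at all finer scales is bounded by that of the two points.  The bound
  outlives the scale at which a pair is created, so that pairs of old points remain usable.\<close>

definition ctrl :: "nat \<Rightarrow> 'a \<Rightarrow> 'a \<Rightarrow> bool" where
  "ctrl k x y \<longleftrightarrow> (\<forall>j\<ge>k. dist x y \<le> 90 * r j \<longrightarrow>
     ennreal (r j) * B j x y \<le> ennreal C2 * (A j x + A j y))"

definition edge :: "nat \<Rightarrow> 'a \<Rightarrow> 'a \<Rightarrow> bool" where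
  "edge k x y \<longleftrightarrow> dist x y \<le> 45 * r k \<and> ctrl k x y"

text \<open>The detour is measured against the distance, not the scale, so that bends survive the
  passage to finer scales. Control of the outer pair is needed when a point is inserted near the
  middle one.\<close>

definition bend :: "nat \<Rightarrow> 'a \<Rightarrow> 'a \<Rightarrow> 'a \<Rightarrow> bool" where
  "bend k x y z \<longleftrightarrow> detour x y z \<le> 2 * eps * dist x z \<and> ctrl k x z"

definition seg_ok :: "nat \<Rightarrow> 'a list \<Rightarrow> bool" where
  "seg_ok k xs \<longleftrightarrow> xs \<noteq> [] \<and> successively (edge k) xs \<and> chain3 (bend k) xs"

text \<open>The factor below 1 absorbs the displacement by up to \<open>alpha * r k\<close> when a
  new point is selected.\<close>

definition spread :: "nat \<Rightarrow> 'a set \<Rightarrow> bool" where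
  "spread k F \<longleftrightarrow> (\<forall>x\<in>F. \<forall>y\<in>F. x \<noteq> y \<longrightarrow> 98/100 * r k \<le> dist x y)"

lemma C2_pos: "0 < C2" using \<delta> by (simp add: C2_def N_def alpha_def)

lemma C3_pos: "0 < C3" using C2_pos by (simp add: C3_def)

lemma ctrl_commute: "ctrl k x y \<longleftrightarrow> ctrl k y x"
  unfolding ctrl_def kernel2_commute[of _ _ x y] by (simp add: dist_commute add.commute)

lemma ctrl_mono: "ctrl k x y \<Longrightarrow> k \<le> j \<Longrightarrow> ctrl j x y"
  unfolding ctrl_def by auto

lemma detour_commute: "detour x y z = detour z y x"
  by (simp add: detour_def dist_commute)

text \<open>The selection bounds the kernel by \<open>B k x y\<close> and control bounds that by the
  curvature of the end points, which together give \<open>C2\<^sup>2 / (r k)\<^sup>2\<close>,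
  written between backticks as \<open>C2\<^sup>2 * (a k x + a k y) / (r k)\<^sup>2\<close>. A
  diameter below \<open>180 * r k\<close> turns this into an excess.\<close>

lemma excess_le_if_ctrl:
  assumes xy: "x \<in> S" "y \<in> S" "ctrl k x y" "dist x y \<le> 90 * r k" and D: "diam3 x y w \<in> I k"
    and sel: "ennreal (\<delta> * alpha * r k) * c k x y w \<le> ennreal N * B k x y"
  shows "excess x y w \<le> C3 * r k * (a k x + a k y)"
proof -
  define d where "d = diam3 x y w"
  define g where "g = excess x y w / d ^ 3"
  have d: "0 < d" "d < 180 * r k" using D r_pos[of k] by (auto simp: I_def d_def)
  have g: "0 \<le> g" using d excess_nonneg[of x y w] by (simp add: g_def)
  have c: "c k x y w = ennreal g" using D by (simp add: kernel_def g_def d_def)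
  have rp: "0 < r k" and al: "0 < alpha" by (auto simp: r_pos alpha_def)
  have "ennreal (r k * (\<delta> * alpha * r k) * g) = ennreal (r k) * (ennreal (\<delta> * alpha * r k) * c k x y w)"
    using rp al \<delta> g unfolding c by (simp add: ennreal_mult mult.assoc)
  also have "\<dots> \<le> ennreal (r k) * (ennreal N * B k x y)" by (intro mult_left_mono sel) simp
  also have "\<dots> = ennreal N * (ennreal (r k) * B k x y)" by (simp add: ac_simps)
  also have "\<dots> \<le> ennreal N * (ennreal C2 * (A k x + A k y))"
    using xy(3,4) unfolding ctrl_def by (intro mult_left_mono) auto
  also have "\<dots> = ennreal (N * (C2 * (a k x + a k y)))"
    unfolding A_eq[OF xy(1)] A_eq[OF xy(2)] using C2_pos a_nonneg
    by (simp add: ennreal_mult ennreal_plus[symmetric] N_def del: ennreal_plus)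
  finally have "r k * (\<delta> * alpha * r k) * g \<le> N * (C2 * (a k x + a k y))"
    using C2_pos a_nonneg[of k x] a_nonneg[of k y] by (subst (asm) ennreal_le_iff) (auto simp: N_def)
  then have "g * (r k)\<^sup>2 \<le> N * (C2 * (a k x + a k y)) / (\<delta> * alpha)"
    using \<delta> al by (subst pos_le_divide_eq) (auto simp: power2_eq_square ac_simps)
  also have "\<dots> = C2\<^sup>2 * (a k x + a k y)" by (simp add: C2_def power2_eq_square)
  finally have g2: "g * (r k)\<^sup>2 \<le> C2\<^sup>2 * (a k x + a k y)" .
  have "excess x y w = g * d ^ 3" using d by (simp add: g_def)
  also have "\<dots> \<le> g * (180 * r k) ^ 3" using d g by (intro mult_left_mono power_mono) auto
  also have "\<dots> = 180 ^ 3 * r k * (g * (r k)\<^sup>2)" by (simp add: power2_eq_square power3_eq_cube)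
  also have "\<dots> \<le> 180 ^ 3 * r k * (C2\<^sup>2 * (a k x + a k y))" using rp by (intro mult_left_mono g2) simp
  also have "\<dots> = C3 * r k * (a k x + a k y)" by (simp add: C3_def ac_simps)
  finally show ?thesis .
qed

text \<open>Twelve scales suffice: the pair is at distance at least \<open>98/100 * r k\<close>,
  which exceeds \<open>90 * r j\<close> once \<open>j \<ge> k + 12\<close>.\<close>

lemma ctrl_if_selected:
  assumes sel: "\<And>j. k \<le> j \<Longrightarrow> j \<le> k + 11 \<Longrightarrow> ennreal (\<delta> * alpha * r k) * B j x w \<le> ennreal N * A j x"
    and d: "98/100 * r k \<le> dist x w"
  shows "ctrl k x w"
  unfolding ctrl_def
proof (intro allI impI)
  fix j assume j: "k \<le> j" and dj: "dist x w \<le> 90 * r j"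
  have "j \<le> k + 11"
  proof (rule ccontr)
    assume "\<not> j \<le> k + 11"
    then have "r j \<le> r (k + 12)" by (intro r_antimono) simp
    also have "\<dots> = r k * (2/3) ^ 12" by (rule r_add)
    finally have "98/100 * r k \<le> 90 * (r k * (2/3) ^ 12)" using d dj by linarith
    then show False using r_pos[of k] by (simp add: power_numeral_reduce)
  qed
  have pos: "0 < \<delta> * alpha" using \<delta> by (simp add: alpha_def)
  have "ennreal (r j) \<le> ennreal (r k)" using r_antimono[OF j] by (rule ennreal_leI)
  then have "ennreal (\<delta> * alpha) * (ennreal (r j) * B j x w) \<le> ennreal (\<delta> * alpha) * (ennreal (r k) * B j x w)"
    by (intro mult_left_mono mult_right_mono) auto
  also have "ennreal (\<delta> * alpha) * (ennreal (r k) * B j x w) = ennreal (\<delta> * alpha * r k) * B j x w"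
    unfolding mult.assoc[symmetric] using pos r_pos[of k] by (subst ennreal_mult[symmetric]) auto
  also have "\<dots> \<le> ennreal N * A j x" by (rule sel[OF j \<open>j \<le> k + 11\<close>])
  finally have *: "ennreal (\<delta> * alpha) * (ennreal (r j) * B j x w) \<le> ennreal N * A j x" .
  have inv: "ennreal (1 / (\<delta> * alpha)) * ennreal (\<delta> * alpha) = 1"
    using pos by (subst ennreal_mult[symmetric]) auto
  have "ennreal (r j) * B j x w = ennreal (1 / (\<delta> * alpha)) * (ennreal (\<delta> * alpha) * (ennreal (r j) * B j x w))"
    unfolding mult.assoc[symmetric] inv by simp
  also have "\<dots> \<le> ennreal (1 / (\<delta> * alpha)) * (ennreal N * A j x)" by (intro mult_left_mono *) simp
  also have "\<dots> = (ennreal (1 / (\<delta> * alpha)) * ennreal N) * A j x" by (simp only: mult.assoc)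
  also have "ennreal (1 / (\<delta> * alpha)) * ennreal N = ennreal C2"
  proof -
    have "ennreal (1 / (\<delta> * alpha)) * ennreal N = ennreal (1 / (\<delta> * alpha) * N)"
      using pos by (intro ennreal_mult[symmetric]) (simp_all add: N_def)
    then show ?thesis by (simp add: C2_def)
  qed
  also have "ennreal C2 * A j x \<le> ennreal C2 * (A j x + A j w)" by (intro mult_left_mono) auto
  finally show "ennreal (r j) * B j x w \<le> ennreal C2 * (A j x + A j w)" .
qed

text \<open>Any two of the three detours add up to twice a distance. If one is known to be
  moderately small, the other two are too large to realize the excess.\<close>

lemma detour_le_if_excess_le:
  assumes "excess x y z \<le> t" "detour x y z \<le> 1/2 * s" "s \<le> dist x y" "s \<le> dist y z" "t \<le> 1/2 * s" "0 < s"
  shows "detour x y z \<le> t"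
proof -
  have "detour x y z + detour x z y = 2 * dist y z" "detour x y z + detour y x z = 2 * dist x y"
    by (simp_all add: detour_def dist_commute)
  then have "\<not> detour x z y \<le> t" "\<not> detour y x z \<le> t" using assms by linarith+
  then show ?thesis using assms(1) unfolding excess_le_iff by blast
qed

lemma eps_r: "eps * r k = r k / 100000"
  by (simp add: eps_def)

lemma bendI:
  assumes "excess x y z \<le> eps * r k" "detour x y z \<le> 1/4 * r k" "98/100 * r k \<le> dist x y" "98/100 * r k \<le> dist y z"
    "98/100 * r k \<le> dist x z" "ctrl k x z"
  shows "bend k x y z"
proof -
  have rp: "0 < r k" by (rule r_pos)
  have "detour x y z \<le> eps * r k"
  proof (rule detour_le_if_excess_le[OF assms(1) _ assms(3,4)])
    show "detour x y z \<le> 1/2 * (98/100 * r k)" "eps * r k \<le> 1/2 * (98/100 * r k)" "0 < 98/100 * r k"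
      using assms(2) rp unfolding eps_r by linarith+
  qed
  also have "eps * r k \<le> 2 * eps * dist x z" using assms(5) rp unfolding eps_def by linarith
  finally show ?thesis using assms(6) by (simp add: bend_def)
qed

text \<open>Three bends are new. The one at \<open>w\<close> is \<open>mid\<close>. At
  \<open>f\<close> and \<open>y\<close> the excess is small by assumption, and the old bend together
  with the additivity of detours singles out the right order.\<close>

lemma seg_insert:
  assumes ok: "seg_ok k (us @ f # y # vs)" and spr: "spread k (insert w (set (us @ f # y # vs)))"
    and dst: "distinct (us @ f # y # vs)" "w \<notin> set (us @ f # y # vs)"
    and mid: "detour f w y \<le> eps * r k"
    and lft: "us \<noteq> [] \<Longrightarrow> excess (last us) f w \<le> eps * r k" "us \<noteq> [] \<Longrightarrow> ctrl k (last us) w"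
    and rgt: "vs \<noteq> [] \<Longrightarrow> excess y (hd vs) w \<le> eps * r k" "vs \<noteq> [] \<Longrightarrow> ctrl k (hd vs) w"
    and ct: "ctrl k f w" "ctrl k y w"
  shows "seg_ok k (us @ f # w # y # vs)"
proof -
  have rp: "0 < r k" by (rule r_pos)
  have sp: "98/100 * r k \<le> dist x z" if "x \<in> insert w (set (us @ f # y # vs))" "z \<in> insert w (set (us @ f # y # vs))" "x \<noteq> z" for x z
    using spr that unfolding spread_def by blast
  have fy: "edge k f y" using ok by (auto simp: seg_ok_def successively_append_iff)
  have fw: "98/100 * r k \<le> dist f w" and wy: "98/100 * r k \<le> dist w y" and fyd: "98/100 * r k \<le> dist f y"
    using sp dst by auto
  have e: "edge k f w" "edge k w y"
    using mid fw wy rp fy ct unfolding edge_def detour_def eps_def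
    by (auto simp: ctrl_commute[of k w] dist_commute)
  have bm: "bend k f w y"
    using mid fyd rp fy by (auto simp: bend_def edge_def eps_def)
  have bl: "bend k (last us) f w" if us: "us \<noteq> []"
  proof -
    let ?l = "last us"
    have l: "?l \<in> set us" using us by simp
    have eq: "us @ f # y # vs = butlast us @ ?l # f # y # vs" using us by simp
    have "chain3 (bend k) (butlast us @ ?l # f # y # vs)" using ok unfolding seg_ok_def eq by blast
    then have "chain3 (bend k) (?l # f # y # vs)" by (rule chain3_appendD[THEN conjunct2])
    then have b: "detour ?l f y \<le> 2 * eps * dist ?l y" by (simp add: bend_def)
    have "dist ?l f \<le> 45 * r k" "dist f y \<le> 45 * r k"
      using ok us by (auto simp: seg_ok_def successively_append_iff edge_def)
    then have "dist ?l y \<le> 90 * r k" using dist_triangle[of ?l y f] by linarith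
    then have "detour ?l f y \<le> 1/100 * r k" using b rp by (simp add: eps_def)
    moreover have "detour ?l f w \<le> detour ?l f y + detour f w y"
      using dist_triangle[of ?l y w] by (simp add: detour_def)
    ultimately have "detour ?l f w \<le> 1/4 * r k" using mid rp by (simp add: eps_def)
    then show ?thesis
      using l dst by (intro bendI lft[OF us] sp) (auto simp: dist_commute)
  qed
  have br: "bend k w y (hd vs)" if vs: "vs \<noteq> []"
  proof -
    let ?l = "hd vs"
    have l: "?l \<in> set vs" using vs by simp
    have eq: "us @ f # y # vs = us @ (f # y # ?l # tl vs)" using vs by simp
    have "chain3 (bend k) (us @ (f # y # ?l # tl vs))" using ok unfolding seg_ok_def eq by blast
    then have "chain3 (bend k) (f # y # ?l # tl vs)" by (rule chain3_appendD[THEN conjunct2])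
    then have b: "detour f y ?l \<le> 2 * eps * dist f ?l" by (simp add: bend_def)
    have "dist y ?l \<le> 45 * r k" "dist f y \<le> 45 * r k"
      using ok vs by (auto simp: seg_ok_def successively_append_iff successively_Cons edge_def)
    then have "dist f ?l \<le> 90 * r k" using dist_triangle[of f ?l y] by linarith
    then have "detour f y ?l \<le> 1/100 * r k" using b rp by (simp add: eps_def)
    moreover have "detour w y ?l \<le> detour f y ?l + detour f w y"
      using dist_triangle[of f ?l w] by (simp add: detour_def)
    ultimately have "detour w y ?l \<le> 1/4 * r k" using mid rp by (simp add: eps_def)
    moreover have "excess w y ?l = excess y ?l w" by (metis excess_commute)
    moreover have "ctrl k w ?l" using rgt(2)[OF vs] by (simp add: ctrl_commute)
    ultimately show ?thesis
      using l dst rgt(1)[OF vs] by (intro bendI sp) auto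
  qed
  have s: "successively (edge k) (us @ f # w # y # vs)"
    using ok e by (auto simp: seg_ok_def successively_append_iff successively_Cons)
  have "chain3 (bend k) (us @ [f])"
    using ok chain3_appendD[of "bend k" "us @ [f]" "y # vs"] by (simp add: seg_ok_def)
  then have c1: "chain3 (bend k) (us @ [f, w])"
  proof (cases us rule: rev_cases)
    case (snoc us' l)
    then show ?thesis using \<open>chain3 (bend k) (us @ [f])\<close> bl by (simp add: chain3_snoc)
  qed simp
  have "chain3 (bend k) (y # vs)"
    using ok chain3_appendD[of "bend k" "us @ [f]" "y # vs"] by (simp add: seg_ok_def)
  then have "chain3 (bend k) (f # w # y # vs)" using bm br by (cases vs) auto
  then have "chain3 (bend k) (us @ f # w # y # vs)" using c1 chain3_append2[of "bend k" us f w "y # vs"] by simp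
  then show ?thesis using s by (simp add: seg_ok_def)
qed

lemma seg_snoc:
  assumes "seg_ok k (us @ [f])" and e: "edge k f w" and "us \<noteq> [] \<Longrightarrow> bend k (last us) f w"
  shows "seg_ok k (us @ [f, w])"
proof (cases us rule: rev_cases)
  case (snoc us' l)
  then show ?thesis using assms by (auto simp: seg_ok_def successively_append_iff chain3_snoc)
qed (use e in \<open>simp add: seg_ok_def\<close>)

lemma seg_Cons:
  assumes "seg_ok k (f # vs)" "edge k w f" and "vs \<noteq> [] \<Longrightarrow> bend k w f (hd vs)"
  shows "seg_ok k (w # f # vs)"
  using assms by (cases vs) (auto simp: seg_ok_def successively_Cons)

text \<open>Inserting between \<open>f\<close> and a neighbour changes the bends at both, so points
  up to two steps from \<open>f\<close> are involved: at most five, the number allowed in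
  \<open>select_point\<close>.\<close>

definition nbs :: "'a list \<Rightarrow> 'a \<Rightarrow> 'a list \<Rightarrow> 'a set" where
  "nbs us f vs = set (take 2 (rev us)) \<union> {f} \<union> set (take 2 vs)"

lemma nbs_self: "f \<in> nbs us f vs"
  by (simp add: nbs_def)

lemma nbs_left: "l \<in> nbs (us @ [l]) f vs" "m \<in> nbs (us @ [m, l]) f vs"
  by (simp_all add: nbs_def)

lemma nbs_right: "l \<in> nbs us f (l # vs)" "m \<in> nbs us f (l # m # vs)"
  by (simp_all add: nbs_def)

lemma nbs_last: "us \<noteq> [] \<Longrightarrow> last us \<in> nbs us f vs"
  using nbs_left(1) by (metis append_butlast_last_id)

lemma nbs_hd: "vs \<noteq> [] \<Longrightarrow> hd vs \<in> nbs us f vs"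
  using nbs_right(1) by (metis list.collapse)

lemma nbs_last2:
  assumes "us \<noteq> []" shows "last us \<in> nbs (us @ [l]) f vs"
proof -
  have "us @ [l] = butlast us @ [last us, l]" using assms by (cases us rule: rev_cases) simp_all
  then show ?thesis using nbs_left(2) by (simp only:)
qed

lemma nbs_hd2:
  assumes "vs \<noteq> []" shows "hd vs \<in> nbs us f (l # vs)"
proof -
  have "l # vs = l # hd vs # tl vs" using assms by simp
  then show ?thesis using nbs_right(2) by (simp only:)
qed

text \<open>In the flat triple of \<open>f\<close>, \<open>w\<close> and a neighbour of
  \<open>f\<close>, either \<open>w\<close> is in the middle and is inserted there, or
  \<open>f\<close> is. The latter cannot happen on both sides of an interior \<open>f\<close>; if
  \<open>f\<close> is an end of the segment, \<open>w\<close> is attached beyond it.\<close>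

lemma place_point:
  assumes ok: "seg_ok k (us @ f # vs)" and spr: "spread k (insert w (set (us @ f # vs)))"
    and dst: "distinct (us @ f # vs)" "w \<notin> set (us @ f # vs)"
    and fw: "dist f w \<le> 152/100 * r k"
    and exc: "\<And>p q. p \<in> nbs us f vs \<Longrightarrow> q \<in> nbs us f vs \<Longrightarrow> p \<noteq> q \<Longrightarrow> ctrl k p q \<Longrightarrow> dist p q \<le> 90 * r k \<Longrightarrow>
       excess p q w \<le> C3 * r k * (a k p + a k q) \<and> C3 * r k * (a k p + a k q) \<le> eps * r k"
    and ct: "\<And>p. p \<in> nbs us f vs \<Longrightarrow> ctrl k p w"
  shows "\<exists>us' vs'. us @ f # vs = us' @ vs' \<and> seg_ok k (us' @ w # vs') \<and>
     ((us' \<noteq> [] \<and> vs' \<noteq> [] \<and> detour (last us') w (hd vs') \<le> C3 * r k * (a k (last us') + a k (hd vs'))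
         \<and> C3 * r k * (a k (last us') + a k (hd vs')) \<le> eps * r k) \<or>
      (us' \<noteq> [] \<and> vs' = [] \<and> last us' = f) \<or> (us' = [] \<and> vs' \<noteq> [] \<and> hd vs' = f))"
    (is "\<exists>us' vs'. ?P us' vs'")
proof -
  have rp: "0 < r k" by (rule r_pos)
  note ep = eps_r[of k]
  have sp: "98/100 * r k \<le> dist x z" if "x \<in> insert w (set (us @ f # vs))" "z \<in> insert w (set (us @ f # vs))" "x \<noteq> z" for x z
    using spr that unfolding spread_def by blast
  have fw': "98/100 * r k \<le> dist f w" using sp dst by auto
  have exs: "excess p q w \<le> eps * r k"
    if "p \<in> nbs us f vs" "q \<in> nbs us f vs" "p \<noteq> q" "edge k p q" for p q
  proof -
    have "dist p q \<le> 90 * r k" "ctrl k p q" using that(4) rp by (auto simp: edge_def)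
    then show ?thesis using exc[OF that(1-3)] by linarith
  qed
  have ins_right: "?P (us @ [f]) (y # vs')"
    if vs: "vs = y # vs'" and d: "detour f w y \<le> C3 * r k * (a k f + a k y)" for y vs'
  proof -
    have fy: "edge k f y" "f \<noteq> y" using ok dst vs by (auto simp: seg_ok_def successively_append_iff)
    have yn: "y \<in> nbs us f vs" "f \<in> nbs us f vs" using nbs_self nbs_right vs by auto
    have ex: "C3 * r k * (a k f + a k y) \<le> eps * r k"
      using exc[OF yn(2,1) fy(2)] fy(1) rp by (auto simp: edge_def)
    have "seg_ok k (us @ f # w # y # vs')"
    proof (rule seg_insert)
      show "seg_ok k (us @ f # y # vs')" "spread k (insert w (set (us @ f # y # vs')))"
        "distinct (us @ f # y # vs')" "w \<notin> set (us @ f # y # vs')" using ok spr dst vs by auto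
      show "detour f w y \<le> eps * r k" using d ex by linarith
      show "ctrl k f w" "ctrl k y w" using ct yn by auto
    next
      assume us: "us \<noteq> []"
      have "edge k (last us) f" using ok us by (auto simp: seg_ok_def successively_append_iff)
      moreover have "last us \<noteq> f" using dst us by (auto dest: last_in_set)
      ultimately show "excess (last us) f w \<le> eps * r k"
        using exs[OF nbs_last[OF us] yn(2)] by blast
      show "ctrl k (last us) w" using ct nbs_last[OF us] by blast
    next
      assume v: "vs' \<noteq> []"
      have hn: "hd vs' \<in> nbs us f vs" using nbs_hd2[OF v] vs by simp
      have "edge k y (hd vs')" using ok vs v by (auto simp: seg_ok_def successively_append_iff successively_Cons)
      moreover have "y \<noteq> hd vs'" using dst vs v by (auto dest: hd_in_set)
      ultimately show "excess y (hd vs') w \<le> eps * r k"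
        using exs[OF yn(1) hn] by blast
      show "ctrl k (hd vs') w" using ct hn by blast
    qed
    then show ?thesis using vs d ex by simp
  qed
  have ins_left: "?P (us' @ [l]) (f # vs)"
    if us: "us = us' @ [l]" and d: "detour l w f \<le> C3 * r k * (a k l + a k f)" for l us'
  proof -
    have fl: "edge k l f" "l \<noteq> f" using ok dst us by (auto simp: seg_ok_def successively_append_iff)
    have ln: "l \<in> nbs us f vs" "f \<in> nbs us f vs" using nbs_self nbs_left us by auto
    have ex: "C3 * r k * (a k l + a k f) \<le> eps * r k"
      using exc[OF ln fl(2)] fl(1) rp by (auto simp: edge_def)
    have "seg_ok k (us' @ l # w # f # vs)"
    proof (rule seg_insert)
      show "seg_ok k (us' @ l # f # vs)" "spread k (insert w (set (us' @ l # f # vs)))"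
        "distinct (us' @ l # f # vs)" "w \<notin> set (us' @ l # f # vs)" using ok spr dst us by auto
      show "detour l w f \<le> eps * r k" using d ex by linarith
      show "ctrl k l w" "ctrl k f w" using ct ln by auto
    next
      assume u: "us' \<noteq> []"
      have hn: "last us' \<in> nbs us f vs" using nbs_last2[OF u] us by simp
      have "edge k (last us') l" using ok us u by (auto simp: seg_ok_def successively_append_iff)
      moreover have "last us' \<noteq> l" using dst us u by (auto dest: last_in_set)
      ultimately show "excess (last us') l w \<le> eps * r k"
        using exs[OF hn ln(1)] by blast
      show "ctrl k (last us') w" using ct hn by blast
    next
      assume v: "vs \<noteq> []"
      have hn: "hd vs \<in> nbs us f vs" using nbs_hd[OF v] .
      have "edge k f (hd vs)" using ok v by (auto simp: seg_ok_def successively_append_iff successively_Cons)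
      moreover have "f \<noteq> hd vs" using dst v by (auto dest: hd_in_set)
      ultimately show "excess f (hd vs) w \<le> eps * r k"
        using exs[OF ln(2) hn] by blast
      show "ctrl k (hd vs) w" using ct hn by blast
    qed
    then show ?thesis using us d ex by simp
  qed
  have efw: "edge k f w" using fw rp ct[OF nbs_self] by (simp add: edge_def)
  have left: "detour l w f \<le> C3 * r k * (a k l + a k f) \<or> (detour l f w \<le> eps * r k \<and> bend k l f w)"
    if us: "us = us' @ [l]" for l us'
  proof -
    have fl: "edge k l f" "l \<noteq> f" using ok dst us by (auto simp: seg_ok_def successively_append_iff)
    have ln: "l \<in> nbs us f vs" "f \<in> nbs us f vs" using nbs_self nbs_left us by auto
    have ex: "excess l f w \<le> C3 * r k * (a k l + a k f)" "C3 * r k * (a k l + a k f) \<le> eps * r k"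
      using exc[OF ln fl(2)] fl(1) rp by (auto simp: edge_def)
    have dl: "98/100 * r k \<le> dist l f" "98/100 * r k \<le> dist l w" using sp[of l f] sp[of l w] dst us by auto
    \<comment> \<open>The ratio of the scales enters here: with \<open>l\<close> between
      \<open>f\<close> and \<open>w\<close>, the distance of \<open>f\<close> and \<open>w\<close>
      would be almost twice the separation.\<close>
    have "\<not> detour f l w \<le> C3 * r k * (a k l + a k f)"
    proof
      assume "detour f l w \<le> C3 * r k * (a k l + a k f)"
      moreover have "detour f l w = dist l f + dist l w - dist f w" by (simp add: detour_def dist_commute)
      ultimately show False using ex(2) dl fw rp unfolding ep by linarith
    qed
    moreover have "bend k l f w" if "detour l f w \<le> eps * r k"
    proof (rule bendI)
      show "excess l f w \<le> eps * r k" using ex by linarith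
      show "detour l f w \<le> 1/4 * r k" using that rp unfolding ep by linarith
    qed (use dl fw' ct[OF ln(1)] in auto)
    ultimately show ?thesis using ex unfolding excess_le_iff by auto
  qed
  have right: "detour f w y \<le> C3 * r k * (a k f + a k y) \<or> (detour w f y \<le> eps * r k \<and> bend k w f y)"
    if vs: "vs = y # vs'" for y vs'
  proof -
    have fl: "edge k f y" "f \<noteq> y" using ok dst vs by (auto simp: seg_ok_def successively_append_iff)
    have ln: "y \<in> nbs us f vs" "f \<in> nbs us f vs" using nbs_self nbs_right vs by auto
    have ex: "excess f y w \<le> C3 * r k * (a k f + a k y)" "C3 * r k * (a k f + a k y) \<le> eps * r k"
      using exc[OF ln(2,1) fl(2)] fl(1) rp by (auto simp: edge_def)
    have dl: "98/100 * r k \<le> dist f y" "98/100 * r k \<le> dist w y" using sp[of f y] sp[of w y] dst vs by auto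
    have "\<not> detour f y w \<le> C3 * r k * (a k f + a k y)"
    proof
      assume "detour f y w \<le> C3 * r k * (a k f + a k y)"
      moreover have "detour f y w = dist f y + dist w y - dist f w" by (simp add: detour_def dist_commute)
      ultimately show False using ex(2) dl fw rp unfolding ep by linarith
    qed
    moreover have "bend k w f y" if "detour w f y \<le> eps * r k"
    proof (rule bendI)
      show "excess w f y \<le> eps * r k" using ex by (metis excess_commute order_trans)
      show "ctrl k w y" using ct[OF ln(1)] by (simp add: ctrl_commute)
      show "detour w f y \<le> 1/4 * r k" using that rp unfolding ep by linarith
    qed (use dl fw' in \<open>auto simp: dist_commute\<close>)
    moreover have "detour y f w = detour w f y" by (rule detour_commute)
    ultimately show ?thesis using ex unfolding excess_le_iff by (auto simp: detour_commute)
  qed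
  show ?thesis
  proof (cases us rule: rev_cases)
    case Nil
    show ?thesis
    proof (cases vs)
      case vs: Nil
      have "?P [f] []" using seg_snoc[of k "[]" f w] ok efw Nil vs by simp
      then show ?thesis by blast
    next
      case (Cons y vs')
      from right[OF Cons] show ?thesis
      proof
        assume "detour w f y \<le> eps * r k \<and> bend k w f y"
        then have "?P [] (f # vs)" using seg_Cons[of k f vs w] ok efw Nil Cons
          by (simp add: edge_def dist_commute ctrl_commute)
        then show ?thesis by blast
      qed (use ins_right[OF Cons] in blast)
    qed
  next
    case us: (snoc us' l)
    show ?thesis
    proof (cases vs)
      case Nil
      from left[OF us] show ?thesis
      proof
        assume "detour l f w \<le> eps * r k \<and> bend k l f w"
        then have "?P (us @ [f]) []" using seg_snoc[of k us f w] ok efw us Nil by simp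
        then show ?thesis by blast
      qed (use ins_left[OF us] in blast)
    next
      case (Cons y vs')
      \<comment> \<open>\<open>f\<close> would be the centre of a tripod with ends \<open>l\<close>,
        \<open>y\<close>, \<open>w\<close> and legs of length at least \<open>98/100 * r k\<close>,
        against the small excess of the three ends.\<close>
      have star: "\<not> (detour l f w \<le> eps * r k \<and> detour w f y \<le> eps * r k)"
      proof
        assume st: "detour l f w \<le> eps * r k \<and> detour w f y \<le> eps * r k"
        have "chain3 (bend k) (us' @ l # f # y # vs')" using ok us Cons by (simp add: seg_ok_def)
        then have "chain3 (bend k) (l # f # y # vs')" by (rule chain3_appendD[THEN conjunct2])
        then have b: "detour l f y \<le> 2 * eps * dist l y" "ctrl k l y" by (simp_all add: bend_def)
        have "dist l f \<le> 45 * r k" "dist f y \<le> 45 * r k"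
          using ok us Cons by (auto simp: seg_ok_def successively_append_iff edge_def)
        then have ly: "dist l y \<le> 90 * r k" using dist_triangle[of l y f] by linarith
        have ln: "l \<in> nbs us f vs" "y \<in> nbs us f vs" using nbs_left nbs_right us Cons by auto
        have ne: "l \<noteq> y" using dst us Cons by auto
        have ex: "excess l y w \<le> eps * r k" using exc[OF ln ne b(2) ly] by linarith
        have dd: "98/100 * r k \<le> dist l f" "98/100 * r k \<le> dist f y" using sp[of l f] sp[of f y] dst us Cons by auto
        have "detour l f y \<le> 1/100 * r k" using b(1) ly rp by (simp add: eps_def)
        moreover have "dist y l = dist l y" "dist f l = dist l f" "dist w l = dist l w" "dist w f = dist f w" "dist w y = dist y w"
          by (simp_all add: dist_commute)
        moreover have "dist y w \<le> dist f y + dist f w" "dist l w \<le> dist l f + dist f w" "dist l y \<le> dist l f + dist f y"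
          using dist_triangle[of y w f] dist_triangle[of l w f] dist_triangle[of l y f] by (simp_all add: dist_commute)
        moreover have "dist l y + dist y w - dist l w \<le> r k / 100000 \<or> dist l w + dist w y - dist l y \<le> r k / 100000 \<or>
            dist y l + dist l w - dist y w \<le> r k / 100000"
          using ex unfolding excess_le_iff detour_def ep .
        ultimately show False
          using st[THEN conjunct1] st[THEN conjunct2] dd fw' rp unfolding ep detour_def
          by - (elim disjE; linarith)
      qed
      show ?thesis using left[OF us] right[OF Cons] star ins_left[OF us] ins_right[OF Cons] by blast
    qed
  qed
qed

end

section \<open>The level step\<close>

text \<open>The bound makes the total curvature cost \<open>C4 * C2 * (70 * \<eta> * r0)\<close> at
  most \<open>r0 / 2\<close>, and it makes every excess at an insertion at most
  \<open>eps * r k\<close>.\<close>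

locale flat_measure_small = flat_measure +
  assumes small: "100000 * C3 * C2 * \<eta> \<le> 1"
begin

section \<open>Sparse points, invariants and potentials\<close>

lemma C2_ge: "87000000 \<le> C2"
proof -
  have "87000000 * (\<delta> * alpha) \<le> N" using \<delta> by (simp add: N_def alpha_def)
  then show ?thesis using \<delta> by (simp add: C2_def pos_le_divide_eq alpha_def)
qed

lemma C3_a_le:
  assumes "x \<in> S" "y \<in> S" shows "C3 * (a k x + a k y) \<le> eps" "3 * C3 * (a k x + a k y) \<le> 1"
proof -
  have "a k x + a k y \<le> 28 * \<eta>" using a_le[OF assms(1), of k] a_le[OF assms(2), of k] by simp
  then have "C3 * (a k x + a k y) \<le> C3 * (28 * \<eta>)" using C3_pos by (intro mult_left_mono) auto
  moreover have "C3 * \<eta> * 87000000 \<le> C3 * \<eta> * C2" using C2_ge C3_pos \<eta> by (intro mult_left_mono) auto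
  moreover have "100000 * (C3 * \<eta> * C2) \<le> 1" using small by (simp add: ac_simps)
  moreover have "C3 * (28 * \<eta>) = 28 * (C3 * \<eta>)" by simp
  ultimately have *: "C3 * (a k x + a k y) \<le> 28 / (100000 * 87000000)" by linarith
  then show "C3 * (a k x + a k y) \<le> eps" by (simp add: eps_def)
  have "3 * C3 * (a k x + a k y) = 3 * (C3 * (a k x + a k y))" by simp
  then show "3 * C3 * (a k x + a k y) \<le> 1" using * by linarith
qed

text \<open>Removing open balls, not just their sparse centres, keeps the sets Borel and keeps
  points selected at much finer scales away from the centres.\<close>

primrec Z :: "nat \<Rightarrow> 'a set" where
  "Z 0 = S"
| "Z (Suc k) = Z k - (\<Union>v\<in>{v \<in> Z k. mball v (alpha * r (Suc k)) < \<delta> * alpha * r (Suc k)}. ball v (alpha * r (Suc k) / 2))"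

definition sparse :: "nat \<Rightarrow> 'a set" where
  "sparse k = {v \<in> Z k. mball v (alpha * r (Suc k)) < \<delta> * alpha * r (Suc k)}"

lemma Z_Suc: "Z (Suc k) = Z k - (\<Union>v\<in>sparse k. ball v (alpha * r (Suc k) / 2))"
  by (simp add: sparse_def)

lemma Z_antimono: "j \<le> k \<Longrightarrow> Z k \<subseteq> Z j"
  by (induction rule: dec_induct) (auto simp: Z_Suc)

lemma Z_subset: "Z k \<subseteq> S" using Z_antimono[of 0 k] by simp

lemma alpha_pos: "0 < alpha" by (simp add: alpha_def)

lemma dense_Z: assumes "v \<in> Z (Suc k)" shows "\<delta> * alpha * r (Suc k) \<le> mball v (alpha * r (Suc k))"
proof (rule ccontr)
  assume "\<not> ?thesis"
  then have "v \<in> sparse k" using assms by (auto simp: sparse_def)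
  moreover have "v \<in> ball v (alpha * r (Suc k) / 2)" using r_pos[of "Suc k"] by (simp add: alpha_def)
  ultimately show False using assms unfolding Z_Suc by blast
qed

text \<open>Unlike \<open>sparse\<close>, this allows a doubled radius, since a new point is only close to a point of \<open>Z k\<close>.\<close>

definition dense :: "'a \<Rightarrow> real \<Rightarrow> bool" where
  "dense x s \<longleftrightarrow> \<delta> * alpha * s \<le> mball x (2 * alpha * s)"

definition pts :: "'a list list \<Rightarrow> 'a set" where "pts segs = set (concat segs)"

text \<open>Points enter at the scale of their distance to the older ones.  Hence of two nearby points the later one
  is dense at the scale of their distance.\<close>

definition recent :: "nat \<Rightarrow> 'a set \<Rightarrow> bool" where
  "recent k F \<longleftrightarrow> (\<forall>x\<in>F. \<forall>y\<in>F. x \<noteq> y \<longrightarrow>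
     (\<exists>s\<ge>r k. s \<le> 103/100 * dist x y \<and> (dense x s \<or> dense y s)))"

text \<open>A hole cannot be kept empty, since points selected at coarser scales may already lie in
  it. But these are far apart, and later points stay outside, so it contains at most one.\<close>

definition holes :: "'a set \<Rightarrow> bool" where
  "holes F \<longleftrightarrow> (\<forall>j. \<forall>v\<in>sparse j. \<forall>x\<in>F. \<forall>y\<in>F. x \<noteq> y \<longrightarrow>
     \<not> (dist x v < 3/8 * (alpha * r (Suc j)) \<and> dist y v < 3/8 * (alpha * r (Suc j))))"

definition inv :: "nat \<Rightarrow> 'a list list \<Rightarrow> bool" where
  "inv k segs \<longleftrightarrow> (\<forall>xs\<in>set segs. seg_ok k xs) \<and> distinct (concat segs) \<and> pts segs \<subseteq> S \<and>
     spread k (pts segs) \<and> recent k (pts segs) \<and> holes (pts segs)"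

definition covers :: "nat \<Rightarrow> 'a list list \<Rightarrow> bool" where
  "covers k segs \<longleftrightarrow> (\<forall>z\<in>Z k. \<exists>x\<in>pts segs. dist z x \<le> r k)"

text \<open>\<open>270 = 2 * 3 * 45\<close>: a vertex has at most two edges of length at most
  \<open>45 * r k\<close>, each weighted by \<open>3 * C3\<close> in \<open>g\<close>.\<close>

definition C4 :: real where "C4 = 270 * C3"

definition g :: "nat \<Rightarrow> 'a \<Rightarrow> 'a \<Rightarrow> real" where
  "g k x y = dist x y * (1 + 3 * C3 * (a k x + a k y))"

text \<open>Appending a point beyond an end of a segment lengthens the path by a multiple of \<open>r k\<close>.  At each level
  this happens at most once per end that is an old point; a slot pays for it.\<close>

definition slots :: "'a set \<Rightarrow> 'a list list \<Rightarrow> real" where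
  "slots Old segs = (\<Sum>xs\<leftarrow>segs. of_bool (hd xs \<in> Old) + of_bool (last xs \<in> Old))"

text \<open>Within a level, an edge carries the curvature of its end points as extra weight; the gain from
  splitting an edge pays for the excess of the inserted point.\<close>

definition psi :: "nat \<Rightarrow> 'a set \<Rightarrow> 'a list list \<Rightarrow> real" where
  "psi k Old segs = psum dist (concat segs) + (\<Sum>xs\<leftarrow>segs. psum (g k) xs) + C4 * (\<Sum>x\<in>pts segs. e (Suc k) x)
     + 7 * r k * slots Old segs"

text \<open>The length of the whole list is what must stay bounded, but cutting does not change it.
  The segments are therefore counted a second time: their length is the reserve that a cut releases.
  The last term stores \<open>30 * r k = 45 * r (Suc k)\<close> per segment for the next
  level.\<close>

definition phi :: "nat \<Rightarrow> 'a list list \<Rightarrow> real" where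
  "phi k segs = psum dist (concat segs) + (\<Sum>xs\<leftarrow>segs. psum dist xs) + C4 * (\<Sum>x\<in>pts segs. e (Suc k) x)
     + 30 * r k * length segs"

section \<open>Choosing a point that preserves the invariants\<close>

lemma nbs_dist:
  assumes "seg_ok k (us @ f # vs)" "p \<in> nbs us f vs" shows "dist f p \<le> 90 * r k" "p \<in> set (us @ f # vs)"
proof -
  have rp: "0 < r k" by (rule r_pos)
  have succ: "successively (edge k) (us @ f # vs)" using assms(1) by (simp add: seg_ok_def)
  consider "p \<in> set (take 2 (rev us))" | "p = f" | "p \<in> set (take 2 vs)"
    using assms(2) unfolding nbs_def by blast
  then show "dist f p \<le> 90 * r k"
  proof cases
    case 1
    show ?thesis
    proof (cases us rule: rev_cases)
      case (snoc us1 l)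
      then have fl: "dist f l \<le> 45 * r k" using succ by (auto simp: successively_append_iff edge_def dist_commute)
      show ?thesis
      proof (cases us1 rule: rev_cases)
        case Nil
        then show ?thesis using 1 snoc fl rp by simp
      next
        case (snoc us2 m)
        then have "dist l m \<le> 45 * r k"
          using succ \<open>us = us1 @ [l]\<close> by (auto simp: successively_append_iff edge_def dist_commute)
        then show ?thesis using 1 snoc \<open>us = us1 @ [l]\<close> fl rp dist_triangle[of f m l] by auto
      qed
    qed (use 1 in simp)
  next
    case 3
    show ?thesis
    proof (cases vs)
      case (Cons l vs1)
      then have fl: "dist f l \<le> 45 * r k" using succ by (auto simp: successively_append_iff edge_def)
      show ?thesis
      proof (cases vs1)
        case Nil
        then show ?thesis using 3 Cons fl rp by simp
      next
        case (Cons m vs2)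
        then have "dist l m \<le> 45 * r k"
          using succ \<open>vs = l # vs1\<close> by (auto simp: successively_append_iff edge_def)
        then show ?thesis using 3 Cons \<open>vs = l # vs1\<close> fl rp dist_triangle[of f m l] by auto
      qed
    qed (use 3 in simp)
  qed (use rp in simp)
  show "p \<in> set (us @ f # vs)"
    using assms(2) set_take_subset[of 2 "rev us"] set_take_subset[of 2 vs] unfolding nbs_def by auto
qed

lemma card_nbs: "finite (nbs us f vs)" "card (nbs us f vs) \<le> 5"
proof -
  show "finite (nbs us f vs)" by (simp add: nbs_def)
  have "card (nbs us f vs) \<le> card (set (take 2 (rev us))) + card {f} + card (set (take 2 vs))"
    unfolding nbs_def by (meson add_le_mono card_Un_le le_refl order_trans)
  also have "\<dots> \<le> 2 + 1 + 2"
    by (intro add_mono order_trans[OF card_length]) auto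
  finally show "card (nbs us f vs) \<le> 5" by simp
qed

lemma choose_point:
  assumes v: "\<delta> * alpha * r k \<le> mball v (alpha * r k)"
    and ok: "seg_ok k (us @ f # vs)" and sub: "set (us @ f # vs) \<subseteq> F" and F: "F \<subseteq> S" "spread k F"
    and dst: "distinct (us @ f # vs)"
    and far: "\<And>x. x \<in> F \<Longrightarrow> r k < dist v x" and near: "dist v f \<le> 3/2 * r k"
  obtains w us' vs' where "w \<in> S" "dist v w \<le> alpha * r k" "w \<notin> F" "spread k (insert w F)" "dist f w \<le> 152/100 * r k"
    "\<delta> * alpha * e k w \<le> N * enn2real (\<integral>\<^sup>+ x\<in>cball v (alpha * r k). H k x \<partial>\<nu>)"
    "us @ f # vs = us' @ vs'" "seg_ok k (us' @ w # vs')"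
    "(us' \<noteq> [] \<and> vs' \<noteq> [] \<and> detour (last us') w (hd vs') \<le> C3 * r k * (a k (last us') + a k (hd vs'))
         \<and> C3 * r k * (a k (last us') + a k (hd vs')) \<le> eps * r k) \<or>
     (us' \<noteq> [] \<and> vs' = [] \<and> last us' = f) \<or> (us' = [] \<and> vs' \<noteq> [] \<and> hd vs' = f)"
proof -
  have rp: "0 < r k" by (rule r_pos)
  obtain w where w: "w \<in> S" "dist v w \<le> alpha * r k"
    and sel: "\<And>x y. x \<in> nbs us f vs \<Longrightarrow> y \<in> nbs us f vs \<Longrightarrow> ennreal (\<delta> * alpha * r k) * c k x y w \<le> ennreal N * B k x y"
    and sel2: "\<And>x j. x \<in> nbs us f vs \<Longrightarrow> k \<le> j \<Longrightarrow> j \<le> k + 11 \<Longrightarrow> ennreal (\<delta> * alpha * r k) * B j x w \<le> ennreal N * A j x"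
    and sel3: "\<delta> * alpha * e k w \<le> N * enn2real (\<integral>\<^sup>+ x\<in>cball v (alpha * r k). H k x \<partial>\<nu>)"
    using select_point[OF v card_nbs(1) card_nbs(2), of us f vs] by blast
  have ar: "alpha * r k = r k / 1000000" by (simp add: alpha_def)
  have wF: "98/100 * r k \<le> dist x w" if "x \<in> F" for x
    using far[OF that] w(2) dist_triangle[of v x w] rp unfolding ar by (simp add: dist_commute)
  have wnF: "w \<notin> F"
  proof
    assume "w \<in> F" from wF[OF this] show False using rp by simp
  qed
  have spr: "spread k (insert w F)"
    using F(2) wF unfolding spread_def by (auto simp: dist_commute)
  have fw: "dist f w \<le> 152/100 * r k"
    using near w(2) dist_triangle[of f w v] rp unfolding ar by (simp add: dist_commute)
  have spr': "spread k (insert w (set (us @ f # vs)))"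
    using spr sub unfolding spread_def by blast
  have wn: "w \<notin> set (us @ f # vs)" using wnF sub by blast
  have pS: "p \<in> S" "p \<in> F" if "p \<in> nbs us f vs" for p using nbs_dist(2)[OF ok that] sub F(1) by blast+
  have exc: "excess p q w \<le> C3 * r k * (a k p + a k q) \<and> C3 * r k * (a k p + a k q) \<le> eps * r k"
    if pq: "p \<in> nbs us f vs" "q \<in> nbs us f vs" "p \<noteq> q" "ctrl k p q" "dist p q \<le> 90 * r k" for p q
  proof
    have "dist p w \<le> 9152/100 * r k" "dist q w \<le> 9152/100 * r k"
      using nbs_dist(1)[OF ok pq(1)] nbs_dist(1)[OF ok pq(2)] fw dist_triangle[of p w f] dist_triangle[of q w f]
      by (simp_all add: dist_commute)
    then have "diam3 p q w \<le> 9152/100 * r k" using pq(5) rp by (simp add: diam3_def)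
    moreover have "98/100 * r k \<le> diam3 p q w"
      using wF[OF pS(2)[OF pq(1)]] dist_le_diam3(3)[of p w q] by linarith
    ultimately have "diam3 p q w \<in> I k" using rp by (simp add: I_def)
    then show "excess p q w \<le> C3 * r k * (a k p + a k q)"
      using pS pq sel by (intro excess_le_if_ctrl) auto
    have "r k * (C3 * (a k p + a k q)) \<le> r k * eps"
      using C3_a_le(1)[OF pS(1)[OF pq(1)] pS(1)[OF pq(2)], of k] rp by (intro mult_left_mono) auto
    then show "C3 * r k * (a k p + a k q) \<le> eps * r k" by (simp add: mult.assoc mult.left_commute mult.commute)
  qed
  have ct: "ctrl k p w" if "p \<in> nbs us f vs" for p
    using sel2[OF that] wF[OF pS(2)[OF that]] by (rule ctrl_if_selected)
  obtain us' vs' where "us @ f # vs = us' @ vs'" "seg_ok k (us' @ w # vs')"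
    "(us' \<noteq> [] \<and> vs' \<noteq> [] \<and> detour (last us') w (hd vs') \<le> C3 * r k * (a k (last us') + a k (hd vs'))
         \<and> C3 * r k * (a k (last us') + a k (hd vs')) \<le> eps * r k) \<or>
     (us' \<noteq> [] \<and> vs' = [] \<and> last us' = f) \<or> (us' = [] \<and> vs' \<noteq> [] \<and> hd vs' = f)"
    using place_point[OF ok spr' dst wn fw exc ct] by blast
  then show thesis using w wnF spr fw sel3 by (intro that)
qed

lemma recent_insert:
  assumes "recent k F" "spread k (insert w F)" "dense w (r k)" "w \<notin> F"
  shows "recent k (insert w F)"
proof -
  have *: "\<exists>s\<ge>r k. s \<le> 103/100 * dist x w \<and> dense w s" if "x \<in> F" for x
  proof -
    have "x \<noteq> w" using assms(4) that by blast
    then have "98/100 * r k \<le> dist x w" using assms(2) that by (simp add: spread_def)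
    then have "r k \<le> 103/100 * dist x w" using r_pos[of k] by linarith
    then show ?thesis using assms(3) by blast
  qed
  show ?thesis
    unfolding recent_def
  proof (intro ballI impI)
    fix x y assume xy: "x \<in> insert w F" "y \<in> insert w F" "x \<noteq> y"
    consider "x = w" "y \<in> F" | "y = w" "x \<in> F" | "x \<in> F" "y \<in> F" using xy by blast
    then show "\<exists>s\<ge>r k. s \<le> 103/100 * dist x y \<and> (dense x s \<or> dense y s)"
    proof cases
      case 1
      then show ?thesis using *[of y] by (metis dist_commute)
    next
      case 2
      then show ?thesis using *[of x] by blast
    next
      case 3
      then show ?thesis using assms(1) xy(3) unfolding recent_def by blast
    qed
  qed
qed

text \<open>If \<open>r k \<le> r (Suc j) / 8\<close>, then \<open>v\<close> has survived the
  removal around \<open>u\<close>, and \<open>w\<close> stays away from \<open>u\<close> by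
  \<open>1/2 - 1/8 = 3/8\<close> of \<open>alpha * r (Suc j)\<close>. Otherwise the hole is tiny
  against the separation of the points.\<close>

lemma holes_insert:
  assumes "holes F" "spread k (insert w F)" "v \<in> Z k" "dist v w \<le> alpha * r k" "w \<notin> F"
  shows "holes (insert w F)"
proof -
  have *: "\<not> (dist x u < 3/8 * (alpha * r (Suc j)) \<and> dist w u < 3/8 * (alpha * r (Suc j)))"
    if u: "u \<in> sparse j" and x: "x \<in> F" for j u x
  proof
    assume near: "dist x u < 3/8 * (alpha * r (Suc j)) \<and> dist w u < 3/8 * (alpha * r (Suc j))"
    have "x \<noteq> w" using assms(5) x by blast
    then have xw: "98/100 * r k \<le> dist x w" using assms(2) x by (simp add: spread_def)
    show False
    proof (cases "r k \<le> r (Suc j) / 8")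
      case True
      have "Suc j \<le> k"
      proof (rule ccontr)
        assume "\<not> Suc j \<le> k"
        then have "r (Suc j) \<le> r k" by (intro r_antimono) simp
        then show False using True r_pos[of "Suc j"] by linarith
      qed
      then have "v \<in> Z (Suc j)" using Z_antimono assms(3) by blast
      then have "v \<notin> ball u (alpha * r (Suc j) / 2)" using u unfolding Z_Suc by blast
      then have "\<not> dist u v < alpha * r (Suc j) / 2" by simp
      moreover have "alpha * r k \<le> alpha * (r (Suc j) / 8)" using True alpha_pos by (intro mult_left_mono) auto
      ultimately show False
        using near assms(4) dist_triangle[of u v w] by (simp add: dist_commute)
    next
      case False
      then have "alpha * r (Suc j) < r k / 100000" using r_pos[of k] by (simp add: alpha_def)
      then show False using near xw dist_triangle[of x w u] r_pos[of k] by (simp add: dist_commute)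
    qed
  qed
  show ?thesis
    unfolding holes_def
  proof (intro allI ballI impI)
    fix j u x y assume u: "u \<in> sparse j" and xy: "x \<in> insert w F" "y \<in> insert w F" "x \<noteq> y"
    consider "x = w" "y \<in> F" | "y = w" "x \<in> F" | "x \<in> F" "y \<in> F" using xy by blast
    then show "\<not> (dist x u < 3/8 * (alpha * r (Suc j)) \<and> dist y u < 3/8 * (alpha * r (Suc j)))"
    proof cases
      case 1
      then show ?thesis using *[OF u, of y] by blast
    next
      case 2
      then show ?thesis using *[OF u, of x] by blast
    next
      case 3
      then show ?thesis using assms(1) u xy(3) unfolding holes_def by blast
    qed
  qed
qed

section \<open>Cost of one insertion and of filling a level\<close>

definition HU :: "nat \<Rightarrow> 'a set \<Rightarrow> real" where
  "HU k U = enn2real (\<integral>\<^sup>+ x\<in>U. H k x \<partial>\<nu>)"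

lemma HU_finite: "ennreal (HU k U) = (\<integral>\<^sup>+ x\<in>U. H k x \<partial>\<nu>)" "HU k U \<le> budget k"
proof -
  have le: "(\<integral>\<^sup>+ x\<in>U. H k x \<partial>\<nu>) \<le> ennreal (budget k)"
    unfolding int_H[symmetric] by (intro nn_integral_mono) (auto simp: indicator_def)
  show "ennreal (HU k U) = (\<integral>\<^sup>+ x\<in>U. H k x \<partial>\<nu>)"
    unfolding HU_def by (rule ennreal_enn2real_le[OF le])
  show "HU k U \<le> budget k"
    unfolding HU_def using le budget_nonneg[of k] by (intro enn2real_leI) auto
qed

lemma HU_nonneg: "0 \<le> HU k U" by (simp add: HU_def)

lemma HU_Un:
  assumes "U \<in> sets \<nu>" "V \<in> sets \<nu>" "U \<inter> V = {}" shows "HU k (U \<union> V) = HU k U + HU k V"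
proof -
  have "(\<integral>\<^sup>+ x\<in>U \<union> V. H k x \<partial>\<nu>) = (\<integral>\<^sup>+ x\<in>U. H k x \<partial>\<nu>) + (\<integral>\<^sup>+ x\<in>V. H k x \<partial>\<nu>)"
    using assms H_measurable by (intro nn_integral_disjoint_pair) auto
  then have "ennreal (HU k (U \<union> V)) = ennreal (HU k U + HU k V)"
    unfolding HU_finite(1)[symmetric] by (simp add: HU_nonneg)
  then show ?thesis by (subst (asm) ennreal_inj) (auto simp: HU_nonneg)
qed

lemma g_le: "x \<in> S \<Longrightarrow> y \<in> S \<Longrightarrow> g k x y \<le> 2 * dist x y"
proof -
  assume "x \<in> S" "y \<in> S"
  then have "dist x y * (1 + 3 * C3 * (a k x + a k y)) \<le> dist x y * 2"
    using C3_a_le(2) by (intro mult_left_mono) auto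
  then show ?thesis by (simp add: g_def)
qed

lemma e_le_HU:
  assumes "\<delta> * alpha * e k w \<le> N * HU k X" shows "C4 * e k w \<le> C4 * C2 * HU k X"
proof -
  have "0 < \<delta> * alpha" using \<delta> alpha_pos by simp
  then have "e k w \<le> C2 * HU k X" using assms by (simp add: C2_def pos_le_divide_eq mult.commute)
  then show ?thesis using C3_pos by (simp add: C4_def mult.assoc)
qed

text \<open>The excess enters twice, through the whole list and through the segment, so at most
  \<open>2 * C3 * r k * (a k x + a k y)\<close> is due. Both new edges are shorter than
  \<open>dist x y\<close> by \<open>97/100 * r k\<close>; with the weight \<open>3 * C3\<close> this
  gains the factor \<open>3 * 97/100 > 2\<close>. What remains is the weight of
  \<open>w\<close>.\<close>

lemma interior_cost:
  assumes ab: "dist x w + dist w y - dist x y \<le> t" "t \<le> C3 * r k * (a k x + a k y)" "t \<le> eps * r k"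
    and far: "98/100 * r k \<le> dist x w" "98/100 * r k \<le> dist w y" and xy: "dist x y \<le> 45 * r k"
  shows "detour x w y + (g k x w + g k w y - g k x y) \<le> C4 * (r k * a k w)"
proof -
  have rp: "0 < r k" by (rule r_pos)
  define da where "da = dist x w"
  define db where "db = dist w y"
  define d where "d = dist x y"
  have "da - d \<le> - (97/100) * r k" "db - d \<le> - (97/100) * r k" "da + db \<le> 90 * r k"
    using ab(1,3) far xy rp unfolding da_def db_def d_def eps_r by linarith+
  then have "(da - d) * a k x \<le> - (97/100) * r k * a k x" "(db - d) * a k y \<le> - (97/100) * r k * a k y"
    "(da + db) * a k w \<le> 90 * r k * a k w"
    using a_nonneg by (intro mult_right_mono; simp)+
  then have "(da - d) * a k x + (db - d) * a k y + (da + db) * a k w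
      \<le> - (97/100) * (r k * (a k x + a k y)) + 90 * (r k * a k w)" by (simp add: algebra_simps)
  then have *: "C3 * ((da - d) * a k x + (db - d) * a k y + (da + db) * a k w)
      \<le> C3 * (- (97/100) * (r k * (a k x + a k y)) + 90 * (r k * a k w))"
    using C3_pos by (intro mult_left_mono) auto
  have "0 \<le> C3 * (r k * (a k x + a k y))" using C3_pos rp a_nonneg by (simp add: add_nonneg_nonneg)
  moreover have "t \<le> C3 * (r k * (a k x + a k y))" using ab(2) by (simp add: mult.assoc)
  moreover have "detour x w y \<le> t" using ab(1) by (simp add: detour_def)
  moreover have "g k x w + g k w y - g k x y = detour x w y + 3 * (C3 * ((da - d) * a k x + (db - d) * a k y + (da + db) * a k w))"
    unfolding g_def detour_def da_def db_def d_def by (simp add: algebra_simps)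
  moreover have "C3 * (- (97/100) * (r k * (a k x + a k y)) + 90 * (r k * a k w))
      = - (97/100) * (C3 * (r k * (a k x + a k y))) + 90 * (C3 * (r k * a k w))" by (simp add: algebra_simps)
  moreover have "C4 * (r k * a k w) = 270 * (C3 * (r k * a k w))" by (simp add: C4_def)
  ultimately show ?thesis using * by linarith
qed

text \<open>The new point always goes next to an old point \<open>f\<close>. In the interior,
  \<open>interior_cost\<close> applies; beyond an end, that end is \<open>f\<close> itself and its
  slot pays. The charge \<open>C4 * e m w\<close> that remains is bounded, by the selection of
  \<open>w\<close>, by the curvature mass of the ball around \<open>v\<close>.\<close>

lemma insert_step:
  assumes inv: "inv (Suc k) segs" and Old: "Old \<subseteq> pts segs"
    and cov: "\<And>z. z \<in> Z (Suc k) \<Longrightarrow> \<exists>f\<in>Old. dist z f \<le> 3/2 * r (Suc k)"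
    and v: "v \<in> Z (Suc k)" and far: "\<And>x. x \<in> pts segs \<Longrightarrow> r (Suc k) < dist v x"
  obtains segs' w where "inv (Suc k) segs'" "pts segs' = insert w (pts segs)"
    "dist v w \<le> alpha * r (Suc k)" "length segs' = length segs"
    "psi (Suc k) Old segs' \<le> psi (Suc k) Old segs + C4 * C2 * HU (Suc k) (cball v (alpha * r (Suc k)))"
proof -
  define m where "m = Suc k"
  note inv = inv[folded m_def] and cov = cov[folded m_def] and v = v[folded m_def] and far = far[folded m_def]
  have rp: "0 < r m" by (rule r_pos)
  obtain f where f: "f \<in> Old" "dist v f \<le> 3/2 * r m" using cov[OF v] by blast
  then obtain xs where xs: "xs \<in> set segs" "f \<in> set xs" using Old by (auto simp: pts_def)
  obtain As Bs where segs: "segs = As @ xs # Bs" using split_list[OF xs(1)] by blast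
  obtain us vs where xs_eq: "xs = us @ f # vs" using split_list[OF xs(2)] by blast
  have ok: "seg_ok m (us @ f # vs)" using inv xs(1) xs_eq by (auto simp: inv_def)
  have dist: "distinct (concat segs)" and sub: "pts segs \<subseteq> S" and spr: "spread m (pts segs)"
    and rec: "recent m (pts segs)" and hol: "holes (pts segs)" using inv by (auto simp: inv_def)
  have dx: "distinct (us @ f # vs)" using dist segs xs_eq by (auto simp: distinct_append)
  have sx: "set (us @ f # vs) \<subseteq> pts segs" using segs xs_eq by (auto simp: pts_def)
  have dv: "\<delta> * alpha * r m \<le> mball v (alpha * r m)" using dense_Z v unfolding m_def by blast
  obtain w us' vs' where w: "w \<in> S" "dist v w \<le> alpha * r m" "w \<notin> pts segs" "spread m (insert w (pts segs))" "dist f w \<le> 152/100 * r m"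
    and ew: "\<delta> * alpha * e m w \<le> N * enn2real (\<integral>\<^sup>+ x\<in>cball v (alpha * r m). H m x \<partial>\<nu>)"
    and eq: "us @ f # vs = us' @ vs'" and ok': "seg_ok m (us' @ w # vs')"
    and cases: "(us' \<noteq> [] \<and> vs' \<noteq> [] \<and> detour (last us') w (hd vs') \<le> C3 * r m * (a m (last us') + a m (hd vs'))
         \<and> C3 * r m * (a m (last us') + a m (hd vs')) \<le> eps * r m) \<or>
     (us' \<noteq> [] \<and> vs' = [] \<and> last us' = f) \<or> (us' = [] \<and> vs' \<noteq> [] \<and> hd vs' = f)"
    using choose_point[OF dv ok sx sub spr dx far f(2)] by blast
  define segs' where "segs' = As @ (us' @ w # vs') # Bs"
  have segs_eq: "segs = As @ (us' @ vs') # Bs" using segs xs_eq eq by simp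
  have pts': "pts segs' = insert w (pts segs)" unfolding pts_def segs'_def segs_eq by auto
  have fin: "finite (pts segs)" by (simp add: pts_def)
  have dw: "dense w (r m)"
  proof -
    have "cball v (alpha * r m) \<subseteq> cball w (2 * alpha * r m)"
    proof
      fix y assume "y \<in> cball v (alpha * r m)"
      then show "y \<in> cball w (2 * alpha * r m)"
        using w(2) dist_triangle[of w y v] by (simp add: dist_commute)
    qed
    then show ?thesis using dv mball_mono unfolding dense_def by (meson order_trans)
  qed
  have inv': "inv m segs'"
    unfolding inv_def
  proof (intro conjI)
    show "\<forall>xs\<in>set segs'. seg_ok m xs" using inv ok' by (auto simp: inv_def segs'_def segs_eq)
    show "distinct (concat segs')"
      using dist w(3) unfolding pts_def segs'_def segs_eq by auto
    show "pts segs' \<subseteq> S" "spread m (pts segs')" using pts' sub w by auto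
    show "recent m (pts segs')" unfolding pts' using rec w(4) dw w(3) by (rule recent_insert)
    show "holes (pts segs')" unfolding pts' using hol w(4) v w(2) w(3) by (rule holes_insert)
  qed
  have C4: "0 \<le> C4" using C3_pos by (simp add: C4_def)
  have eHU: "C4 * e m w \<le> C4 * C2 * HU m (cball v (alpha * r m))"
    using ew by (intro e_le_HU) (simp add: HU_def)
  have em: "e m w = r m * a m w + e (Suc m) w" using w(1) by (rule e_Suc)
  have sum_e: "(\<Sum>x\<in>pts segs'. e (Suc m) x) = e (Suc m) w + (\<Sum>x\<in>pts segs. e (Suc m) x)"
    unfolding pts' using fin w(3) by simp
  \<comment> \<open>The changes of the length of the whole list, of the weighted length of the
    segment, and of its slots.\<close>
  define P1 where "P1 = psum dist (concat segs') - psum dist (concat segs)"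
  define P2 where "P2 = psum (g m) (us' @ w # vs') - psum (g m) (us' @ vs')"
  define P4 where "P4 = of_bool (hd (us' @ w # vs') \<in> Old) + of_bool (last (us' @ w # vs') \<in> Old)
     - of_bool (hd (us' @ vs') \<in> Old) - (of_bool (last (us' @ vs') \<in> Old) :: real)"
  have psi: "psi m Old segs' - psi m Old segs = P1 + P2 + C4 * e (Suc m) w + 7 * r m * P4"
    unfolding psi_def P1_def P2_def P4_def slots_def sum_e
    by (simp add: segs'_def segs_eq algebra_simps)
  have wOld: "w \<notin> Old" using w(3) Old by blast
  have fS: "f \<in> S" using f(1) Old sub by blast
  have g_fw: "g m f w \<le> 304/100 * r m" "g m w f \<le> 304/100 * r m"
    using g_le[OF fS w(1), of m] g_le[OF w(1) fS, of m] w(5) by (simp_all add: dist_commute)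
  have c1: "concat segs' = (concat As @ us') @ w # (vs' @ concat Bs)" and c0: "concat segs = (concat As @ us') @ (vs' @ concat Bs)"
    by (simp_all add: segs'_def segs_eq)
  have "P1 + P2 + 7 * r m * P4 \<le> C4 * (r m * a m w)"
    using cases
  proof (elim disjE conjE)
    assume A: "us' \<noteq> []" "vs' \<noteq> []" and dt: "detour (last us') w (hd vs') \<le> C3 * r m * (a m (last us') + a m (hd vs'))"
      and te: "C3 * r m * (a m (last us') + a m (hd vs')) \<le> eps * r m"
    let ?x = "last us'" and ?y = "hd vs'"
    have in_pts: "?x \<in> pts segs" "?y \<in> pts segs" using A unfolding pts_def segs_eq by auto
    have "98/100 * r m \<le> dist ?x w" "98/100 * r m \<le> dist w ?y"
      using w(3,4) in_pts unfolding spread_def by (metis insertCI)+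
    moreover have "dist ?x ?y \<le> 45 * r m"
      using ok A unfolding eq seg_ok_def by (simp add: successively_append_iff edge_def)
    ultimately have "detour ?x w ?y + (g m ?x w + g m w ?y - g m ?x ?y) \<le> C4 * (r m * a m w)"
      using dt te by (intro interior_cost[where t = "C3 * r m * (a m (last us') + a m (hd vs'))"]) (auto simp: detour_def)
    moreover have "P1 = detour ?x w ?y"
      unfolding P1_def c1 c0 using A by (subst psum_insert) (auto simp: detour_def)
    moreover have "P2 = g m ?x w + g m w ?y - g m ?x ?y"
      unfolding P2_def using A by (subst psum_insert) auto
    moreover have "P4 = 0" unfolding P4_def using A by simp
    ultimately show ?thesis by simp
  next
    \<comment> \<open>Both lengths grow by at most \<open>304/100 * r m\<close>, together less than
      the slot of \<open>7 * r m\<close>. This slot is used up, since the new end \<open>w\<close>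
      is not old.\<close>
    assume A: "us' \<noteq> []" "vs' = []" and l: "last us' = f"
    have "P1 \<le> 2 * dist f w"
      unfolding P1_def c1 c0 using psum_dist_insert[of "concat As @ us'" f "vs' @ concat Bs" w] A l by simp
    moreover have "P2 = g m f w" unfolding P2_def using A l by (simp add: psum_snoc)
    moreover have "P4 = -1" unfolding P4_def using A l f(1) wOld by simp
    ultimately have "P1 + P2 + 7 * r m * P4 \<le> 0" using w(5) g_fw rp by simp
    also have "0 \<le> C4 * (r m * a m w)" using C4 rp a_nonneg by simp
    finally show ?thesis .
  next
    assume A: "us' = []" "vs' \<noteq> []" and l: "hd vs' = f"
    have "P1 \<le> 2 * dist f w"
      unfolding P1_def c1 c0 using psum_dist_insert[of "concat As @ us'" f "vs' @ concat Bs" w] A l by simp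
    moreover have "P2 = g m w f" unfolding P2_def using A l by (simp add: psum_Cons)
    moreover have "P4 = -1" unfolding P4_def using A l f(1) wOld by simp
    ultimately have "P1 + P2 + 7 * r m * P4 \<le> 0" using w(5) g_fw rp by simp
    also have "0 \<le> C4 * (r m * a m w)" using C4 rp a_nonneg by simp
    finally show ?thesis .
  qed
  then have "psi m Old segs' \<le> psi m Old segs + C4 * e m w"
    using psi unfolding em by (simp add: algebra_simps)
  then have "psi m Old segs' \<le> psi m Old segs + C4 * C2 * HU m (cball v (alpha * r m))"
    using eHU by linarith
  moreover have "length segs' = length segs" by (simp add: segs'_def segs_eq)
  ultimately show thesis using that[of segs' w] inv' pts' w(2) unfolding m_def by blast
qed

text \<open>Every insertion consumes a ball of mass at least \<open>\<delta> * alpha * r m\<close>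
  disjoint from the earlier ones, so the list must cover before the mass \<open>r0\<close> is
  exhausted. Disjointness also bounds the sum of all charges by the budget.\<close>

lemma fill_level:
  assumes inv: "inv (Suc k) segs"
    and cov: "\<And>z. z \<in> Z (Suc k) \<Longrightarrow> \<exists>f\<in>pts segs. dist z f \<le> 3/2 * r (Suc k)"
  obtains segs' where "inv (Suc k) segs'" "pts segs \<subseteq> pts segs'" "length segs' = length segs"
    "psi (Suc k) (pts segs) segs' \<le> psi (Suc k) (pts segs) segs + C4 * C2 * budget (Suc k)" "covers (Suc k) segs'"
proof (rule ccontr)
  assume no: "\<not> thesis"
  define m where "m = Suc k"
  note inv = inv[folded m_def] and cov = cov[folded m_def]
  have rp: "0 < r m" by (rule r_pos)
  have C: "0 \<le> C4 * C2" using C3_pos C2_pos by (simp add: C4_def)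
  define Q where "Q n segs' U \<longleftrightarrow> inv m segs' \<and> pts segs \<subseteq> pts segs' \<and> length segs' = length segs \<and>
     U \<in> sets \<nu> \<and> U \<subseteq> (\<Union>x\<in>pts segs'. cball x (2 * alpha * r m)) \<and> real n * (\<delta> * alpha * r m) \<le> measure \<nu> U \<and>
     psi m (pts segs) segs' \<le> psi m (pts segs) segs + C4 * C2 * HU m U" for n segs' U
  have "\<exists>segs' U. Q n segs' U" for n
  proof (induction n)
    case 0
    have "Q 0 segs {}" using inv by (simp add: Q_def HU_def)
    then show ?case by blast
  next
    case (Suc n)
    then obtain segs1 U where q: "inv m segs1" "pts segs \<subseteq> pts segs1" "length segs1 = length segs"
      "U \<in> sets \<nu>" "U \<subseteq> (\<Union>x\<in>pts segs1. cball x (2 * alpha * r m))" "real n * (\<delta> * alpha * r m) \<le> measure \<nu> U"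
      "psi m (pts segs) segs1 \<le> psi m (pts segs) segs + C4 * C2 * HU m U" unfolding Q_def by blast
    have "C4 * C2 * HU m U \<le> C4 * C2 * budget m" using C HU_finite(2) by (intro mult_left_mono) auto
    then have "\<not> covers m segs1" using no that[of segs1] q unfolding m_def by force
    then obtain v where v: "v \<in> Z m" and far: "\<And>x. x \<in> pts segs1 \<Longrightarrow> r m < dist v x"
      unfolding covers_def by (force simp: not_le)
    obtain segs' w where s: "inv m segs'" "pts segs' = insert w (pts segs1)"
      "dist v w \<le> alpha * r m" "length segs' = length segs1"
      "psi m (pts segs) segs' \<le> psi m (pts segs) segs1 + C4 * C2 * HU m (cball v (alpha * r m))"
      using insert_step[of k segs1 "pts segs" v] q cov v far unfolding m_def by blast
    define V where "V = cball v (alpha * r m)"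
    have V: "V \<in> sets \<nu>" by (simp add: V_def cball_sets)
    \<comment> \<open>Earlier balls lie within \<open>2 * alpha * r m\<close> of points of the list,
      whereas \<open>v\<close> is farther than \<open>r m\<close> from all of them.\<close>
    have disj: "U \<inter> V = {}"
    proof (rule ccontr)
      assume "U \<inter> V \<noteq> {}"
      then obtain y where "y \<in> U" "y \<in> V" by blast
      then obtain x where x: "x \<in> pts segs1" "dist x y \<le> 2 * alpha * r m" "dist v y \<le> alpha * r m"
        using q(5) by (auto simp: V_def)
      then show False using far[OF x(1)] dist_triangle[of v x y] rp by (simp add: alpha_def dist_commute)
    qed
    have VW: "V \<subseteq> cball w (2 * alpha * r m)"
    proof
      fix y assume "y \<in> V"
      then show "y \<in> cball w (2 * alpha * r m)"
        using s(3) dist_triangle[of w y v] by (simp add: V_def dist_commute)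
    qed
    have "measure \<nu> (U \<union> V) = measure \<nu> U + measure \<nu> V"
      using q(4) V disj by (intro finite_measure_Union)
    moreover have "\<delta> * alpha * r m \<le> measure \<nu> V"
      using dense_Z[of v k] v unfolding m_def V_def mball_def by blast
    ultimately have meas: "real (Suc n) * (\<delta> * alpha * r m) \<le> measure \<nu> (U \<union> V)"
      using q(6) by (simp add: algebra_simps)
    have "C4 * C2 * HU m (U \<union> V) = C4 * C2 * HU m U + C4 * C2 * HU m V"
      by (subst HU_Un[OF q(4) V disj]) (simp add: algebra_simps)
    then have "psi m (pts segs) segs' \<le> psi m (pts segs) segs + C4 * C2 * HU m (U \<union> V)"
      using s(5) q(7) unfolding V_def by linarith
    then have "Q (Suc n) segs' (U \<union> V)"
      unfolding Q_def using s q V VW meas by auto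
    then show ?case by blast
  qed
  moreover obtain n :: nat where n: "r0 < n * (\<delta> * alpha * r m)"
    using ex_less_of_nat_mult[of "\<delta> * alpha * r m" r0] \<delta> rp alpha_pos by auto
  ultimately obtain U where "real n * (\<delta> * alpha * r m) \<le> measure \<nu> U" unfolding Q_def by blast
  then show False using n measure_UNIV_le[of U] by linarith
qed

section \<open>Cutting long edges and the balance of a level\<close>

lemma seg_ok_mono: assumes "seg_ok k xs" "ys \<noteq> []" "xs = us @ ys @ vs" "k \<le> j" "successively (\<lambda>a b. dist a b \<le> 45 * r j) ys"
  shows "seg_ok j ys"
proof -
  have "successively (edge k) ys" "chain3 (bend k) ys"
    using assms(1) chain3_appendD[of "bend k" us "ys @ vs"] chain3_appendD[of "bend k" ys vs]
    unfolding seg_ok_def assms(3) by (auto simp: successively_append_iff)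
  moreover have "bend j a b c" if "bend k a b c" for a b c
    using that ctrl_mono[OF _ assms(4)] unfolding bend_def by blast
  ultimately have "chain3 (bend j) ys" using chain3_mono by blast
  moreover have "successively (edge j) ys"
    using \<open>successively (edge k) ys\<close> assms(5) ctrl_mono[OF _ assms(4)]
    by (induction ys rule: induct_list012) (auto simp: edge_def)
  ultimately show ?thesis using assms(2) by (simp add: seg_ok_def)
qed

lemma split_level:
  assumes inv: "inv k segs"
  obtains segs1 where "inv (Suc k) segs1" "concat segs1 = concat segs"
    "(\<Sum>xs\<leftarrow>segs1. psum dist xs) + 45 * r (Suc k) * length segs1
      \<le> (\<Sum>xs\<leftarrow>segs. psum dist xs) + 45 * r (Suc k) * length segs"
proof -
  define m where "m = 45 * r (Suc k)"
  have "\<exists>segs1. concat segs1 = concat segs' \<and> (\<forall>ys\<in>set segs1. seg_ok (Suc k) ys) \<and>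
      (\<Sum>xs\<leftarrow>segs1. psum dist xs) + m * length segs1 \<le> (\<Sum>xs\<leftarrow>segs'. psum dist xs) + m * length segs'"
    if "\<forall>xs\<in>set segs'. seg_ok k xs" for segs' :: "'a list list"
    using that
  proof (induction segs')
    case (Cons xs segs')
    then obtain segs1 where 1: "concat segs1 = concat segs'" "\<forall>ys\<in>set segs1. seg_ok (Suc k) ys"
      "(\<Sum>xs\<leftarrow>segs1. psum dist xs) + m * length segs1 \<le> (\<Sum>xs\<leftarrow>segs'. psum dist xs) + m * length segs'" by auto
    have ok: "seg_ok k xs" using Cons.prems by simp
    then have "xs \<noteq> []" by (simp add: seg_ok_def)
    from split_long_edges[OF this, of m] obtain xss where xss: "concat xss = xs" "[] \<notin> set xss" "xss \<noteq> []"
      "\<forall>ys\<in>set xss. successively (\<lambda>a b. dist a b \<le> m) ys"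
      "(\<Sum>ys\<leftarrow>xss. psum dist ys) + m * (real (length xss) - 1) \<le> psum dist xs" by blast
    have "seg_ok (Suc k) ys" if ys: "ys \<in> set xss" for ys
    proof -
      obtain A B where "xss = A @ ys # B" using split_list[OF ys] by blast
      then have "xs = concat A @ ys @ concat B" using xss(1) by auto
      then show ?thesis using seg_ok_mono[OF ok] xss(2,4) ys unfolding m_def by (metis le_SucI order_refl)
    qed
    then show ?case using 1 xss by (intro exI[of _ "xss @ segs1"]) (auto simp: algebra_simps)
  qed (intro exI[of _ "[]"], simp)
  then obtain segs1 where s: "concat segs1 = concat segs" "\<forall>ys\<in>set segs1. seg_ok (Suc k) ys"
    "(\<Sum>xs\<leftarrow>segs1. psum dist xs) + m * length segs1 \<le> (\<Sum>xs\<leftarrow>segs. psum dist xs) + m * length segs"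
    using inv unfolding inv_def by blast
  have p: "pts segs1 = pts segs" using s(1) by (simp add: pts_def)
  have rk: "r (Suc k) \<le> r k" by (intro r_antimono) simp
  have "inv (Suc k) segs1"
    unfolding inv_def p
  proof (intro conjI)
    show "distinct (concat segs1)" "pts segs \<subseteq> S" "holes (pts segs)" using inv s(1) by (auto simp: inv_def)
    show "spread (Suc k) (pts segs)" using inv rk unfolding inv_def spread_def by force
    show "recent (Suc k) (pts segs)" using inv rk unfolding inv_def recent_def by (meson order_trans)
  qed (use s in blast)
  then show thesis using that s unfolding m_def by blast
qed

lemma psum_g_le:
  assumes xs: "distinct xs" "set xs \<subseteq> S" "successively (\<lambda>a b. dist a b \<le> 45 * r k) xs"
  shows "psum (g k) xs \<le> psum dist xs + C4 * (\<Sum>x\<in>set xs. r k * a k x)"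
proof -
  have rp: "0 < r k" by (rule r_pos)
  have c: "0 \<le> C3" using C3_pos by simp
  \<comment> \<open>One edge weight of the first point, \<open>3 * 45 = 135\<close>, is held back
    for the edge that the next step of the induction puts in front of it.\<close>
  have "psum (g k) ys + 135 * C3 * r k * a k y \<le> psum dist ys + 270 * C3 * (\<Sum>x\<leftarrow>ys. r k * a k x)"
    if "ys = y # zs" "successively (\<lambda>a b. dist a b \<le> 45 * r k) ys" for y zs ys
    using that
  proof (induction ys arbitrary: y zs rule: induct_list012)
    case (2 x)
    then show ?case using rp c a_nonneg[of k x] by (simp add: mult.assoc)
  next
    case (3 x y' zs')
    have d: "dist x y' \<le> 45 * r k" using 3(4) by simp
    have IH: "psum (g k) (y' # zs') + 135 * C3 * r k * a k y' \<le> psum dist (y' # zs') + 270 * C3 * (\<Sum>x\<leftarrow>y' # zs'. r k * a k x)"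
      using 3(2)[of y' zs'] 3(4) by simp
    have "dist x y' * (3 * C3 * (a k x + a k y')) \<le> 45 * r k * (3 * C3 * (a k x + a k y'))"
      using d c a_nonneg by (intro mult_right_mono) (auto intro!: mult_nonneg_nonneg add_nonneg_nonneg)
    then have "g k x y' \<le> dist x y' + 135 * C3 * r k * a k x + 135 * C3 * r k * a k y'"
      by (simp add: g_def algebra_simps)
    moreover have "x = y" "zs = y' # zs'" using 3(3) by auto
    ultimately show ?case using IH by (simp add: algebra_simps)
  qed simp
  then have "psum (g k) xs \<le> psum dist xs + 270 * C3 * (\<Sum>x\<leftarrow>xs. r k * a k x)"
  proof (cases xs)
    case (Cons y zs)
    have "0 \<le> 135 * C3 * r k * a k y" using c rp a_nonneg by simp
    then show ?thesis using \<open>\<And>zs ys y. ys = y # zs \<Longrightarrow> _ ys \<Longrightarrow> _\<close>[OF Cons xs(3)] by linarith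
  qed simp
  also have "(\<Sum>x\<leftarrow>xs. r k * a k x) = (\<Sum>x\<in>set xs. r k * a k x)"
    using xs(1) by (rule sum_list_distinct_conv_sum_set)
  finally show ?thesis by (simp add: C4_def)
qed

text \<open>After the cut every segment has \<open>45 * r (Suc k)\<close> to spend, either stored in
  \<open>phi\<close> or freed by the cut that created it: 30 for the next \<open>phi\<close>, 14 for
  two slots, and 1 that makes the number of segments weighted by scale summable.\<close>

lemma level_step:
  assumes inv: "inv k segs" and cov: "covers k segs"
  obtains segs' where "inv (Suc k) segs'" "covers (Suc k) segs'" "pts segs \<subseteq> pts segs'"
    "phi (Suc k) segs' + r (Suc k) * length segs' \<le> phi k segs + C4 * C2 * budget (Suc k)"
proof -
  define m where "m = Suc k"
  have rp: "0 < r m" by (rule r_pos)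
  have C4: "0 \<le> C4" using C3_pos by (simp add: C4_def)
  have rm: "30 * r k = 45 * r m" using r_Suc[of k] by (simp add: m_def)
  obtain segs1 where s1: "inv m segs1" "concat segs1 = concat segs"
    "(\<Sum>xs\<leftarrow>segs1. psum dist xs) + 45 * r m * length segs1 \<le> (\<Sum>xs\<leftarrow>segs. psum dist xs) + 45 * r m * length segs"
    using split_level[OF inv] unfolding m_def by blast
  have p1: "pts segs1 = pts segs" using s1(2) by (simp add: pts_def)
  have cov1: "\<exists>f\<in>pts segs1. dist z f \<le> 3/2 * r m" if "z \<in> Z m" for z
  proof -
    have "z \<in> Z k" using that Z_antimono[of k m] by (auto simp: m_def)
    moreover have "r k = 3/2 * r m" using rm by simp
    ultimately show ?thesis using cov unfolding covers_def p1 by metis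
  qed
  obtain segs' where s': "inv m segs'" "pts segs1 \<subseteq> pts segs'" "length segs' = length segs1"
    "psi m (pts segs1) segs' \<le> psi m (pts segs1) segs1 + C4 * C2 * budget m" "covers m segs'"
    using fill_level[of k segs1] s1(1) cov1 unfolding m_def by blast
  have "psum dist xs \<le> psum (g m) xs" if "set xs \<subseteq> S" for xs
  proof (rule psum_mono)
    have "dist x y \<le> g m x y" for x y
    proof -
      have "dist x y * 1 \<le> dist x y * (1 + 3 * C3 * (a m x + a m y))"
        using C3_pos a_nonneg by (intro mult_left_mono) (auto intro!: mult_nonneg_nonneg add_nonneg_nonneg)
      then show ?thesis by (simp add: g_def)
    qed
    then show "successively (\<lambda>a b. dist a b \<le> g m a b) xs" by (induction xs rule: induct_list012) auto
  qed
  moreover have "set xs \<subseteq> S" if "xs \<in> set segs'" for xs using s'(1) that by (auto simp: inv_def pts_def)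
  ultimately have gsum: "(\<Sum>xs\<leftarrow>segs'. psum dist xs) \<le> (\<Sum>xs\<leftarrow>segs'. psum (g m) xs)"
    by (intro sum_list_mono) auto
  have "0 \<le> slots (pts segs1) segs'" unfolding slots_def by (intro sum_list_nonneg) auto
  then have "0 \<le> 7 * r m * slots (pts segs1) segs'" using rp by simp
  then have "phi m segs' \<le> psi m (pts segs1) segs' + 30 * r m * length segs'"
    using gsum unfolding phi_def psi_def by linarith
  also have "\<dots> \<le> psi m (pts segs1) segs1 + C4 * C2 * budget m + 30 * r m * length segs1"
    using s'(3,4) by simp
  also have "psi m (pts segs1) segs1 \<le> psum dist (concat segs) + (\<Sum>xs\<leftarrow>segs1. psum dist xs)
      + C4 * (\<Sum>x\<in>pts segs. e m x) + 14 * r m * length segs1"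
  proof -
    have "(\<Sum>xs\<leftarrow>segs1. psum (g m) xs) \<le> (\<Sum>xs\<leftarrow>segs1. psum dist xs + C4 * (\<Sum>x\<in>set xs. r m * a m x))"
    proof (rule sum_list_mono)
      fix xs assume xs: "xs \<in> set segs1"
      then have "successively (edge m) xs" "distinct xs" "set xs \<subseteq> S"
        using s1(1) by (auto simp: inv_def seg_ok_def pts_def distinct_concat_iff)
      moreover from this(1) have "successively (\<lambda>a b. dist a b \<le> 45 * r m) xs"
        by (rule successively_mono) (auto simp: edge_def)
      ultimately show "psum (g m) xs \<le> psum dist xs + C4 * (\<Sum>x\<in>set xs. r m * a m x)" by (intro psum_g_le)
    qed
    also have "\<dots> = (\<Sum>xs\<leftarrow>segs1. psum dist xs) + C4 * (\<Sum>x\<in>pts segs1. r m * a m x)"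
    proof -
      have "(\<Sum>xs\<leftarrow>segs2. \<Sum>x\<in>set xs. r m * a m x) = (\<Sum>x\<in>set (concat segs2). r m * a m x)"
        if "distinct (concat segs2)" for segs2 :: "'a list list"
        using that by (induction segs2) (auto simp: sum.union_disjoint)
      from this[of segs1] s1(1) show ?thesis
        by (simp add: sum_list_addf sum_list_const_mult pts_def inv_def)
    qed
    finally have 1: "(\<Sum>xs\<leftarrow>segs1. psum (g m) xs) \<le> (\<Sum>xs\<leftarrow>segs1. psum dist xs) + C4 * (\<Sum>x\<in>pts segs. r m * a m x)"
      by (simp add: p1)
    have "(\<Sum>x\<in>pts segs. e m x) = (\<Sum>x\<in>pts segs. r m * a m x + e (Suc m) x)"
      using inv by (intro sum.cong refl e_Suc) (auto simp: inv_def)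
    then have 2: "C4 * (\<Sum>x\<in>pts segs. e m x) = C4 * (\<Sum>x\<in>pts segs. r m * a m x) + C4 * (\<Sum>x\<in>pts segs. e (Suc m) x)"
      by (simp add: sum.distrib distrib_left)
    have "slots (pts segs1) segs1 \<le> (\<Sum>xs\<leftarrow>segs1. 2)"
      unfolding slots_def by (intro sum_list_mono) auto
    also have "\<dots> = 2 * real (length segs1)" by (simp add: sum_list_triv)
    finally have "7 * r m * slots (pts segs1) segs1 \<le> 7 * r m * (2 * real (length segs1))"
      using rp by (intro mult_left_mono) auto
    then show ?thesis using 1 2 unfolding psi_def p1 s1(2) by linarith
  qed
  finally have "phi m segs' + r m * length segs' \<le> psum dist (concat segs) + ((\<Sum>xs\<leftarrow>segs1. psum dist xs) + 45 * r m * length segs1)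
      + C4 * (\<Sum>x\<in>pts segs. e m x) + C4 * C2 * budget m"
    using s'(3) by (simp add: algebra_simps)
  also have "\<dots> \<le> psum dist (concat segs) + ((\<Sum>xs\<leftarrow>segs. psum dist xs) + 45 * r m * length segs)
      + C4 * (\<Sum>x\<in>pts segs. e m x) + C4 * C2 * budget m" using s1(3) by simp
  also have "\<dots> = phi k segs + C4 * C2 * budget m" unfolding phi_def rm m_def by simp
  finally show thesis using that[of segs'] s' p1 unfolding m_def by blast
qed

text \<open>The single point \<open>x0\<close> starts with \<open>30 * r0\<close> for its segment.
  By \<open>small\<close>, its initial charge and the sum of all later budgets contribute at most
  \<open>r0 / 2\<close> each.\<close>

lemma exists_levels:
  obtains p :: "nat \<Rightarrow> 'a list list" where "\<And>k. inv k (p k)" "\<And>k. covers k (p k)" "\<And>k. pts (p k) \<subseteq> pts (p (Suc k))"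
    "\<And>k. psum dist (concat (p k)) \<le> 31 * r0" "\<And>n. (\<Sum>k<n. r (Suc k) * length (p (Suc k))) \<le> 31 * r0"
proof -
  define P where "P k segs \<longleftrightarrow> inv k segs \<and> covers k segs" for k segs
  define R where "R k segs segs' \<longleftrightarrow> pts segs \<subseteq> pts segs' \<and>
     phi (Suc k) segs' + r (Suc k) * length segs' \<le> phi k segs + C4 * C2 * budget (Suc k)" for k segs segs'
  have base: "P 0 [[x0]]"
    using x0 S_sub
    by (auto simp: P_def inv_def covers_def pts_def seg_ok_def spread_def recent_def holes_def r_0 dist_commute)
  have step: "\<exists>segs'. P (Suc k) segs' \<and> R k segs segs'" if "P k segs" for k segs
    using level_step[of k segs] that unfolding P_def R_def by metis
  define p where "p = rec_nat [[x0]] (\<lambda>k segs. SOME segs'. P (Suc k) segs' \<and> R k segs segs')"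
  have p0: "p 0 = [[x0]]" by (simp add: p_def)
  have pS: "p (Suc k) = (SOME segs'. P (Suc k) segs' \<and> R k (p k) segs')" for k by (simp add: p_def)
  have P: "P k (p k)" for k
  proof (induction k)
    case (Suc k)
    then show ?case using someI_ex[OF step[OF Suc]] unfolding pS[symmetric] by blast
  qed (simp add: p0 base)
  have R: "R k (p k) (p (Suc k))" for k
    using someI_ex[OF step[OF P[of k]]] unfolding pS[symmetric] by blast
  have C: "0 \<le> C4 * C2" "0 \<le> C4" using C3_pos C2_pos by (auto simp: C4_def)
  have sum: "phi n (p n) + (\<Sum>k<n. r (Suc k) * length (p (Suc k))) \<le> phi 0 (p 0) + C4 * C2 * (\<Sum>k<n. budget (Suc k))" for n
  proof (induction n)
    case (Suc n)
    then show ?case using R[of n] unfolding R_def by (simp add: distrib_left)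
  qed simp
  have bud: "(\<Sum>k<n. budget (Suc k)) \<le> 70 * \<eta> * r0" for n
    using sum_budget_le[of "Suc n"] budget_nonneg[of 0] unfolding sum.lessThan_Suc_shift by linarith
  have "C4 * C2 * (\<Sum>k<n. budget (Suc k)) \<le> C4 * C2 * (70 * \<eta> * r0)" for n
    using C bud by (intro mult_left_mono)
  moreover have "C4 * C2 * (70 * \<eta> * r0) \<le> r0 / 2"
  proof -
    have "100000 * C3 * C2 * \<eta> * r0 \<le> 1 * r0" using small r0 by (intro mult_right_mono) auto
    moreover have "C4 * C2 * (70 * \<eta> * r0) = 18900 * (C3 * C2 * \<eta> * r0)" by (simp add: C4_def)
    moreover have "100000 * C3 * C2 * \<eta> * r0 = 100000 * (C3 * C2 * \<eta> * r0)" by simp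
    ultimately show ?thesis using r0 by linarith
  qed
  moreover have "phi 0 (p 0) \<le> 30 * r0 + r0 / 2"
  proof -
    have "14 * \<eta> * r 1 \<le> 14 * \<eta> * r0" using r_antimono[of 0 1] \<eta> by (intro mult_left_mono) (auto simp: r_0)
    then have "e 1 x0 \<le> 14 * \<eta> * r0" using e_le[OF x0, of 1] by linarith
    then have "C4 * e 1 x0 \<le> C4 * (14 * \<eta> * r0)" using C by (intro mult_left_mono)
    also have "\<dots> = 3780 * (C3 * \<eta> * r0)" by (simp add: C4_def)
    also have "\<dots> \<le> r0 / 2"
    proof -
      have "C3 * \<eta> * r0 * 1 \<le> C3 * \<eta> * r0 * C2" using C2_ge C3_pos \<eta> r0 by (intro mult_left_mono) auto
      moreover have "100000 * C3 * C2 * \<eta> * r0 \<le> 1 * r0" using small r0 by (intro mult_right_mono) auto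
      moreover have "C3 * \<eta> * r0 * C2 = C3 * C2 * \<eta> * r0" "100000 * C3 * C2 * \<eta> * r0 = 100000 * (C3 * C2 * \<eta> * r0)" by simp_all
      ultimately show ?thesis using r0 by linarith
    qed
    finally show ?thesis by (simp add: phi_def p0 pts_def r_0)
  qed
  ultimately have main: "phi n (p n) + (\<Sum>k<n. r (Suc k) * length (p (Suc k))) \<le> 31 * r0" for n
    using sum[of n] by (smt (verit) field_sum_of_halves)
  have rest: "psum dist (concat (p n)) \<le> phi n (p n)" "0 \<le> phi n (p n)" for n
  proof -
    have "0 \<le> (\<Sum>xs\<leftarrow>p n. psum dist xs)" by (intro sum_list_nonneg) (auto intro: psum_nonneg)
    moreover have "0 \<le> C4 * (\<Sum>x\<in>pts (p n). e (Suc n) x)" using C e_nonneg by (intro mult_nonneg_nonneg sum_nonneg) auto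
    moreover have "0 \<le> 30 * r n * length (p n)" using r_pos[of n] by simp
    moreover have "0 \<le> psum dist (concat (p n))" by (intro psum_nonneg) simp
    ultimately show "psum dist (concat (p n)) \<le> phi n (p n)" "0 \<le> phi n (p n)" unfolding phi_def by linarith+
  qed
  have nn: "0 \<le> (\<Sum>k<n. r (Suc k) * length (p (Suc k)))" for n
    using r_pos by (intro sum_nonneg) (simp add: less_imp_le)
  show thesis
  proof (rule that[of p])
    show "inv k (p k)" "covers k (p k)" "pts (p k) \<subseteq> pts (p (Suc k))" for k
      using P[of k] R[of k] by (auto simp: P_def R_def)
    show "psum dist (concat (p k)) \<le> 31 * r0" "(\<Sum>k<n. r (Suc k) * length (p (Suc k))) \<le> 31 * r0" for k n
      using main[of k] main[of n] rest nn[of k] rest(2)[of n] by (smt (verit))+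
  qed
qed

section \<open>The mass lost at sparse points\<close>

lemma Markov_measure:
  assumes f: "f \<in> borel_measurable \<nu>" "(\<integral>\<^sup>+ x. f x \<partial>\<nu>) \<le> ennreal I0" and pos: "0 < t" "0 \<le> I0"
  shows "measure \<nu> {y. ennreal t < f y} \<le> I0 / t"
proof -
  have "emeasure \<nu> {y \<in> UNIV. 1 \<le> ennreal (1 / t) * f y} \<le> ennreal (1 / t) * (\<integral>\<^sup>+ x. f x * indicator UNIV x \<partial>\<nu>)"
    using f(1) sets.top[of \<nu>] by (intro nn_integral_Markov_inequality) (auto simp: space_nu)
  also have "\<dots> \<le> ennreal (1 / t) * ennreal I0" using f(2) by (intro mult_left_mono) auto
  also have "\<dots> = ennreal (I0 / t)" using pos by (subst ennreal_mult[symmetric]) auto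
  finally have 1: "emeasure \<nu> {y \<in> UNIV. 1 \<le> ennreal (1 / t) * f y} \<le> ennreal (I0 / t)" .
  have "{y. ennreal t < f y} \<subseteq> {y \<in> UNIV. 1 \<le> ennreal (1 / t) * f y}"
  proof
    fix y assume "y \<in> {y. ennreal t < f y}"
    then have "ennreal (1 / t) * ennreal t \<le> ennreal (1 / t) * f y" by (intro mult_left_mono) auto
    moreover have "ennreal (1 / t) * ennreal t = 1" using pos by (subst ennreal_mult[symmetric]) auto
    ultimately show "y \<in> {y \<in> UNIV. 1 \<le> ennreal (1 / t) * f y}" by simp
  qed
  moreover have "{y \<in> UNIV. 1 \<le> ennreal (1 / t) * f y} \<in> sets \<nu>"
  proof -
    have "{y \<in> space \<nu>. 1 \<le> ennreal (1 / t) * f y} \<in> sets \<nu>" using f(1) by measurable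
    then show ?thesis by (simp add: space_nu)
  qed
  ultimately have "emeasure \<nu> {y. ennreal t < f y} \<le> ennreal (I0 / t)"
    using 1 by (meson emeasure_mono order_trans)
  then show ?thesis using pos by (simp add: emeasure_eq_measure ennreal_le_iff)
qed

lemma superlevel_sets:
  fixes f :: "'a \<Rightarrow> ennreal"
  assumes "f \<in> borel_measurable \<nu>" shows "{y. t < f y} \<in> sets \<nu>"
proof -
  have "f -` {t<..} \<inter> space \<nu> \<in> sets \<nu>" using assms by (rule measurable_sets) simp
  then show ?thesis by (simp add: space_nu vimage_def)
qed

abbreviation (input) "kp \<equiv> kernel {0::real<..}"
abbreviation (input) "kp2 \<equiv> kernel2 \<nu> {0<..}"

lemma kp_measurable: "(\<lambda>z. kp x y z) \<in> borel_measurable \<nu>" "(\<lambda>y. kp2 x y) \<in> borel_measurable \<nu>"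
  by (intro kernel_measurable kernel2_measurable sets_nu pos_open)+

text \<open>A set of positive mass all of whose points are sparse would contain many well separated points
  in nearly flat position.\<close>

lemma sparse_set_mass:
  assumes X: "X \<in> sets \<nu>" "X \<subseteq> S" "X \<subseteq> cball x R" and sparse: "\<And>y. y \<in> X \<Longrightarrow> mball y s \<le> \<tau>"
    and pos: "0 < s" "0 < R" "0 < \<tau>" and n: "8 * R / s + 3 < real n"
    and eta: "\<eta> \<le> s / (80 * R ^ 3) * \<tau>\<^sup>2 / (4 * real n)"
  shows "measure \<nu> X \<le> 2 * real n * \<tau>"
proof (rule ccontr)
  assume "\<not> ?thesis"
  then have big: "2 * real n * \<tau> < measure \<nu> X" by simp
  have n0: "0 < real n" using n pos by (smt (verit) divide_nonneg_pos mult_nonneg_nonneg)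
  \<comment> \<open>Diameters are at most \<open>2 * R\<close>, and
    \<open>\<kappa> * (2 * R) ^ 3 = s / 10\<close> is a tolerance that
    \<open>card_flat_separated_le\<close> accepts. \<open>\<theta>\<close> is chosen so that at most
    \<open>n * n\<close> pairs, losing \<open>\<theta> / \<kappa>\<close> each, lose
    \<open>n * \<tau> / 2\<close>.\<close>
  define \<kappa> where "\<kappa> = s / (80 * R ^ 3)"
  define \<theta> where "\<theta> = \<kappa> * \<tau> / (2 * real n)"
  have kp: "0 < \<kappa>" "0 < \<theta>" using pos n0 by (auto simp: \<kappa>_def \<theta>_def)
  have eta': "\<eta> \<le> \<theta> * \<tau> / 2" using eta n0 by (simp add: \<theta>_def \<kappa>_def power2_eq_square field_simps)
  define P where "P Y \<longleftrightarrow> finite Y \<and> Y \<subseteq> X \<and> (\<forall>u\<in>Y. \<forall>v\<in>Y. u \<noteq> v \<longrightarrow> s \<le> dist u v \<and> kp2 u v \<le> ennreal \<theta>) \<and>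
     (\<forall>u\<in>Y. \<forall>v\<in>Y. \<forall>w\<in>Y. u \<noteq> v \<longrightarrow> v \<noteq> w \<longrightarrow> u \<noteq> w \<longrightarrow> kp u v w \<le> ennreal \<kappa>)" for Y
  have "\<exists>Y. P Y \<and> card Y = i" if "i \<le> n" for i
    using that
  proof (induction i)
    case 0
    show ?case by (rule exI[of _ "{}"]) (simp add: P_def)
  next
    case (Suc i)
    then obtain Y where Y: "P Y" "card Y = i" by auto
    have finY: "finite Y" and YX: "Y \<subseteq> X" using Y(1) by (auto simp: P_def)
    have i: "real i \<le> real n" using Suc.prems by simp
    \<comment> \<open>The next point must avoid the points too close to \<open>Y\<close>, of mass at
      most \<open>n * \<tau>\<close>, and those with too much curvature in a pair or in a triple, of
      mass at most \<open>n * \<tau> / 2\<close> each.\<close>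
    define B1 where "B1 = (\<Union>u\<in>Y. cball u s)"
    define B2 where "B2 = (\<Union>u\<in>Y. {y. ennreal \<theta> < kp2 u y})"
    define B3 where "B3 = (\<Union>p\<in>{(u, v). u \<in> Y \<and> v \<in> Y \<and> u \<noteq> v}. {y. ennreal \<kappa> < kp (fst p) (snd p) y})"
    have finP: "finite {(u, v). u \<in> Y \<and> v \<in> Y \<and> u \<noteq> v}"
      by (rule finite_subset[of _ "Y \<times> Y"]) (use finY in auto)
    have cardP: "real (card {(u, v). u \<in> Y \<and> v \<in> Y \<and> u \<noteq> v}) \<le> real n * real n"
    proof -
      have "card {(u, v). u \<in> Y \<and> v \<in> Y \<and> u \<noteq> v} \<le> card (Y \<times> Y)"
        by (rule card_mono) (use finY in auto)
      then have "card {(u, v). u \<in> Y \<and> v \<in> Y \<and> u \<noteq> v} \<le> i * i" using Y(2) by (simp add: card_cartesian_product)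
      then have "real (card {(u, v). u \<in> Y \<and> v \<in> Y \<and> u \<noteq> v}) \<le> real i * real i"
        unfolding of_nat_mult[symmetric] by (rule of_nat_mono)
      also have "\<dots> \<le> real n * real n" using i by (intro mult_mono) auto
      finally show ?thesis .
    qed
    have m1: "measure \<nu> B1 \<le> real n * \<tau>"
    proof -
      have "measure \<nu> B1 \<le> (\<Sum>u\<in>Y. measure \<nu> (cball u s))"
        unfolding B1_def using finY by (intro finite_measure_subadditive_finite) (auto simp: sets_nu)
      also have "\<dots> \<le> (\<Sum>u\<in>Y. \<tau>)" using sparse YX by (intro sum_mono) (auto simp: mball_def)
      also have "\<dots> \<le> real n * \<tau>" using i pos Y(2) by (simp add: mult_right_mono)
      finally show ?thesis .
    qed
    have m2: "measure \<nu> B2 \<le> real n * \<tau> / 2"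
    proof -
      have "measure \<nu> B2 \<le> (\<Sum>u\<in>Y. measure \<nu> {y. ennreal \<theta> < kp2 u y})"
        unfolding B2_def using finY
        by (intro finite_measure_subadditive_finite) (auto intro: superlevel_sets kp_measurable)
      also have "\<dots> \<le> (\<Sum>u\<in>Y. \<eta> / \<theta>)"
      proof (intro sum_mono Markov_measure kp_measurable)
        fix u assume "u \<in> Y"
        then have "u \<in> S" using YX X(2) by blast
        then show "(\<integral>\<^sup>+ y. kp2 u y \<partial>\<nu>) \<le> ennreal \<eta>" using flat by (simp add: kernel1_def)
      qed (use kp \<eta> in auto)
      also have "\<dots> = real i * (\<eta> / \<theta>)" using Y(2) by simp
      also have "\<dots> \<le> real n * (\<tau> / 2)"
        using i eta' kp \<eta> by (intro mult_mono) (auto simp: pos_divide_le_eq mult.commute)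
      finally show ?thesis by simp
    qed
    have m3: "measure \<nu> B3 \<le> real n * \<tau> / 2"
    proof -
      have "measure \<nu> B3 \<le> (\<Sum>p\<in>{(u, v). u \<in> Y \<and> v \<in> Y \<and> u \<noteq> v}. measure \<nu> {y. ennreal \<kappa> < kp (fst p) (snd p) y})"
        unfolding B3_def using finP
        by (intro finite_measure_subadditive_finite) (auto intro: superlevel_sets kp_measurable)
      also have "\<dots> \<le> (\<Sum>p\<in>{(u, v). u \<in> Y \<and> v \<in> Y \<and> u \<noteq> v}. \<theta> / \<kappa>)"
      proof (intro sum_mono Markov_measure kp_measurable)
        fix p assume "p \<in> {(u, v). u \<in> Y \<and> v \<in> Y \<and> u \<noteq> v}"
        then have "kp2 (fst p) (snd p) \<le> ennreal \<theta>" using Y(1) unfolding P_def by auto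
        then show "(\<integral>\<^sup>+ y. kp (fst p) (snd p) y \<partial>\<nu>) \<le> ennreal \<theta>" by (simp add: kernel2_def)
      qed (use kp in auto)
      also have "\<dots> = real (card {(u, v). u \<in> Y \<and> v \<in> Y \<and> u \<noteq> v}) * (\<theta> / \<kappa>)" by simp
      also have "\<dots> \<le> real n * real n * (\<theta> / \<kappa>)" using cardP kp by (intro mult_right_mono) auto
      also have "\<dots> = real n * \<tau> / 2" using kp n0 by (simp add: \<theta>_def)
      finally show ?thesis .
    qed
    have Bs: "B1 \<in> sets \<nu>" "B2 \<in> sets \<nu>" "B3 \<in> sets \<nu>"
      unfolding B1_def B2_def B3_def using finY finP
      by (intro sets.finite_UN superlevel_sets kp_measurable; simp add: sets_nu cball_sets)+
    have "measure \<nu> (B1 \<union> B2 \<union> B3) \<le> measure \<nu> B1 + measure \<nu> B2 + measure \<nu> B3"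
      using Bs measure_Un_le[of "B1 \<union> B2" \<nu> B3] measure_Un_le[of B1 \<nu> B2] by simp
    then have "measure \<nu> (B1 \<union> B2 \<union> B3) < measure \<nu> X" using m1 m2 m3 big by linarith
    then have "\<not> X \<subseteq> B1 \<union> B2 \<union> B3" using Bs finite_measure_mono[of X "B1 \<union> B2 \<union> B3"] by auto
    then obtain y where y: "y \<in> X" "y \<notin> B1" "y \<notin> B2" "y \<notin> B3" by blast
    have y1: "s \<le> dist u y" if "u \<in> Y" for u using y(2) that by (auto simp: B1_def not_le)
    have y2: "kp2 u y \<le> ennreal \<theta>" if "u \<in> Y" for u using y(3) that by (auto simp: B2_def not_less)
    have y3: "kp u v y \<le> ennreal \<kappa>" if "u \<in> Y" "v \<in> Y" "u \<noteq> v" for u v using y(4) that by (auto simp: B3_def not_less)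
    have yY: "y \<notin> Y" using y1[of y] pos by auto
    have y3': "kp y u v \<le> ennreal \<kappa>" "kp u y v \<le> ennreal \<kappa>" if "u \<in> Y" "v \<in> Y" "u \<noteq> v" for u v
    proof -
      show "kp u y v \<le> ennreal \<kappa>" using y3[OF that] by (subst kernel_commute(2))
      then show "kp y u v \<le> ennreal \<kappa>" by (subst kernel_commute(1))
    qed
    have "P (insert y Y)"
      unfolding P_def
    proof (intro conjI ballI impI)
      show "finite (insert y Y)" "insert y Y \<subseteq> X" using finY YX y(1) by auto
      show "s \<le> dist u v" "kp2 u v \<le> ennreal \<theta>" if "u \<in> insert y Y" "v \<in> insert y Y" "u \<noteq> v" for u v
        using that Y(1) y1 y2 kernel2_commute[of \<nu> "{0<..}" y v] unfolding P_def by (auto simp: dist_commute)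
      show "kp u v w \<le> ennreal \<kappa>"
        if "u \<in> insert y Y" "v \<in> insert y Y" "w \<in> insert y Y" "u \<noteq> v" "v \<noteq> w" "u \<noteq> w" for u v w
        using that Y(1) y3 y3' unfolding P_def by auto
    qed
    moreover have "card (insert y Y) = Suc i" using finY yY Y(2) by simp
    ultimately show ?case by blast
  qed
  then obtain Y where Y: "P Y" "card Y = n" by blast
  have "real (card Y) \<le> 8 * R / s + 3"
  proof (rule card_flat_separated_le[of Y x R s "s / 10"])
    show "finite Y" "Y \<subseteq> cball x R" using Y(1) X(3) by (auto simp: P_def)
    show "s \<le> dist u v" if "u \<in> Y" "v \<in> Y" "u \<noteq> v" for u v using Y(1) that by (auto simp: P_def)
    show "excess u v w \<le> s / 10" if uvw: "u \<in> Y" "v \<in> Y" "w \<in> Y" "u \<noteq> v" "v \<noteq> w" "u \<noteq> w" for u v w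
    proof -
      have "u \<in> cball x R" "v \<in> cball x R" "w \<in> cball x R" using uvw Y(1) X(3) by (auto simp: P_def)
      then have "diam3 u v w \<le> 2 * R"
        using dist_triangle[of u v x] dist_triangle[of v w x] dist_triangle[of u w x]
        by (simp add: diam3_def dist_commute)
      moreover have d0: "0 < diam3 u v w" using uvw(4) by (intro diam3_pos) auto
      ultimately have "diam3 u v w ^ 3 \<le> (2 * R) ^ 3" by (intro power_mono) auto
      then have "\<kappa> * diam3 u v w ^ 3 \<le> \<kappa> * (2 * R) ^ 3" using kp by (intro mult_left_mono) auto
      also have "\<dots> = s / 10" using pos by (simp add: \<kappa>_def power_mult_distrib)
      finally have "\<kappa> * diam3 u v w ^ 3 \<le> s / 10" .
      moreover have "kp u v w \<le> ennreal \<kappa>" using Y(1) uvw by (auto simp: P_def)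
      ultimately show ?thesis
        using excess_le_kernel[of u v w "{0<..}" \<kappa>] d0 kp by auto
    qed
  qed (use pos in auto)
  then show False using n Y(2) by simp
qed

text \<open>If the kernel were larger on the whole product of the two balls, each of mass at least
  \<open>\<delta> * alpha * R\<close>, integration would give at least \<open>2 * \<eta>\<close> at
  \<open>x\<close>.\<close>

lemma flat_near_dense:
  assumes x: "x \<in> S" and p: "dense p s" "dense p' s'" and R: "0 < R" "R \<le> s" "R \<le> s'"
  shows "\<exists>p1 p1'. dist p p1 \<le> 2 * alpha * s \<and> dist p' p1' \<le> 2 * alpha * s' \<and>
    kp x p1 p1' \<le> ennreal (2 * \<eta> / (\<delta> * alpha * R)\<^sup>2)"
proof (rule ccontr)
  assume neg: "\<not> ?thesis"
  define b where "b = \<delta> * alpha * R"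
  define t where "t = 2 * \<eta> / b\<^sup>2"
  have b: "0 < b" using R \<delta> alpha_pos by (simp add: b_def)
  have t: "0 < t" using b \<eta> by (simp add: t_def)
  define U where "U = cball p (2 * alpha * s)"
  define V where "V = cball p' (2 * alpha * s')"
  have UV: "U \<in> sets \<nu>" "V \<in> sets \<nu>" by (simp_all add: U_def V_def cball_sets)
  have "b \<le> \<delta> * alpha * s" "b \<le> \<delta> * alpha * s'"
    unfolding b_def using R \<delta> alpha_pos by (intro mult_left_mono; simp)+
  then have mUV: "ennreal b \<le> emeasure \<nu> U" "ennreal b \<le> emeasure \<nu> V"
    using p unfolding dense_def mball_def U_def V_def by (auto simp: emeasure_eq_measure intro!: ennreal_leI)
  have k2: "ennreal (t * b) \<le> kp2 x y" if "y \<in> U" for y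
  proof -
    have "ennreal (t * b) = ennreal t * ennreal b" using t b by (simp add: ennreal_mult)
    also have "\<dots> \<le> ennreal t * emeasure \<nu> V" by (intro mult_left_mono mUV) simp
    also have "\<dots> = (\<integral>\<^sup>+ z. ennreal t * indicator V z \<partial>\<nu>)" using UV by (simp add: nn_integral_cmult_indicator)
    also have "\<dots> \<le> kp2 x y"
      unfolding kernel2_def
    proof (rule nn_integral_mono)
      fix z
      show "ennreal t * indicator V z \<le> kp x y z"
      proof (cases "z \<in> V")
        case True
        then have "\<not> kp x y z \<le> ennreal t"
          using neg that unfolding t_def b_def U_def V_def by simp
        then show ?thesis using True by simp
      qed simp
    qed
    finally show ?thesis .
  qed
  have "ennreal (2 * \<eta>) = ennreal (t * b) * ennreal b"
  proof -
    have "t * b * b = 2 * \<eta>" using b by (simp add: t_def power2_eq_square)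
    then show ?thesis using ennreal_mult[of "t * b" b] t b by simp
  qed
  also have "\<dots> \<le> ennreal (t * b) * emeasure \<nu> U" by (intro mult_left_mono mUV) simp
  also have "\<dots> = (\<integral>\<^sup>+ y. ennreal (t * b) * indicator U y \<partial>\<nu>)" using UV by (simp add: nn_integral_cmult_indicator)
  also have "\<dots> \<le> kernel1 \<nu> {0<..} x"
    unfolding kernel1_def using k2 by (intro nn_integral_mono) (auto simp: indicator_def)
  also have "\<dots> \<le> ennreal \<eta>" by (rule flat[OF x])
  finally show False using \<eta> by (simp add: ennreal_le_iff)
qed

end

text \<open>A hole is located by the list 53 levels further down: \<open>159 = 3 * 53\<close> stems
  from the cube of a diameter in \<open>excess_recents\<close>, and 52 from comparing
  \<open>r (Suc j)\<close> with \<open>r (j + 53)\<close>. \<open>small3\<close> serves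
  \<open>sparse_set_mass\<close> in \<open>removed_mass\<close>.\<close>

locale flat_measure_final = flat_measure_small +
  assumes small2: "54000 * (3/2) ^ 159 * \<eta> \<le> (\<delta> * alpha)\<^sup>2"
    and small3: "10 ^ 12 * \<eta> \<le> \<delta>\<^sup>2 * alpha ^ 3"
    and small_delta: "20000 * (3/2) ^ 52 * \<delta> \<le> 1"
    and mass_ge: "r0 / 2 \<le> measure \<nu> S"
begin

text \<open>Density at some scale comparable to \<open>r k\<close>. The factor 200 exceeds
  \<open>103/100 * 180\<close>, for pairs at distance up to \<open>180 * r k\<close>.\<close>

definition recents :: "nat \<Rightarrow> 'a \<Rightarrow> bool" where
  "recents k p \<longleftrightarrow> (\<exists>s\<ge>r k. s \<le> 200 * r k \<and> dense p s)"

text \<open>Move \<open>p\<close> and \<open>p'\<close> slightly so that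
  \<open>flat_near_dense\<close> applies; this changes the excess by at most
  \<open>2 * R / 1000\<close>. The diameter may reach \<open>3 * r j\<close>, whose cube relative to
  \<open>R ^ 3\<close> is \<open>27 * (3/2) ^ 159\<close>.\<close>

lemma excess_recents:
  assumes x: "x \<in> S" and p: "recents (j + 53) p" "recents (j + 53) p'"
    and near: "dist x p \<le> 2 * r j" "dist x p' \<le> 2 * r j" "dist p p' \<le> 2 * r j"
  shows "excess x p p' \<le> r (j + 53) / 100"
proof -
  define R where "R = r (j + 53)"
  define Q :: real where "Q = (3/2) ^ 159"
  have R: "0 < R" "r j = R * (3/2) ^ 53"
    using r_pos[of "j + 53"] r_add[of j 53] by (simp_all add: R_def power_divide)
  obtain s s' where s: "R \<le> s" "s \<le> 200 * R" "dense p s" "R \<le> s'" "s' \<le> 200 * R" "dense p' s'"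
    using p unfolding recents_def R_def by blast
  obtain p1 p1' where p1: "dist p p1 \<le> 2 * alpha * s" "dist p' p1' \<le> 2 * alpha * s'"
    "kp x p1 p1' \<le> ennreal (2 * \<eta> / (\<delta> * alpha * R)\<^sup>2)"
    using flat_near_dense[OF x s(3,6) R(1) s(1,4)] by blast
  have d1: "dist p p1 \<le> R / 2000" "dist p' p1' \<le> R / 2000"
    using p1(1,2) s R(1) by (simp_all add: alpha_def)
  have Rj: "R \<le> r j" unfolding R_def by (intro r_antimono) simp
  have "excess x p1 p1' \<le> R / 1000"
  proof (cases "diam3 x p1 p1' = 0")
    case True
    then have "dist x p1 \<le> 0" "dist x p1' \<le> 0" "dist p1 p1' \<le> 0"
      using dist_le_diam3[of x p1 p1'] dist_le_diam3[of p1 p1' x] dist_le_diam3(3)[of x p1' p1] by auto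
    then have "excess x p1 p1' \<le> 0" using excess_le_detour(1)[of x p1 p1'] by (simp add: detour_def)
    then show ?thesis using R by linarith
  next
    case False
    then have D0: "0 < diam3 x p1 p1'" using diam3_nonneg[of x p1 p1'] by linarith
    have "dist x p1 \<le> 3 * r j" "dist x p1' \<le> 3 * r j" "dist p1 p1' \<le> 3 * r j"
      using near d1 Rj r_pos[of j] dist_triangle[of x p1 p] dist_triangle[of x p1' p']
        dist_triangle[of p1 p1' p] dist_triangle[of p p1' p'] by (simp_all add: dist_commute)
    then have "diam3 x p1 p1' \<le> 3 * r j" by (simp add: diam3_def)
    then have "diam3 x p1 p1' ^ 3 \<le> (3 * r j) ^ 3" using D0 by (intro power_mono) auto
    also have "\<dots> = 27 * R ^ 3 * Q"
      unfolding R(2) power_mult_distrib power_mult[symmetric] Q_def by simp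
    finally have D3: "diam3 x p1 p1' ^ 3 \<le> 27 * R ^ 3 * Q" .
    have da: "0 < (\<delta> * alpha)\<^sup>2" using \<delta> alpha_pos by simp
    have "excess x p1 p1' \<le> 2 * \<eta> / (\<delta> * alpha * R)\<^sup>2 * diam3 x p1 p1' ^ 3"
      using D0 p1(3) \<eta> by (intro excess_le_kernel[where I = "{0<..}"]) auto
    also have "\<dots> \<le> 2 * \<eta> / (\<delta> * alpha * R)\<^sup>2 * (27 * R ^ 3 * Q)"
      using D3 \<eta> by (intro mult_left_mono) auto
    also have "\<dots> = (54000 * Q * \<eta>) / (\<delta> * alpha)\<^sup>2 * (R / 1000)"
    proof -
      have eq: "2 * y / (u * R)\<^sup>2 * (27 * R ^ 3 * Q) = (54000 * Q * y) / u\<^sup>2 * (R / 1000)" if "u \<noteq> 0" for u y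
        using R(1) that by (simp add: field_simps power2_eq_square power3_eq_cube)
      show ?thesis using \<delta> alpha_pos by (intro eq) simp
    qed
    also have "\<dots> \<le> 1 * (R / 1000)"
      using small2 da R(1) by (intro mult_right_mono) (auto simp: Q_def)
    finally show ?thesis by simp
  qed
  moreover have "excess x p p' \<le> excess x p1 p1' + 2 * dist p p1 + 2 * dist p' p1'" by (rule excess_lipschitz)
  ultimately show ?thesis using d1 R(1) unfolding R_def[symmetric] by linarith
qed

lemma recents_if_near:
  assumes inv: "inv k segs" and u: "u \<in> pts segs" "v \<in> pts segs" "u \<noteq> v" and d: "dist u v \<le> 180 * r k"
  shows "recents k u \<or> recents k v"
proof -
  have "recent k (pts segs)" using inv unfolding inv_def by (elim conjE)
  from this[unfolded recent_def, rule_format, OF u]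
  obtain s where s: "r k \<le> s" "s \<le> 103/100 * dist u v" "dense u s \<or> dense v s" by (elim exE conjE)
  then have "s \<le> 200 * r k" using d r_pos[of k] by linarith
  then show ?thesis using s unfolding recents_def by (auto intro: exI[of _ s])
qed

text \<open>Each pair contains a point that is dense near this scale, so at least two of the three
  are. The third is the base point in \<open>excess_recents\<close>.\<close>

lemma excess_level_points:
  assumes inv: "inv (j + 53) segs" and xyz: "x \<in> pts segs" "y \<in> pts segs" "z \<in> pts segs" "x \<noteq> y" "y \<noteq> z" "x \<noteq> z"
    and d: "dist x y \<le> 180 * r (j + 53)" "dist y z \<le> 180 * r (j + 53)" "dist x z \<le> 180 * r (j + 53)"
  shows "excess x y z \<le> r (j + 53) / 100"
proof -
  have S: "x \<in> S" "y \<in> S" "z \<in> S" using inv xyz by (auto simp: inv_def)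
  have rp: "0 < r (j + 53)" by (rule r_pos)
  note rec = recents_if_near[OF inv]
  have "r (j + 53) * 90 \<le> r j"
    using r_pos[of j] unfolding r_add by (simp add: power_divide)
  then have d': "dist x y \<le> 2 * r j" "dist y z \<le> 2 * r j" "dist x z \<le> 2 * r j" using d by linarith+
  consider "recents (j + 53) x" "recents (j + 53) y" | "recents (j + 53) y" "recents (j + 53) z" | "recents (j + 53) x" "recents (j + 53) z"
    using rec xyz d by blast
  then show ?thesis
  proof cases
    case 1
    then have "excess z x y \<le> r (j + 53) / 100" using S d' by (intro excess_recents) (simp_all add: dist_commute)
    then show ?thesis using excess_commute(1)[of z x y] excess_commute(2)[of x z y] by simp
  next
    case 2
    then show ?thesis using S d' by (intro excess_recents) simp_all
  next
    case 3
    then have "excess y x z \<le> r (j + 53) / 100" using S d' by (intro excess_recents) (simp_all add: dist_commute)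
    then show ?thesis using excess_commute(1)[of y x z] by simp
  qed
qed

text \<open>A level point near a sparse point cannot lie deep inside its segment: the nearest point of the
  segment would be the middle of a straight piece, and the sparse point would see both sides at
  nearly the same distance, so that it would not be in flat position with them.\<close>

lemma end_near_sparse:
  assumes inv: "inv (j + 53) segs" and v: "v \<in> sparse j" and f: "f \<in> pts segs" "dist v f \<le> r j"
  shows "\<exists>xs\<in>set segs. dist v (hd xs) \<le> 11/10 * r j \<or> dist v (last xs) \<le> 11/10 * r j"
proof -
  define K where "K = j + 53"
  define R where "R = r K"
  define \<rho> where "\<rho> = alpha * r (Suc j)"
  have R: "0 < R" by (simp add: R_def r_pos)
  have rj: "0 < r j" by (rule r_pos)
  \<comment> \<open>\<open>alpha * (3/2) ^ 52 > 720\<close>: after 53 levels, five consecutive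
    points of a segment span at most \<open>180 * R \<le> \<rho> / 4\<close>.\<close>
  have R\<rho>: "720 * R \<le> \<rho>" "45 * R \<le> r j / 100"
    using rj unfolding R_def K_def \<rho>_def r_add r_Suc by (simp_all add: alpha_def power_divide)
  have inv': "inv K segs" using inv by (simp add: K_def)
  obtain \<sigma> where \<sigma>: "\<sigma> \<in> set segs" "f \<in> set \<sigma>" using f(1) by (auto simp: pts_def)
  have "finite (set \<sigma>)" "set \<sigma> \<noteq> {}" using \<sigma>(2) by auto
  from ex_min_if_finite[of "dist v ` set \<sigma>"] this
  obtain a where a: "a \<in> set \<sigma>" "\<And>b. b \<in> set \<sigma> \<Longrightarrow> dist v a \<le> dist v b"
    by (auto simp: not_less)
  define D where "D = dist v a"
  have D: "D \<le> r j" using a(2)[OF \<sigma>(2)] f(2) by (simp add: D_def)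
  have sub: "b \<in> pts segs" if "b \<in> set \<sigma>" for b using that \<sigma>(1) by (auto simp: pts_def)
  have ok: "successively (edge K) \<sigma>" "chain3 (bend K) \<sigma>"
    using inv' \<sigma>(1) by (auto simp: inv_def seg_ok_def)
  have dst: "distinct \<sigma>" using inv' \<sigma>(1) by (auto simp: inv_def distinct_concat_iff)
  obtain us vs where \<sigma>eq: "\<sigma> = us @ a # vs" using split_list[OF a(1)] by blast
  have ed: "dist x y \<le> 45 * R" if "\<sigma> = as @ x # y # bs" for as x y bs
    using ok(1) unfolding that by (simp add: successively_append_iff edge_def R_def)
  consider "us = []" | l where "us = [l]" | us' l' l where "us = us' @ [l', l]"
    by (metis append_Cons append_Nil append_assoc rev_exhaust)
  then consider (hd) "us = [] \<or> (\<exists>l. us = [l])" | (last) "vs = [] \<or> (\<exists>y. vs = [y])"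
    | (mid) us' l' l y y' vs' where "us = us' @ [l', l]" "vs = y # y' # vs'"
    by (metis list.exhaust)
  then show ?thesis
  proof cases
    case hd
    then have "dist v (hd \<sigma>) \<le> D + 45 * R"
    proof
      assume "us = []"
      then show ?thesis using R by (simp add: \<sigma>eq D_def)
    next
      assume "\<exists>l. us = [l]"
      then obtain l where l: "\<sigma> = [] @ l # a # vs" by (auto simp: \<sigma>eq)
      show ?thesis using ed[OF l] dist_triangle[of v l a] by (simp add: l D_def dist_commute)
    qed
    then show ?thesis using D R\<rho>(2) rj \<sigma>(1) by (intro bexI[of _ \<sigma>] disjI1) linarith+
  next
    case last
    then have "dist v (last \<sigma>) \<le> D + 45 * R"
    proof
      assume "vs = []"
      then show ?thesis using R by (simp add: \<sigma>eq D_def)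
    next
      assume "\<exists>l. vs = [l]"
      then obtain l where l: "\<sigma> = us @ a # l # []" by (auto simp: \<sigma>eq)
      show ?thesis using ed[OF l] dist_triangle[of v l a] by (simp add: l D_def)
    qed
    then show ?thesis using D R\<rho>(2) rj \<sigma>(1) by (intro bexI[of _ \<sigma>] disjI2) linarith+
  next
    case mid
    have eq: "\<sigma> = us' @ l' # l # a # y # y' # vs'" using mid by (simp add: \<sigma>eq)
    have e: "dist l' l \<le> 45 * R" "dist l a \<le> 45 * R" "dist a y \<le> 45 * R" "dist y y' \<le> 45 * R"
      using ok(1) by (simp_all add: eq successively_append_iff edge_def R_def)
    have b: "bend K l' l a" "bend K l a y" "bend K a y y'"
    proof -
      have "chain3 (bend K) (l' # l # a # y # y' # vs')"
        using ok(2) unfolding eq using chain3_appendD by blast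
      then show "bend K l' l a" "bend K l a y" "bend K a y y'" by simp_all
    qed
    have far: "dist l' a \<le> 90 * R" "dist l' y \<le> 135 * R" "dist l' y' \<le> 180 * R" "dist l y \<le> 90 * R"
      "dist l y' \<le> 135 * R" "dist a y' \<le> 90 * R"
      using e dist_triangle[of l' a l] dist_triangle[of l y a] dist_triangle[of a y' y]
        dist_triangle[of l' y l] dist_triangle[of l y' y] dist_triangle[of l' y' y] by linarith+
    have P: "l' \<in> pts segs" "l \<in> pts segs" "a \<in> pts segs" "y \<in> pts segs" "y' \<in> pts segs"
      by (auto intro!: sub simp: eq)
    have ne: "l' \<noteq> l" "l' \<noteq> a" "l' \<noteq> y" "l' \<noteq> y'" "l \<noteq> a" "l \<noteq> y" "l \<noteq> y'" "a \<noteq> y" "a \<noteq> y'" "y \<noteq> y'"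
      using dst by (auto simp: eq)
    have sep: "98/100 * R \<le> dist p q" if "p \<in> pts segs" "q \<in> pts segs" "p \<noteq> q" for p q
    proof -
      have "spread K (pts segs)" using inv' unfolding inv_def by (elim conjE)
      from this[unfolded spread_def, rule_format, OF that] show ?thesis by (simp add: R_def)
    qed
    have small: "detour p q s \<le> R / 100" if "bend K p q s" "dist p s \<le> 90 * R" for p q s
      using that R unfolding bend_def eps_def by linarith
    note flat = excess_level_points[OF inv, folded K_def, folded R_def]
    have fl: "excess l' l y \<le> R / 100" "excess l' l y' \<le> R / 100" "excess l' a y \<le> R / 100" "excess l' a y' \<le> R / 100"
      "excess l' y y' \<le> R / 100" "excess l a y' \<le> R / 100" "excess l y y' \<le> R / 100"
      by (intro flat P ne; use e far R in linarith)+
    have t: "20 * (R / 100) < 98/100 * R" "0 \<le> R / 100" using R by linarith+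
    note five = five_points_detour[OF t sep[OF P(1,2) ne(1)] sep[OF P(1,3) ne(2)] sep[OF P(1,4) ne(3)]
      sep[OF P(1,5) ne(4)] sep[OF P(2,3) ne(5)] sep[OF P(2,4) ne(6)] sep[OF P(2,5) ne(7)] sep[OF P(3,4) ne(8)]
      sep[OF P(3,5) ne(9)] sep[OF P(4,5) ne(10)] small[OF b(1) far(1)] small[OF b(2) far(4)] small[OF b(3) far(6)] fl]
    \<comment> \<open>Only one of two neighbours is known to be dense near this scale;
      \<open>five\<close> covers all four combinations of sides.\<close>
    obtain p where p: "p \<in> {l', l}" "recents K p"
      using recents_if_near[OF inv' P(1,2) ne(1)] e(1) R unfolding R_def by auto
    obtain p' where p': "p' \<in> {y, y'}" "recents K p'"
      using recents_if_near[OF inv' P(4,5) ne(10)] e(4) R unfolding R_def by auto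
    have pp: "detour p a p' \<le> R / 100" using five p(1) p'(1) by auto
    have dp: "dist p a \<le> 90 * R" "dist a p' \<le> 90 * R" "98/100 * R \<le> dist p a" "98/100 * R \<le> dist a p'"
      using p(1) p'(1) e far R sep P ne by auto
    have "p \<in> set \<sigma>" "p' \<in> set \<sigma>" using p(1) p'(1) by (auto simp: eq)
    then have near: "D \<le> dist v p" "D \<le> dist v p'" using a(2) by (auto simp: D_def)
    have tri: "dist v p \<le> D + dist p a" "dist v p' \<le> D + dist a p'" "dist p p' \<le> dist p a + dist a p'"
      using dist_triangle[of v p a] dist_triangle[of v p' a] dist_triangle[of p p' a]
      by (simp_all add: D_def dist_commute)
    \<comment> \<open>Otherwise \<open>a\<close> and its neighbour \<open>l\<close> would both lie
      in the hole around \<open>v\<close>, which contains at most one point.\<close>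
    have D4: "\<rho> / 4 \<le> D"
    proof (rule ccontr)
      assume "\<not> \<rho> / 4 \<le> D"
      moreover have "dist l v \<le> D + 45 * R" using dist_triangle[of l v a] e(2) by (simp add: D_def dist_commute)
      ultimately have "dist l v < 3/8 * \<rho>" "dist a v < 3/8 * \<rho>"
        using R\<rho>(1) R by (simp_all add: D_def dist_commute)
      moreover have "holes (pts segs)" using inv unfolding inv_def by (elim conjE)
      from this[unfolded holes_def, rule_format, OF v P(2,3) ne(5)]
      have "\<not> (dist l v < 3/8 * \<rho> \<and> dist a v < 3/8 * \<rho>)" unfolding \<rho>_def .
      ultimately show False by blast
    qed
    have "v \<in> S" using v Z_subset[of j] by (auto simp: sparse_def)
    then have "excess v p p' \<le> R / 100"
      unfolding R_def K_def
      by (rule excess_recents) (use p(2) p'(2) tri dp D R\<rho>(2) rj R in \<open>simp_all add: K_def\<close>)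
    \<comment> \<open>As \<open>a\<close> is nearest to \<open>v\<close> and
      \<open>dist p p'\<close> is almost \<open>dist p a + dist a p'\<close>, neither
      \<open>p\<close> nor \<open>p'\<close> is between \<open>v\<close> and the other. Nor is
      \<open>v\<close> between them: \<open>2 * D \<ge> 360 * R\<close>, while
      \<open>dist p p' \<le> 180 * R\<close>.\<close>
    then show ?thesis
      using near tri pp dp D4 R\<rho>(1) R unfolding excess_le_iff detour_def by (auto simp: dist_commute)
  qed
qed

section \<open>The removed mass and the surviving expanding set\<close>

lemma Z_sets: "Z k \<in> sets \<nu>"
proof (induction k)
  case 0
  show ?case using S_borel by (simp add: sets_nu)
next
  case (Suc k)
  then show ?case unfolding Z_Suc by (intro sets.Diff) (auto simp: sets_nu intro!: borel_open)
qed

text \<open>A removed point is close to a sparse point, hence to an end of a segment. So the removed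
  set lies in at most \<open>2 * length segs\<close> balls, and \<open>sparse_set_mass\<close>
  bounds its mass in each.\<close>

lemma removed_mass:
  assumes inv: "inv (j + 53) segs" and cov: "covers j segs0" "pts segs0 \<subseteq> pts segs"
  shows "measure \<nu> (Z j - Z (Suc j)) \<le> 120 * \<delta> * r (Suc j) * length segs"
proof -
  define \<rho> where "\<rho> = alpha * r (Suc j)"
  have rp: "0 < r (Suc j)" and rj: "r j = 3/2 * r (Suc j)" by (simp_all add: r_pos r_Suc)
  have \<rho>: "0 < \<rho>" "\<rho> / 2 \<le> r j / 10" using rp unfolding \<rho>_def rj by (simp_all add: alpha_def)
  define X where "X e = (Z j - Z (Suc j)) \<inter> cball e (18/10 * r (Suc j))" for e
  define E where "E = hd ` set segs \<union> last ` set segs"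
  have finE: "finite E" by (simp add: E_def)
  have Xs: "X e \<in> sets \<nu>" for e unfolding X_def using Z_sets by (intro sets.Int sets.Diff cball_sets)
  have cardE: "card E \<le> 2 * length segs"
  proof -
    have "card E \<le> card (hd ` set segs) + card (last ` set segs)" unfolding E_def by (rule card_Un_le)
    also have "\<dots> \<le> card (set segs) + card (set segs)" by (intro add_mono card_image_le) auto
    also have "\<dots> \<le> 2 * length segs" using card_length[of segs] by simp
    finally show ?thesis .
  qed
  have near: "\<exists>v\<in>sparse j. dist v x < \<rho> / 2" if "x \<in> Z j - Z (Suc j)" for x
    using that unfolding Z_Suc \<rho>_def by auto
  have "Z j - Z (Suc j) \<subseteq> (\<Union>e\<in>E. X e)"
  proof
    fix x assume x: "x \<in> Z j - Z (Suc j)"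
    then obtain v where v: "v \<in> sparse j" "dist v x < \<rho> / 2" using near by blast
    then have "v \<in> Z j" by (simp add: sparse_def)
    then obtain f where "f \<in> pts segs" "dist v f \<le> r j" using cov unfolding covers_def by blast
    from end_near_sparse[OF inv v(1) this]
    obtain e where e: "e \<in> E" "dist v e \<le> 11/10 * r j" unfolding E_def by blast
    have "dist e x \<le> 18/10 * r (Suc j)"
      using dist_triangle[of e x v] e(2) v(2) \<rho>(2) rj by (simp add: dist_commute)
    then show "x \<in> (\<Union>e\<in>E. X e)" using x e(1) unfolding X_def by auto
  qed
  then have "measure \<nu> (Z j - Z (Suc j)) \<le> measure \<nu> (\<Union>e\<in>E. X e)"
    by (intro finite_measure_mono sets.finite_UN Xs finE)
  also have "\<dots> \<le> (\<Sum>e\<in>E. measure \<nu> (X e))"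
    using Xs finE by (intro finite_measure_subadditive_finite) auto
  also have "\<dots> \<le> (\<Sum>e\<in>E. 60 * \<delta> * r (Suc j))"
  proof (rule sum_mono)
    fix e
    \<comment> \<open>With \<open>s = \<rho> / 2\<close> and \<open>R = 18/10 * r (Suc j)\<close>,
      the value of \<open>8 * R / s + 3\<close> is 28800003, and
      \<open>2 * 28800004 * alpha < 60\<close>.\<close>
    have "measure \<nu> (X e) \<le> 2 * real 28800004 * (\<delta> * \<rho>)"
    proof (rule sparse_set_mass[where x = e and s = "\<rho> / 2" and R = "18/10 * r (Suc j)"])
      show "X e \<in> sets \<nu>" by (rule Xs)
      show "X e \<subseteq> S" "X e \<subseteq> cball e (18/10 * r (Suc j))" using Z_subset[of j] by (auto simp: X_def)
      show "mball y (\<rho> / 2) \<le> \<delta> * \<rho>" if "y \<in> X e" for y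
      proof -
        have "y \<in> Z j - Z (Suc j)" using that unfolding X_def by (rule IntD1)
        from near[OF this] obtain v where v: "v \<in> sparse j" "dist v y < \<rho> / 2" by blast
        have "cball y (\<rho> / 2) \<subseteq> cball v \<rho>"
        proof
          fix z assume "z \<in> cball y (\<rho> / 2)"
          then show "z \<in> cball v \<rho>" using v(2) dist_triangle[of v z y] by simp
        qed
        then have "mball y (\<rho> / 2) \<le> mball v \<rho>" unfolding mball_def by (intro finite_measure_mono cball_sets)
        also have "\<dots> \<le> \<delta> * \<rho>" using v(1) by (simp add: sparse_def \<rho>_def mult.assoc)
        finally show ?thesis .
      qed
      show "0 < \<rho> / 2" "0 < 18/10 * r (Suc j)" "0 < \<delta> * \<rho>" using \<rho>(1) rp \<delta> by simp_all
      show "8 * (18/10 * r (Suc j)) / (\<rho> / 2) + 3 < real 28800004" using rp by (simp add: \<rho>_def alpha_def)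
      have "\<eta> \<le> \<delta>\<^sup>2 * alpha ^ 3 / 10 ^ 12" using small3 by simp
      also have "\<dots> \<le> \<delta>\<^sup>2 * alpha ^ 3 * (1 / (16 * (5832/100) * 115200016))"
        using alpha_pos unfolding divide_inverse by (intro mult_left_mono) simp_all
      also have "\<dots> = \<rho> / 2 / (80 * (18/10 * r (Suc j)) ^ 3) * (\<delta> * \<rho>)\<^sup>2 / (4 * real 28800004)"
        using rp by (simp add: \<rho>_def power2_eq_square power3_eq_cube field_simps)
      finally show "\<eta> \<le> \<rho> / 2 / (80 * (18/10 * r (Suc j)) ^ 3) * (\<delta> * \<rho>)\<^sup>2 / (4 * real 28800004)" .
    qed
    also have "\<dots> \<le> 60 * \<delta> * r (Suc j)" using rp \<delta> by (simp add: \<rho>_def alpha_def)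
    finally show "measure \<nu> (X e) \<le> 60 * \<delta> * r (Suc j)" .
  qed
  also have "\<dots> = real (card E) * (60 * \<delta> * r (Suc j))" by simp
  also have "\<dots> \<le> real (2 * length segs) * (60 * \<delta> * r (Suc j))"
    using cardE rp \<delta> by (intro mult_right_mono of_nat_mono) auto
  finally show ?thesis by (simp add: ac_simps)
qed

lemma exists_expanding_subset:
  obtains X where "X \<in> sets borel" "X \<subseteq> S" "0 < emeasure \<nu> X" "expands X"
proof -
  obtain p :: "nat \<Rightarrow> 'a list list" where p: "\<And>k. inv k (p k)" "\<And>k. covers k (p k)" "\<And>k. pts (p k) \<subseteq> pts (p (Suc k))"
    "\<And>k. psum dist (concat (p k)) \<le> 31 * r0" "\<And>n. (\<Sum>k<n. r (Suc k) * length (p (Suc k))) \<le> 31 * r0"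
    using exists_levels by blast
  have pts_mono: "pts (p k) \<subseteq> pts (p l)" if "k \<le> l" for k l
    using p(3) that by (rule lift_Suc_mono_le)
  define Q :: real where "Q = (3/2) ^ 52"
  define T where "T n = (\<Sum>j<n. measure \<nu> (Z j - Z (Suc j)))" for n
  have T: "T n \<le> r0 / 4" for n
  proof -
    \<comment> \<open>The loss at level \<open>j\<close> is charged to the segments of level
      \<open>j + 53\<close>, whose weighted numbers have a bounded sum. The factor \<open>Q\<close>
      between the scales is compensated by \<open>\<delta>\<close>.\<close>
    have "T n \<le> (\<Sum>j<n. 120 * \<delta> * Q * (r (Suc (j + 52)) * length (p (Suc (j + 52)))))"
      unfolding T_def
    proof (rule sum_mono)
      fix j
      have "r (Suc j) = Q * r (Suc (j + 52))"
        using r_add[of "Suc j" 52] by (simp add: Q_def power_divide)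
      moreover have "measure \<nu> (Z j - Z (Suc j)) \<le> 120 * \<delta> * r (Suc j) * length (p (j + 53))"
        by (rule removed_mass[OF p(1) p(2) pts_mono]) simp
      ultimately show "measure \<nu> (Z j - Z (Suc j)) \<le> 120 * \<delta> * Q * (r (Suc (j + 52)) * length (p (Suc (j + 52))))"
        by (simp add: ac_simps)
    qed
    also have "\<dots> = 120 * \<delta> * Q * (\<Sum>j<n. r (Suc (j + 52)) * length (p (Suc (j + 52))))"
      by (simp add: sum_distrib_left)
    also have "(\<Sum>j<n. r (Suc (j + 52)) * length (p (Suc (j + 52)))) = (\<Sum>k\<in>(\<lambda>j. j + 52) ` {..<n}. r (Suc k) * length (p (Suc k)))"
      by (subst sum.reindex) simp_all
    also have "\<dots> \<le> (\<Sum>k<n + 52. r (Suc k) * length (p (Suc k)))"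
      using r_pos by (intro sum_mono2) (auto simp: less_imp_le)
    also have "\<dots> \<le> 31 * r0" by (rule p(5))
    finally have 1: "T n \<le> 120 * \<delta> * Q * (31 * r0)" using \<delta> by (simp add: Q_def)
    have "20000 * Q * \<delta> * r0 \<le> 1 * r0" using small_delta r0 unfolding Q_def by (intro mult_right_mono) simp_all
    moreover have "20000 * Q * \<delta> * r0 = 20000 * (\<delta> * Q * r0)" "120 * \<delta> * Q * (31 * r0) = 3720 * (\<delta> * Q * r0)" by simp_all
    ultimately show ?thesis using 1 r0 by linarith
  qed
  have Zm: "measure \<nu> S \<le> measure \<nu> (Z n) + T n" for n
  proof (induction n)
    case (Suc n)
    have "measure \<nu> (Z n - Z (Suc n)) = measure \<nu> (Z n) - measure \<nu> (Z (Suc n))"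
      by (rule finite_measure_Diff) (rule Z_sets Z_antimono; simp)+
    then show ?case using Suc by (simp add: T_def)
  qed (simp add: T_def)
  have ge: "r0 / 4 \<le> measure \<nu> (Z n)" for n using Zm[of n] T[of n] mass_ge by linarith
  define X where "X = (\<Inter>n. Z n)"
  have "(\<lambda>n. measure \<nu> (Z n)) \<longlonglongrightarrow> measure \<nu> X"
    unfolding X_def using Z_sets Z_antimono by (intro finite_Lim_measure_decseq) (auto simp: decseq_def)
  then have "r0 / 4 \<le> measure \<nu> X" by (rule LIMSEQ_le_const) (use ge in blast)
  then have "0 < emeasure \<nu> X" using r0 by (simp add: emeasure_eq_measure)
  moreover have "X \<in> sets borel" unfolding X_def sets_nu[symmetric] using Z_sets by (intro sets.countable_INT) auto
  moreover have "X \<subseteq> S" unfolding X_def using Z_subset by blast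
  moreover have "expands X"
  proof (rule expands_if_approximable[where p = "\<lambda>k. concat (p k)" and r = r])
    show "psum dist (concat (p k)) \<le> 31 * r0" for k by (rule p(4))
    have "(\<lambda>k. r0 * (2/3) ^ k) \<longlonglongrightarrow> r0 * 0" by (intro tendsto_mult tendsto_const LIMSEQ_realpow_zero) auto
    then show "r \<longlonglongrightarrow> 0" by (simp add: r_def[abs_def])
    show "\<exists>x\<in>set (concat (p k)). dist z x \<le> r k" if "z \<in> X" for k z
      using p(2)[of k] that unfolding covers_def pts_def X_def by blast
  qed
  ultimately show thesis using that by blast
qed

end

section \<open>Rectifiability\<close>

lemma exists_expanding_piece:
  fixes R :: "'a::metric_space set"
  assumes beta: "menger_beta TYPE('a) < \<infinity>" and R: "R \<in> sets borel" "0 < hausdorff1 R" "hausdorff1 R < \<infinity>"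
  obtains X where "X \<in> sets borel" "X \<subseteq> R" "0 < hausdorff1 X" "expands X"
proof -
  \<comment> \<open>\<open>\<delta>\<close> comes first, to compensate 52 levels. It determines
    \<open>C\<close>, which will be \<open>C2\<close>, and the minimum collects the three demands on
    \<open>\<eta>\<close>.\<close>
  define \<delta> :: real where "\<delta> = 1 / (20000 * (3/2) ^ 52)"
  define C :: real where "C = 87 / (\<delta> * alpha)"
  define \<eta> where "\<eta> = min (1 / (100000 * (180 ^ 3 * C\<^sup>2) * C)) (min ((\<delta> * alpha)\<^sup>2 / (54000 * (3/2) ^ 159)) (\<delta>\<^sup>2 * alpha ^ 3 / 10 ^ 12))"
  have al: "0 < alpha" by (simp add: alpha_def)
  have \<delta>: "0 < \<delta>" "\<delta> \<le> 1" by (simp_all add: \<delta>_def power_divide)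
  have C: "0 < C" using \<delta>(1) al by (simp add: C_def)
  have \<eta>: "0 < \<eta>" using \<delta>(1) al C by (simp add: \<eta>_def)
  obtain A x0 r0 where A: "A \<in> sets borel" "A \<subseteq> R" and x0: "x0 \<in> A" "0 < r0" "A \<subseteq> cball x0 r0"
    and mass: "ennreal (r0 / 2) \<le> hausdorff1 A" "hausdorff1 A \<le> ennreal r0"
    and flat: "\<And>x. x \<in> A \<Longrightarrow> kernel1 (density hausdorff1_measure (indicator A)) {0<..} x \<le> ennreal \<eta>"
    using critical_piece[OF beta R \<eta>] by blast
  define \<nu> where "\<nu> = density (hausdorff1_measure :: 'a measure) (indicator A)"
  have sets: "sets \<nu> = sets borel" by (simp add: \<nu>_def)
  have em: "emeasure \<nu> X = hausdorff1 (A \<inter> X)" if "X \<in> sets borel" for X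
  proof -
    have "emeasure \<nu> X = (\<integral>\<^sup>+ x. indicator A x * indicator X x \<partial>hausdorff1_measure)"
      unfolding \<nu>_def using A(1) that by (intro emeasure_density) auto
    also have "\<dots> = emeasure hausdorff1_measure (A \<inter> X)"
      using A(1) that by (simp add: indicator_inter_arith[symmetric])
    finally show ?thesis using A(1) that by (simp add: emeasure_hausdorff1_measure)
  qed
  have fm: "flat_measure \<nu> A x0 r0 \<delta> \<eta>"
  proof
    show "emeasure \<nu> (- A) = 0" using A(1) by (subst em) auto
    show "emeasure \<nu> UNIV \<le> ennreal r0" using mass(2) by (simp add: em)
  qed (use sets A x0 \<delta> \<eta> flat in \<open>simp_all add: \<nu>_def\<close>)
  interpret fm: flat_measure \<nu> A x0 r0 \<delta> \<eta> by (rule fm)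
  have C2: "fm.C2 = C" by (simp add: fm.C2_def fm.N_def C_def)
  interpret flat_measure_final \<nu> A x0 r0 \<delta> \<eta>
  proof
    have "100000 * (180 ^ 3 * C\<^sup>2) * C * \<eta> \<le> 100000 * (180 ^ 3 * C\<^sup>2) * C * (1 / (100000 * (180 ^ 3 * C\<^sup>2) * C))"
      using C by (intro mult_left_mono) (simp_all add: \<eta>_def)
    also have "\<dots> = 1" using C by simp
    finally show "100000 * fm.C3 * fm.C2 * \<eta> \<le> 1" by (simp only: fm.C3_def C2)
    have "\<eta> \<le> (\<delta> * alpha)\<^sup>2 / (54000 * (3/2) ^ 159)" by (simp only: \<eta>_def min.coboundedI2 min.cobounded1)
    then show "54000 * (3/2) ^ 159 * \<eta> \<le> (\<delta> * alpha)\<^sup>2" by (subst mult.commute, subst (asm) pos_le_divide_eq) simp_all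
    have "\<eta> \<le> \<delta>\<^sup>2 * alpha ^ 3 / 10 ^ 12" by (simp only: \<eta>_def min.coboundedI2 min.cobounded2)
    then show "10 ^ 12 * \<eta> \<le> \<delta>\<^sup>2 * alpha ^ 3" by (subst mult.commute, subst (asm) pos_le_divide_eq) simp_all
    show "20000 * (3/2) ^ 52 * \<delta> \<le> 1" by (simp add: \<delta>_def)
    have "ennreal (r0 / 2) \<le> emeasure \<nu> A" using mass(1) A(1) by (simp add: em)
    then show "r0 / 2 \<le> measure \<nu> A" by (simp add: fm.emeasure_eq_measure ennreal_le_iff)
  qed
  obtain X where X: "X \<in> sets borel" "X \<subseteq> A" "0 < emeasure \<nu> X" "expands X" by (rule exists_expanding_subset)
  then have "0 < hausdorff1 X" by (simp add: em Int_absorb1)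
  then show thesis using that X A(2) by blast
qed

lemma expands_Un:
  fixes X Y :: "'a::metric_space set"
  assumes "expands X" "expands Y" shows "expands (X \<union> Y)"
proof -
  have "expands (\<Union>n. if n = (0::nat) then X else Y)" using assms by (intro expands_UN) simp
  moreover have "(\<Union>n. if n = (0::nat) then X else Y) = X \<union> Y" by (auto split: if_splits)
  ultimately show ?thesis by simp
qed

text \<open>Exhaustion: a Borel expanding subset of maximal measure leaves a null set.\<close>

lemma exists_expanding_conull:
  fixes C :: "'a::metric_space set"
  assumes beta: "menger_beta TYPE('a) < \<infinity>" and C: "C \<in> sets borel" "hausdorff1 C < \<infinity>"
  shows "\<exists>Y. expands Y \<and> hausdorff1 (C - Y) = 0"
proof -
  define F where "F = {Y \<in> sets borel. Y \<subseteq> C \<and> expands Y}"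
  have "F \<noteq> {}" by (auto simp: F_def expands_def intro!: exI[of _ "{}"])
  from ennreal_SUP_countable_SUP[OF this, of hausdorff1]
  obtain y :: "nat \<Rightarrow> ennreal" where y: "range y \<subseteq> hausdorff1 ` F" "(SUP Y\<in>F. hausdorff1 Y) = (SUP n. y n)"
    by (elim exE conjE)
  have "\<exists>Y. Y \<in> F \<and> y n = hausdorff1 Y" for n using y(1) by blast
  then obtain Y where Y: "\<And>n. Y n \<in> F" "\<And>n. y n = hausdorff1 (Y n)" by metis
  define U where "U = (\<Union>n::nat. Y n)"
  have U: "U \<in> F"
    using Y(1) expands_UN[of Y] unfolding U_def F_def by blast
  have le: "hausdorff1 Y' \<le> hausdorff1 U" if "Y' \<in> F" for Y'
  proof -
    have "hausdorff1 Y' \<le> (SUP n. y n)" unfolding y(2)[symmetric] using that by (rule SUP_upper)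
    also have "\<dots> \<le> hausdorff1 U" unfolding Y(2) U_def by (intro SUP_least hausdorff1_mono) blast
    finally show ?thesis .
  qed
  have "hausdorff1 (C - U) = 0"
  proof (rule ccontr)
    assume "hausdorff1 (C - U) \<noteq> 0"
    moreover have "hausdorff1 (C - U) < \<infinity>" using le_less_trans[OF hausdorff1_mono C(2)] by blast
    moreover have "C - U \<in> sets borel" using C(1) U by (auto simp: F_def)
    ultimately obtain X where X: "X \<in> sets borel" "X \<subseteq> C - U" "0 < hausdorff1 X" "expands X"
      using exists_expanding_piece[OF beta, of "C - U"] by (auto simp: zero_less_iff_neq_zero)
    have "emeasure hausdorff1_measure X + emeasure hausdorff1_measure U = emeasure hausdorff1_measure (X \<union> U)"
      using X U by (intro plus_emeasure) (auto simp: F_def)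
    then have "hausdorff1 X + hausdorff1 U = hausdorff1 (X \<union> U)"
      using X(1) U by (simp add: emeasure_hausdorff1_measure F_def sets.Un)
    also have "\<dots> \<le> hausdorff1 U" using X U by (intro le) (auto simp: F_def intro: expands_Un)
    finally have "hausdorff1 U + hausdorff1 X \<le> hausdorff1 U + 0" by (simp add: add.commute)
    moreover have "hausdorff1 U < \<infinity>" using U by (intro le_less_trans[OF hausdorff1_mono C(2)]) (simp add: F_def)
    ultimately show False using X(3) by (auto simp: ennreal_add_left_cancel_le)
  qed
  then show ?thesis using U by (auto simp: F_def)
qed

theorem theorem1p7:
  assumes "menger_beta TYPE('a::metric_space) < \<infinity>"
  shows "\<exists>(E :: real set) (f :: real \<Rightarrow> 'a).
           (\<exists>L. L-lipschitz_on E f) \<and> hausdorff1 (UNIV - f ` E) = 0"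
proof -
  obtain \<C> :: "'a set set" where \<C>: "countable \<C>" "\<And>C. C \<in> \<C> \<Longrightarrow> C \<in> sets borel"
    "\<And>C. C \<in> \<C> \<Longrightarrow> hausdorff1 C < \<infinity>" "hausdorff1 (- \<Union>\<C>) = 0"
    using sigma_finite_cover[OF assms] by blast
  \<comment> \<open>The empty set is added so that the enumeration is onto even if the cover is
    empty.\<close>
  define C where "C = from_nat_into (insert {} \<C>)"
  have range_C: "range C = insert {} \<C>" unfolding C_def using \<C>(1) by (intro range_from_nat_into) auto
  have "\<exists>Y. expands Y \<and> hausdorff1 (C n - Y) = 0" for n
  proof (rule exists_expanding_conull[OF assms])
    have "C n \<in> insert {} \<C>" using range_C by blast
    then show "C n \<in> sets borel" "hausdorff1 (C n) < \<infinity>" using \<C>(2,3) by auto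
  qed
  then obtain Y where Y: "\<And>n. expands (Y n)" "\<And>n. hausdorff1 (C n - Y n) = 0" by metis
  define Z where "Z = (\<Union>n. Y n)"
  have "expands Z" unfolding Z_def using Y(1) by (rule expands_UN)
  then obtain t :: "'a \<Rightarrow> real" where t: "\<And>z z'. z \<in> Z \<Longrightarrow> z' \<in> Z \<Longrightarrow> dist z z' \<le> \<bar>t z - t z'\<bar>"
    unfolding expands_def by blast
  have inj: "inj_on t Z"
  proof (rule inj_onI)
    fix z z' assume "z \<in> Z" "z' \<in> Z" "t z = t z'"
    then show "z = z'" using t[of z z'] by simp
  qed
  define f where "f = inv_into Z t"
  have "1-lipschitz_on (t ` Z) f"
    by (rule lipschitz_onI) (auto simp: f_def inv_into_f_f[OF inj] dist_real_def t)
  moreover have "f ` t ` Z = Z" unfolding f_def by (rule inv_into_image_cancel[OF inj]) simp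
  moreover have "hausdorff1 (UNIV - Z) = 0"
  proof -
    have "UNIV - Z \<subseteq> - \<Union>\<C> \<union> (\<Union>n. C n - Y n)"
    proof
      fix x assume x: "x \<in> UNIV - Z"
      show "x \<in> - \<Union>\<C> \<union> (\<Union>n. C n - Y n)"
      proof (cases "x \<in> \<Union>\<C>")
        case True
        then have "x \<in> \<Union>(range C)" unfolding range_C by blast
        then show ?thesis using x unfolding Z_def by blast
      qed simp
    qed
    then have "hausdorff1 (UNIV - Z) \<le> hausdorff1 (- \<Union>\<C> \<union> (\<Union>n. C n - Y n))" by (rule hausdorff1_mono)
    also have "\<dots> \<le> hausdorff1 (- \<Union>\<C>) + hausdorff1 (\<Union>n. C n - Y n)" by (rule hausdorff1_Un_le)
    also have "\<dots> \<le> 0 + (\<Sum>n. hausdorff1 (C n - Y n))"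
      by (intro add_mono hausdorff1_countably_subadditive) (simp add: \<C>(4))
    also have "\<dots> = 0" by (simp add: Y(2))
    finally show ?thesis by simp
  qed
  ultimately show ?thesis by (intro exI[of _ "t ` Z"] exI[of _ f]) auto
qed

end
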